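(* Let $G\subseteq\mathrm{GL}(n,\mathbb{R})$ be a linear Lie group, $d\ge 2$, and consider the system $$\dot X = X x_2,\quad \dot x_2 = x_3,\ \ldots,\ \dot x_{d-1}=x_d,\quad \dot x_d = u,\qquad Y = X,$$ with $X\in G$, $x_i\in\mathrm{Lie}(G)$ for $i=2,\dots,d$, and input $u:\mathbb{R}\to\mathrm{Lie}(G)$ smooth, uniformly bounded and locally Lipschitz. Let $a_0,\dots,a_{d-1}\in\mathbb{R}$ be such that $p(s)=s^d+a_{d-1}s^{d-1}+\cdots+a_1 s+a_0$ is Hurwitz, and consider the direct observer $$\dot{\hat X} = Y\hat x_2 Y^{-1}\hat X - a_{d-1}\hat X\log(Y^{-1}\hat X),$$ $$\dot{\hat x}_i = \hat x_{i+1} - a_{d-i}\log(Y^{-1}\hat X)\quad (2\le i\le d-1),\qquad \dot{\hat x}_d = u - a_0\log(Y^{-1}\hat X),$$ with estimates $\hat X\in G$ and $\hat x_i\in\mathrm{Lie}(G)$, $i=2,\dots,d$. Let $E_l := X^{-1}\hat X$ and $e_i := x_i-\hat x_i$, $i=2,\dots,d$. Then, for $(E_l(0),e_2(0),\dots,e_d(0))\in B(I_n,1)\times(\mathbb{R}^{n\times n})^{d-1}$, the direct observer exponentially stabilizes $(E_l,e_2,\dots,e_d)=(I_n,0_n,\dots,0_n)$. Furthermore, suppose that $u$ is such that for any initial condition $X(0)\in G$, $x_2(0),\dots,x_d(0)\in\mathrm{Lie}(G)$, the corresponding solution $(X(t),x_2(t),\dots,x_d(t))$ of the system is such that $X(t)$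 is bounded. Then the direct observer, which has access to the output $Y\in G$ and the input $u\in\mathrm{Lie}(G)$, is a state estimator with the following property: if $\|\hat X(0)-X(0)\|$, $\|\hat x_2(0)-x_2(0)\|$, $\ldots$, $\|\hat x_d(0)-x_d(0)\|$ are sufficiently small, then $\|\hat X(t)-X(t)\|\to0$, $\|\hat x_2(t)-x_2(t)\|\to 0$, $\ldots$, $\|\hat x_d(t)-x_d(t)\|\to0$ exponentially as $t\to\infty$.
   Context: A linear Lie group $G$ is a closed subgroup of $\mathrm{GL}(n,\mathbb{R})$, the group of invertible real $n\times n$ matrices; its Lie algebra is $\mathrm{Lie}(G)=\{A\in\mathbb{R}^{n\times n} : \exp(tA)\in G \text{ for all } t\in\mathbb{R}\}$. $\|\cdot\|$ is the matrix norm induced by the Euclidean norm, $I_n$ and $0_n$ are the $n\times n$ identity and zero matrices, and $B(A,r)=\{X\in\mathbb{R}^{n\times n}:\|A-X\|<r\}$. For a real matrix $X$ with no eigenvalue in $(-\infty,0]$, $\log(X)$ is the principal logarithm: the unique real $A$ with $\exp(A)=X$ whose eigenvalues all lie in $\{z\in\mathbb{C}:-\pi<\mathrm{Im}(z)<\pi\}$; for $X\in B(I_n,1)$ it is given by the convergent series $\sum_{k\ge1}\frac{(-1)^{k+1}}{k}(X-I_n)^k$. A polynomial is Hurwitz if all its roots have strictly negative real part.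
   Formalization: Exponential stabilization is proved locally: for initial errors (E_l(0),e_2(0),…,e_d(0)) in some small neighbourhood of (I_n,0_n,…,0_n), not on all of B(I_n,1)×(R^{n×n})^{d-1}, where the claim fails (e.g. for SO(2), d=2, with large e_2(0)). *)

theory Defs
  imports "HOL-Analysis.Analysis" "HOL-Computational_Algebra.Polynomial"
begin

section \<open>Real matrices: induced norm, exponential, principal logarithm\<close>

type_synonym 'n rmat = "real ^ 'n ^ 'n"

definition opnorm :: "'n::finite rmat \<Rightarrow> real" where
  "opnorm A = onorm (\<lambda>v. A *v v)"

definition opball :: "'n::finite rmat \<Rightarrow> real \<Rightarrow> 'n rmat set" where
  "opball A r = {X. opnorm (A - X) < r}"

definition mpow :: "'n::finite rmat \<Rightarrow> nat \<Rightarrow> 'n rmat" where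
  "mpow A k = (((**) A) ^^ k) (mat 1)"

text \<open>The library function \<open>exp\<close> is not available here, because the matrix type is not
  an instance of the class of real normed algebras.\<close>

definition mexp :: "'n::finite rmat \<Rightarrow> 'n rmat" where
  "mexp A = (\<Sum>k. (1 / fact k) *\<^sub>R mpow A k)"

definition complex_eigenvalue :: "'n::finite rmat \<Rightarrow> complex \<Rightarrow> bool" where
  "complex_eigenvalue A z \<longleftrightarrow>
     (\<exists>v :: complex ^ 'n. v \<noteq> 0 \<and> map_matrix complex_of_real A *v v = z *s v)"

definition log_domain :: "'n::finite rmat set" where
  "log_domain = {X. \<forall>z. complex_eigenvalue X z \<longrightarrow> \<not> (Im z = 0 \<and> Re z \<le> 0)}"

text \<open>Meaningful on \<open>log_domain\<close> only; the observer below is required to stay there.\<close>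

definition principal_log :: "'n::finite rmat \<Rightarrow> 'n rmat" where
  "principal_log X =
     (THE A. mexp A = X \<and> (\<forall>z. complex_eigenvalue A z \<longrightarrow> - pi < Im z \<and> Im z < pi))"


section \<open>Linear Lie groups\<close>

definition linear_lie_group :: "'n::finite rmat set \<Rightarrow> bool" where
  "linear_lie_group G \<longleftrightarrow>
     G \<subseteq> {A. invertible A} \<and> mat 1 \<in> G \<and>
     (\<forall>A\<in>G. \<forall>B\<in>G. A ** B \<in> G) \<and> (\<forall>A\<in>G. matrix_inv A \<in> G) \<and>
     closedin (top_of_set {A. invertible A}) G"

definition lie_algebra :: "'n::finite rmat set \<Rightarrow> 'n rmat set" where
  "lie_algebra G = {A. \<forall>t::real. mexp (t *\<^sub>R A) \<in> G}"


section \<open>Hurwitz polynomials and regularity of inputs\<close>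

definition hurwitz :: "real poly \<Rightarrow> bool" where
  "hurwitz p \<longleftrightarrow> (\<forall>z. poly (map_poly complex_of_real p) z = 0 \<longrightarrow> Re z < 0)"

definition monic_poly :: "nat \<Rightarrow> (nat \<Rightarrow> real) \<Rightarrow> real poly" where
  "monic_poly d a = monom 1 d + (\<Sum>i<d. monom (a i) i)"

text \<open>\<open>D k\<close> is the \<open>k\<close>-th derivative.\<close>

definition smooth_curve :: "(real \<Rightarrow> 'a::real_normed_vector) \<Rightarrow> bool" where
  "smooth_curve u \<longleftrightarrow>
     (\<exists>D :: nat \<Rightarrow> real \<Rightarrow> 'a. D 0 = u \<and>
        (\<forall>k t. (D k has_vector_derivative D (Suc k) t) (at t)))"

definition locally_lipschitz :: "(real \<Rightarrow> 'a::metric_space) \<Rightarrow> bool" where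
  "locally_lipschitz u \<longleftrightarrow> (\<forall>t. \<exists>r>0. \<exists>L. L-lipschitz_on (cball t r) u)"


section \<open>The system, the direct observer, and exponential stability\<close>

text \<open>A tuple \<open>(x_2, \<dots>, x_d)\<close> of curves is a function \<open>x\<close> of type \<open>nat \<Rightarrow> real \<Rightarrow> _\<close> of which
  only the indices in \<open>{2..d}\<close> matter. Solutions are considered for times \<open>t \<ge> 0\<close>.\<close>

definition system_solution ::
  "'n::finite rmat set \<Rightarrow> nat \<Rightarrow> (real \<Rightarrow> 'n rmat) \<Rightarrow>
   (real \<Rightarrow> 'n rmat) \<Rightarrow> (nat \<Rightarrow> real \<Rightarrow> 'n rmat) \<Rightarrow> bool" where
  "system_solution G d u X x \<longleftrightarrow>
     (\<forall>t\<ge>0.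
        X t \<in> G \<and> (\<forall>i\<in>{2..d}. x i t \<in> lie_algebra G) \<and>
        (X has_vector_derivative X t ** x 2 t) (at t within {0..}) \<and>
        (\<forall>i\<in>{2..<d}. (x i has_vector_derivative x (i + 1) t) (at t within {0..})) \<and>
        (x d has_vector_derivative u t) (at t within {0..}))"

definition observer_solution ::
  "'n::finite rmat set \<Rightarrow> nat \<Rightarrow> (nat \<Rightarrow> real) \<Rightarrow> (real \<Rightarrow> 'n rmat) \<Rightarrow> (real \<Rightarrow> 'n rmat) \<Rightarrow>
   (real \<Rightarrow> 'n rmat) \<Rightarrow> (nat \<Rightarrow> real \<Rightarrow> 'n rmat) \<Rightarrow> bool" where
  "observer_solution G d a u Y Xh xh \<longleftrightarrow>
     (\<forall>t\<ge>0.
        Xh t \<in> G \<and> (\<forall>i\<in>{2..d}. xh i t \<in> lie_algebra G) \<and>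
        matrix_inv (Y t) ** Xh t \<in> log_domain \<and>
        (Xh has_vector_derivative
           (Y t ** xh 2 t ** matrix_inv (Y t) ** Xh t
             - a (d - 1) *\<^sub>R (Xh t ** principal_log (matrix_inv (Y t) ** Xh t))))
          (at t within {0..}) \<and>
        (\<forall>i\<in>{2..<d}. (xh i has_vector_derivative
           (xh (i + 1) t - a (d - i) *\<^sub>R principal_log (matrix_inv (Y t) ** Xh t)))
          (at t within {0..})) \<and>
        (xh d has_vector_derivative
           (u t - a 0 *\<^sub>R principal_log (matrix_inv (Y t) ** Xh t)))
          (at t within {0..}))"

definition group_error :: "'n::finite rmat \<Rightarrow> 'n rmat \<Rightarrow> 'n rmat" where
  "group_error X Xh = matrix_inv X ** Xh"

definition equilibrium_distance :: "nat \<Rightarrow> 'n::finite rmat \<Rightarrow> (nat \<Rightarrow> 'n rmat) \<Rightarrow> real" where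
  "equilibrium_distance d E e = opnorm (E - mat 1) + (\<Sum>i=2..d. opnorm (e i))"

text \<open>Exponential stability of the equilibrium \<open>(I, 0, \<dots>, 0)\<close> of the error dynamics,
  with initial errors taken from \<open>S\<close>. As usual for an equilibrium of a nonlinear system, this is
  a local notion: some neighbourhood of radius \<open>\<delta>\<close> is attracted, uniformly over all trajectories of
  the observed system, and the observer exists there for all future times. All of
  \<open>B(I,1) \<times> (real^'n^'n)^(d-1)\<close> cannot be attracted: for \<open>G = {(3/2)^k | k \<in> \<int>}\<close> the Lie algebra is zero, and an observer
  started in \<open>G\<close> with error \<open>3/2\<close> cannot stay in \<open>G\<close>; for the rotation group of the plane, a large
  initial error \<open>e_2\<close> drives the group error to a rotation by \<open>\<pi>\<close>, where the logarithm is
  undefined.\<close>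

definition exponentially_stabilizes ::
  "'n::finite rmat set \<Rightarrow> nat \<Rightarrow> (nat \<Rightarrow> real) \<Rightarrow> (real \<Rightarrow> 'n rmat) \<Rightarrow>
   ('n rmat \<times> (nat \<Rightarrow> 'n rmat)) set \<Rightarrow> bool" where
  "exponentially_stabilizes G d a u S \<longleftrightarrow>
     (\<exists>\<delta>>0. \<exists>M>0. \<exists>\<kappa>>0. \<forall>X x Xh0 xh0.
        system_solution G d u X x \<and>
        Xh0 \<in> G \<and> (\<forall>i\<in>{2..d}. xh0 i \<in> lie_algebra G) \<and>
        (group_error (X 0) Xh0, \<lambda>i. x i 0 - xh0 i) \<in> S \<and>
        equilibrium_distance d (group_error (X 0) Xh0) (\<lambda>i. x i 0 - xh0 i) < \<delta> \<longrightarrow>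
        (\<exists>Xh xh. observer_solution G d a u X Xh xh \<and>
           Xh 0 = Xh0 \<and> (\<forall>i\<in>{2..d}. xh i 0 = xh0 i)) \<and>
        (\<forall>Xh xh. observer_solution G d a u X Xh xh \<and>
           Xh 0 = Xh0 \<and> (\<forall>i\<in>{2..d}. xh i 0 = xh0 i) \<longrightarrow>
           (\<forall>t\<ge>0. equilibrium_distance d (group_error (X t) (Xh t)) (\<lambda>i. x i t - xh i t)
              \<le> M * exp (- \<kappa> * t) *
                equilibrium_distance d (group_error (X 0) Xh0) (\<lambda>i. x i 0 - xh0 i))))"

definition exponentially_vanishes :: "(real \<Rightarrow> real) \<Rightarrow> bool" where
  "exponentially_vanishes f \<longleftrightarrow> (\<exists>M>0. \<exists>\<kappa>>0. \<forall>t\<ge>0. \<bar>f t\<bar> \<le> M * exp (- \<kappa> * t))"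

end

theory Submission
  imports Defs "HOL-Computational_Algebra.Fundamental_Theorem_Algebra" "HOL-Probability.Discrete_Topology"
begin

text \<open>
  The error system is autonomous. With \<open>E = X\<^sup>-\<^sup>1 Xh\<close> the true state cancels: \<open>E' = - e\<^sub>2 E - a\<^sub>d\<^sub>-\<^sub>1 E log E\<close>,
  \<open>e\<^sub>i' = e\<^sub>i\<^sub>+\<^sub>1 + a\<^sub>d\<^sub>-\<^sub>i log E\<close> and \<open>e\<^sub>d' = a\<^sub>0 log E\<close> (lemmas \<open>observer_solution_error\<close> and, conversely,
  \<open>observer_of_error\<close>). In the coordinates \<open>z\<^sub>d\<^sub>-\<^sub>1 = E - 1\<close>, \<open>z\<^sub>d\<^sub>-\<^sub>i = - e\<^sub>i\<close> the linearisation is multiplication by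
  the variable on polynomials modulo the Hurwitz polynomial, applied to every matrix entry separately, and
  the remainder is quadratic because \<open>log E - (E - 1)\<close> is.

  In the Newton basis attached to the roots that multiplication is bidiagonal with the roots on the
  diagonal, so rescaled Newton coordinates give a quadratic Lyapunov function (\<open>lyapunov_form\<close>). It absorbs the
  quadratic remainder near the equilibrium, which yields a uniform exponential bound for every solution
  of the error system starting there (\<open>exponential_decay\<close>).

  Projecting the arguments of the remainder to a small ball makes the field globally Lipschitz, so Picard
  iteration gives a global solution; by the decay bound it never leaves the ball (\<open>error_dynamics\<close>).
  An observer must also stay in \<open>G\<close> and its Lie algebra. This follows from a comparison with one-step
  approximations inside the invariant set (\<open>invariance\<close>), which needs that the Lie algebra is a linear space and contains \<open>log E\<close> for \<open>E \<in> G\<close> near the identity, that is, the closed subgroup theorem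
  (\<open>tangent_in_lie_algebra\<close>, \<open>subspace_lie_algebra\<close>, \<open>log_in_lie_algebra\<close>).

  Near the identity \<open>exp\<close> is inverted by a contraction. That this inverse is the
  principal logarithm means uniqueness of a logarithm with spectrum in the strip, which is
  proved with a common eigenvector of commuting matrices (\<open>principal_log_eqI\<close>).

  The second claim follows from the first because \<open>Xh - X = X (E - 1)\<close> and \<open>X\<close> is bounded.
\<close>

section \<open>Norms of matrices\<close>

lemma norm_matrix_vector_mult_le: "norm (A *v v) \<le> norm A * norm (v::real^'n::finite)"
  for A :: "real^'n^'m::finite"
proof -
  have "(A *v v) $ i = A $ i \<bullet> v" for i
    by (simp add: matrix_vector_mult_def inner_vec_def)
  then have "\<bar>(A *v v) $ i\<bar> \<le> norm (A $ i) * norm v" for i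
    by (simp add: Cauchy_Schwarz_ineq2)
  then have "norm (A *v v) \<le> L2_set (\<lambda>i. norm (A $ i) * norm v) UNIV"
    unfolding norm_vec_def[of "A *v v"] by (intro L2_set_mono) auto
  also have "\<dots> = norm A * norm v"
    unfolding norm_vec_def[of A] by (simp add: L2_set_left_distrib)
  finally show ?thesis .
qed

lemma norm_matrix_transpose: "norm (transpose A) = norm A" for A :: "real^'n::finite^'m::finite"
proof -
  have "(\<Sum>i\<in>UNIV. \<Sum>j\<in>UNIV. (A $ j $ i)\<^sup>2) = (\<Sum>i\<in>UNIV. \<Sum>j\<in>UNIV. (A $ i $ j)\<^sup>2)"
    by (rule sum.swap)
  then show ?thesis
    by (simp add: norm_eq_sqrt_inner inner_vec_def transpose_def power2_eq_square)
qed

lemma norm_matrix_mult_le: "norm (A ** B) \<le> norm A * norm B" for A B :: "real^'n::finite^'n"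
proof -
  have "(A ** B) $ i = transpose B *v (A $ i)" for i
    by (simp add: vec_eq_iff matrix_matrix_mult_def matrix_vector_mult_def transpose_def mult.commute)
  then have "norm ((A ** B) $ i) \<le> norm (A $ i) * norm B" for i
    using norm_matrix_vector_mult_le[of "transpose B" "A $ i"] by (simp add: norm_matrix_transpose mult.commute)
  then have "norm (A ** B) \<le> L2_set (\<lambda>i. norm (A $ i) * norm B) UNIV"
    unfolding norm_vec_def[of "A ** B"] by (intro L2_set_mono) auto
  also have "\<dots> = norm A * norm B"
    unfolding norm_vec_def[of A] by (simp add: L2_set_left_distrib)
  finally show ?thesis .
qed

lemma bounded_bilinear_matrix_mult: "bounded_bilinear ((**) :: real^'n::finite^'n \<Rightarrow> real^'n^'n \<Rightarrow> real^'n^'n)"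
proof
  fix A B C :: "real^'n^'n" and r :: real
  show "(A + B) ** C = A ** C + B ** C" "A ** (B + C) = A ** B + A ** C"
    by (simp_all add: vec_eq_iff matrix_matrix_mult_def algebra_simps sum.distrib)
  show "(r *\<^sub>R A) ** B = r *\<^sub>R (A ** B)" "A ** (r *\<^sub>R B) = r *\<^sub>R (A ** B)"
    by (simp_all add: vec_eq_iff matrix_matrix_mult_def algebra_simps sum_distrib_left)
  show "\<exists>K. \<forall>(A :: real^'n^'n) (B :: real^'n^'n). norm (A ** B) \<le> norm A * norm B * K"
    by (rule exI[of _ 1]) (simp add: norm_matrix_mult_le)
qed

interpretation mm: bounded_bilinear "(**) :: real^'n::finite^'n \<Rightarrow> real^'n^'n \<Rightarrow> real^'n^'n"
  by (rule bounded_bilinear_matrix_mult)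

lemma opnorm_le_norm: "opnorm A \<le> norm A" for A :: "real^'n::finite^'n"
  unfolding opnorm_def by (intro onorm_le norm_matrix_vector_mult_le)

lemma opnorm_nonneg: "0 \<le> opnorm A" for A :: "real^'n::finite^'n"
  unfolding opnorm_def by (intro onorm_pos_le) simp

lemma norm_le_opnorm: "norm A \<le> (real CARD('n))\<^sup>2 * opnorm A" for A :: "real^'n::finite^'n"
proof -
  have "norm A \<le> (\<Sum>i\<in>UNIV. norm (A $ i))" unfolding norm_vec_def by (rule L2_set_le_sum) simp
  also have "\<dots> \<le> (\<Sum>i\<in>(UNIV::'n set). \<Sum>j\<in>(UNIV::'n set). \<bar>A $ i $ j\<bar>)"
    by (intro sum_mono norm_le_l1_cart)
  also have "\<dots> \<le> (\<Sum>i\<in>(UNIV::'n set). \<Sum>j\<in>(UNIV::'n set). opnorm A)"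
    unfolding opnorm_def by (intro sum_mono matrix_component_le_onorm)
  finally show ?thesis by (simp add: power2_eq_square)
qed

lemma opnorm_mult_le: "opnorm (A ** B) \<le> opnorm A * opnorm B" for A B :: "real^'n::finite^'n"
  unfolding opnorm_def
  using onorm_compose[of "\<lambda>v. A *v v" "\<lambda>v. B *v v"] by (simp add: o_def matrix_vector_mul_assoc)

section \<open>Square matrices as a Banach algebra\<close>

text \<open>A copy of the matrix type that carries the multiplication and norm of a Banach algebra. Its purpose is the
  product rule for exponentials of commuting elements.\<close>

typedef 'n sqmat = "UNIV :: (real^'n::finite^'n) set"
  morphisms mat_of Sqmat ..

setup_lifting type_definition_sqmat

instantiation sqmat :: (finite) real_normed_algebra_1
begin
lift_definition zero_sqmat :: "'a sqmat" is 0 .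
lift_definition one_sqmat :: "'a sqmat" is "mat 1" .
lift_definition plus_sqmat :: "'a sqmat \<Rightarrow> 'a sqmat \<Rightarrow> 'a sqmat" is "(+)" .
lift_definition minus_sqmat :: "'a sqmat \<Rightarrow> 'a sqmat \<Rightarrow> 'a sqmat" is "(-)" .
lift_definition uminus_sqmat :: "'a sqmat \<Rightarrow> 'a sqmat" is "uminus" .
lift_definition times_sqmat :: "'a sqmat \<Rightarrow> 'a sqmat \<Rightarrow> 'a sqmat" is "(**)" .
lift_definition scaleR_sqmat :: "real \<Rightarrow> 'a sqmat \<Rightarrow> 'a sqmat" is "(*\<^sub>R)" .
lift_definition norm_sqmat :: "'a sqmat \<Rightarrow> real" is opnorm .
definition dist_sqmat :: "'a sqmat \<Rightarrow> 'a sqmat \<Rightarrow> real" where "dist_sqmat A B = norm (A - B)"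
definition sgn_sqmat :: "'a sqmat \<Rightarrow> 'a sqmat" where "sgn_sqmat A = inverse (norm A) *\<^sub>R A"
definition uniformity_sqmat :: "('a sqmat \<times> 'a sqmat) filter" where
  "uniformity_sqmat = (INF e\<in>{0<..}. principal {(x, y). dist (x::'a sqmat) y < e})"
definition open_sqmat :: "'a sqmat set \<Rightarrow> bool" where
  "open_sqmat U = (\<forall>x\<in>U. eventually (\<lambda>(x', y). x' = x \<longrightarrow> y \<in> U) uniformity)"

instance
proof
  fix A B C :: "'a sqmat" and r s :: real
  show "A + B + C = A + (B + C)" "A + B = B + A" "0 + A = A" "- A + A = 0" "A - B = A + - B"
    by (transfer; simp)+
  show "r *\<^sub>R (A + B) = r *\<^sub>R A + r *\<^sub>R B" "(r + s) *\<^sub>R A = r *\<^sub>R A + s *\<^sub>R A"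
    "r *\<^sub>R s *\<^sub>R A = (r * s) *\<^sub>R A" "1 *\<^sub>R A = A"
    by (transfer; simp add: scaleR_add_right scaleR_add_left)+
  show "A * B * C = A * (B * C)" by transfer (simp add: matrix_mul_assoc)
  show "(A + B) * C = A * C + B * C" "A * (B + C) = A * B + A * C"
    "r *\<^sub>R A * B = r *\<^sub>R (A * B)" "A * r *\<^sub>R B = r *\<^sub>R (A * B)"
    by (transfer; simp add: mm.add_left mm.add_right mm.scaleR_left mm.scaleR_right)+
  show "1 * A = A" "A * 1 = A" by (transfer; simp)+
  have "(mat 1 :: real^'a^'a) \<noteq> 0"
    by (simp add: vec_eq_iff mat_def) 
  then show "(0::'a sqmat) \<noteq> 1" by transfer simp
  show "dist A B = norm (A - B)" by (rule dist_sqmat_def)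
  show "sgn A = inverse (norm A) *\<^sub>R A" by (rule sgn_sqmat_def)
  show "uniformity = (INF e\<in>{0<..}. principal {(x, y). dist (x::'a sqmat) y < e})"
    by (rule uniformity_sqmat_def)
  show "open U = (\<forall>x\<in>U. eventually (\<lambda>(x', y). x' = x \<longrightarrow> y \<in> U) uniformity)"
    for U :: "'a sqmat set" by (rule open_sqmat_def)
  show "norm A = 0 \<longleftrightarrow> A = 0"
  proof transfer
    fix A :: "real^'a^'a"
    show "opnorm A = 0 \<longleftrightarrow> A = 0"
      using norm_le_opnorm[of A] opnorm_le_norm[of A] opnorm_nonneg[of A] by auto
  qed
  show "norm (A + B) \<le> norm A + norm B"
    by transfer (simp add: opnorm_def matrix_vector_mult_add_rdistrib onorm_triangle)
  show "norm (r *\<^sub>R A) = \<bar>r\<bar> * norm A"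
    by transfer (simp add: opnorm_def scaleR_matrix_vector_assoc[symmetric] onorm_scaleR)
  show "norm (A * B) \<le> norm A * norm B" by transfer (rule opnorm_mult_le)
  show "norm (1::'a sqmat) = 1" by transfer (simp add: opnorm_def onorm_id)
qed
end

lemma bounded_linear_mat_of: "bounded_linear (mat_of :: 'n::finite sqmat \<Rightarrow> _)"
proof (rule bounded_linear_intro[where K = "(real CARD('n))\<^sup>2"])
  fix A B :: "'n sqmat" and r :: real
  show "mat_of (A + B) = mat_of A + mat_of B" by (rule plus_sqmat.rep_eq)
  show "mat_of (r *\<^sub>R A) = r *\<^sub>R mat_of A" by (rule scaleR_sqmat.rep_eq)
  show "norm (mat_of A) \<le> norm A * (real CARD('n))\<^sup>2"
    using norm_le_opnorm[of "mat_of A"] by (simp only: norm_sqmat.rep_eq mult.commute)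
qed

lemma bounded_linear_Sqmat: "bounded_linear (Sqmat :: _ \<Rightarrow> 'n::finite sqmat)"
proof (rule bounded_linear_intro[where K = 1])
  fix A B :: "real^'n^'n" and r :: real
  show "Sqmat (A + B) = Sqmat A + Sqmat B" by (rule plus_sqmat.abs_eq[symmetric])
  show "Sqmat (r *\<^sub>R A) = r *\<^sub>R Sqmat A" by (rule scaleR_sqmat.abs_eq[symmetric])
  show "norm (Sqmat A) \<le> norm A * 1" by (simp only: norm_sqmat.abs_eq mult_1_right opnorm_le_norm)
qed

instance sqmat :: (finite) banach
proof
  fix X :: "nat \<Rightarrow> 'a sqmat"
  assume "Cauchy X"
  then have "Cauchy (\<lambda>k. mat_of (X k))"
    using bounded_linear.Cauchy[OF bounded_linear_mat_of] by blast
  then obtain L where "(\<lambda>k. mat_of (X k)) \<longlonglongrightarrow> L"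
    using Cauchy_convergent convergent_def by blast
  then have "(\<lambda>k. Sqmat (mat_of (X k))) \<longlonglongrightarrow> Sqmat L"
    by (rule bounded_linear.tendsto[OF bounded_linear_Sqmat])
  then show "convergent X" by (auto simp: mat_of_inverse convergent_def)
qed

section \<open>The exponential in a Banach algebra\<close>

lemma norm_power_diff_le:
  fixes x y :: "'a::real_normed_algebra_1"
  assumes "norm x \<le> r" "norm y \<le> r"
  shows "norm (x ^ Suc k - y ^ Suc k) \<le> real (Suc k) * r ^ k * norm (x - y)"
proof (induction k)
  case 0 show ?case by simp
next
  case (Suc k)
  have r: "0 \<le> r" using assms norm_ge_zero order_trans by blast
  have "x ^ Suc (Suc k) - y ^ Suc (Suc k) = x * (x ^ Suc k - y ^ Suc k) + (x - y) * y ^ Suc k"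
    by (simp add: algebra_simps)
  also have "norm \<dots> \<le> norm x * norm (x ^ Suc k - y ^ Suc k) + norm (x - y) * norm (y ^ Suc k)"
    by (intro norm_triangle_le add_mono norm_mult_ineq)
  also have "\<dots> \<le> r * (real (Suc k) * r ^ k * norm (x - y)) + norm (x - y) * r ^ Suc k"
    using r assms by (intro add_mono mult_mono Suc order_trans[OF norm_power_ineq] power_mono) auto
  also have "\<dots> = real (Suc (Suc k)) * r ^ Suc k * norm (x - y)"
    by (simp add: algebra_simps)
  finally show ?case .
qed

text \<open>Subtracting the identity leaves a map with small Lipschitz constant near zero. Inverting the exponential, and every
  first-order estimate of exponentials and logarithms below, rests on this.\<close>

lemma norm_exp_diff_le:
  fixes x y :: "'a::{real_normed_algebra_1,banach}"
  assumes "norm x \<le> r" "norm y \<le> r"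
  shows "norm (exp x - exp y - (x - y)) \<le> (exp r - 1) * norm (x - y)"
proof -
  have "(\<lambda>k. (x ^ k - y ^ k) /\<^sub>R fact k) sums (exp x - exp y)"
    using sums_diff[OF exp_converges[of x] exp_converges[of y]] by (simp add: scaleR_diff_right)
  then have "(\<lambda>k. (x ^ Suc k - y ^ Suc k) /\<^sub>R fact (Suc k)) sums (exp x - exp y)"
    by (subst sums_Suc_iff) simp
  then have s1: "(\<lambda>k. (x ^ Suc (Suc k) - y ^ Suc (Suc k)) /\<^sub>R fact (Suc (Suc k))) sums (exp x - exp y - (x - y))"
    by (subst sums_Suc_iff) simp
  have "(\<lambda>k. r ^ k /\<^sub>R fact k) sums exp r" by (rule exp_converges)
  then have "(\<lambda>k. r ^ Suc k /\<^sub>R fact (Suc k)) sums (exp r - 1)"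
    by (subst sums_Suc_iff) simp
  then have s2: "(\<lambda>k. (r ^ Suc k /\<^sub>R fact (Suc k)) * norm (x - y)) sums ((exp r - 1) * norm (x - y))"
    by (rule sums_mult2)
  have "norm ((x ^ Suc (Suc k) - y ^ Suc (Suc k)) /\<^sub>R fact (Suc (Suc k)))
      \<le> (r ^ Suc k /\<^sub>R fact (Suc k)) * norm (x - y)" for k
  proof -
    have "norm ((x ^ Suc (Suc k) - y ^ Suc (Suc k)) /\<^sub>R fact (Suc (Suc k)))
      \<le> (real (Suc (Suc k)) * r ^ Suc k * norm (x - y)) / fact (Suc (Suc k))"
      using norm_power_diff_le[OF assms, of "Suc k"]
      by (simp add: divide_simps del: power_Suc fact_Suc of_nat_Suc)
    also have "\<dots> = (r ^ Suc k /\<^sub>R fact (Suc k)) * norm (x - y)"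
      unfolding fact_Suc[of "Suc k"] by (simp add: field_simps del: power_Suc fact_Suc of_nat_Suc)
    finally show ?thesis .
  qed
  then show ?thesis
    using norm_suminf_le[OF _ sums_summable[OF s2]] s1 s2 by (metis (no_types, lifting) sums_unique)
qed

section \<open>The matrix exponential\<close>

lemma mat_of_power: "mat_of (Sqmat A ^ k) = mpow A k"
  by (induction k) (simp_all add: mpow_def one_sqmat.rep_eq times_sqmat.rep_eq Sqmat_inverse)

lemma mexp_sums: "(\<lambda>k. (1 / fact k) *\<^sub>R mpow A k) sums mat_of (exp (Sqmat A))"
proof -
  have "(\<lambda>k. mat_of (Sqmat A ^ k /\<^sub>R fact k)) sums mat_of (exp (Sqmat A))"
    by (rule bounded_linear.sums[OF bounded_linear_mat_of exp_converges])
  then show ?thesis by (simp add: scaleR_sqmat.rep_eq mat_of_power inverse_eq_divide)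
qed

lemma mexp_eq: "mexp A = mat_of (exp (Sqmat A))"
  unfolding mexp_def using mexp_sums by (rule sums_unique[symmetric])

lemma mexp_0 [simp]: "mexp 0 = mat 1"
  by (simp add: mexp_eq zero_sqmat.abs_eq[symmetric] one_sqmat.rep_eq)

lemma mexp_add:
  assumes "A ** B = B ** A" shows "mexp (A + B) = mexp A ** mexp B"
proof -
  have "Sqmat A * Sqmat B = Sqmat B * Sqmat A"
    using assms by (simp add: times_sqmat.abs_eq)
  from exp_add_commuting[OF this] show ?thesis
    by (simp add: mexp_eq plus_sqmat.abs_eq times_sqmat.rep_eq)
qed

lemma mpow_commute: assumes "A ** B = B ** A" shows "mpow A k ** B = B ** mpow A k"
  by (induction k) (auto simp: mpow_def matrix_mul_assoc[symmetric] assms, simp add: matrix_mul_assoc assms)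

lemma mexp_commute: assumes "A ** B = B ** A" shows "mexp A ** B = B ** mexp A"
proof -
  have eq: "(\<lambda>k. ((1 / fact k) *\<^sub>R mpow A k) ** B) = (\<lambda>k. B ** ((1 / fact k) *\<^sub>R mpow A k))"
    by (simp add: mm.scaleR_left mm.scaleR_right mpow_commute[OF assms])
  have "(\<lambda>k. ((1 / fact k) *\<^sub>R mpow A k) ** B) sums (mexp A ** B)"
    unfolding mexp_eq by (rule bounded_linear.sums[OF mm.bounded_linear_left mexp_sums])
  moreover have "(\<lambda>k. B ** ((1 / fact k) *\<^sub>R mpow A k)) sums (B ** mexp A)"
    unfolding mexp_eq by (rule bounded_linear.sums[OF mm.bounded_linear_right mexp_sums])
  ultimately show ?thesis unfolding eq by (rule sums_unique2)
qed

lemma mexp_minus: "mexp (- A) ** mexp A = mat 1" "mexp A ** mexp (- A) = mat 1"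
  using mexp_add[of "- A" A] mexp_add[of A "- A"] by (simp_all add: mm.minus_left mm.minus_right)

lemma mexp_diff_le:
  obtains c where "c \<ge> 1"
    "\<And>A B :: real^'n::finite^'n. \<And>r. norm A \<le> r \<Longrightarrow> norm B \<le> r \<Longrightarrow> r \<le> 1 \<Longrightarrow>
       norm (mexp A - mexp B - (A - B)) \<le> c * r * norm (A - B)"
proof
  define c where "c = 2 * (real CARD('n))\<^sup>2"
  show "c \<ge> 1" by (simp add: c_def) (metis One_nat_def Suc_leI le_add_same_cancel1 mult_2 of_nat_1 of_nat_mono one_le_power order_trans zero_le_one zero_less_card_finite)
  fix A B :: "real^'n^'n" and r
  assume *: "norm A \<le> r" "norm B \<le> r" "r \<le> 1"
  then have r: "0 \<le> r" using norm_ge_zero order_trans by blast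
  have "exp r \<le> 1 + r + r\<^sup>2" using r * by (simp add: exp_bound)
  also have "\<dots> \<le> 1 + 2 * r" using r * by (simp add: power2_eq_square mult_left_le)
  finally have er: "exp r - 1 \<le> 2 * r" by simp
  have "norm (Sqmat A) \<le> r" "norm (Sqmat B) \<le> r"
    using * opnorm_le_norm order_trans by (auto simp: norm_sqmat.abs_eq)
  from norm_exp_diff_le[OF this]
  have "opnorm (mexp A - mexp B - (A - B)) \<le> (exp r - 1) * opnorm (A - B)"
    by (simp add: norm_sqmat.rep_eq minus_sqmat.rep_eq mexp_eq Sqmat_inverse)
  also have "\<dots> \<le> (2 * r) * norm (A - B)"
    using r by (intro mult_mono er opnorm_le_norm opnorm_nonneg) auto
  finally have "(real CARD('n))\<^sup>2 * opnorm (mexp A - mexp B - (A - B)) \<le> (real CARD('n))\<^sup>2 * ((2 * r) * norm (A - B))"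
    by (intro mult_left_mono) auto
  then show "norm (mexp A - mexp B - (A - B)) \<le> c * r * norm (A - B)"
    by (intro order_trans[OF norm_le_opnorm]) (simp only: c_def mult_ac)
qed

section \<open>Complex eigenvectors of commuting matrices\<close>

definition poly_act :: "complex^'n::finite^'n \<Rightarrow> complex poly \<Rightarrow> complex^'n \<Rightarrow> complex^'n" where
  "poly_act M p x = (\<Sum>i\<le>degree p. coeff p i *s ((*v) M ^^ i) x)"

lemma poly_act_upto:
  assumes "degree p \<le> N" shows "poly_act M p x = (\<Sum>i\<le>N. coeff p i *s ((*v) M ^^ i) x)"
  unfolding poly_act_def using assms
  by (intro sum.mono_neutral_left) (auto simp: coeff_eq_0)

lemma poly_act_linear_factor:
  "poly_act M ([:-z, 1:] * q) x = M *v poly_act M q x - z *s poly_act M q x"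
proof -
  let ?f = "\<lambda>i. ((*v) M ^^ i) x"
  have "poly_act M ([:-z, 1:] * q) x = (\<Sum>i\<le>Suc (degree q). coeff ([:-z, 1:] * q) i *s ?f i)"
    by (intro poly_act_upto order_trans[OF degree_mult_le]) simp
  also have "\<dots> = (\<Sum>i\<le>Suc (degree q). coeff (pCons 0 q) i *s ?f i) - z *s (\<Sum>i\<le>Suc (degree q). coeff q i *s ?f i)"
    by (simp only: vec.scale_sum_right sum_subtractf[symmetric])
      (intro sum.cong, simp_all add: vec.scale_left_diff_distrib)
  also have "(\<Sum>i\<le>Suc (degree q). coeff (pCons 0 q) i *s ?f i) = (\<Sum>i\<le>degree q. coeff q i *s ?f (Suc i))"
    by (subst sum.atMost_Suc_shift) simp
  also have "\<dots> = M *v poly_act M q x"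
    by (simp add: poly_act_def vec.linear_sum[OF matrix_vector_mul_linear_gen] vector_scalar_commute)
  also have "(\<Sum>i\<le>Suc (degree q). coeff q i *s ?f i) = poly_act M q x"
    by (intro poly_act_upto[symmetric]) simp
  finally show ?thesis .
qed

lemma poly_act_in:
  assumes "x \<in> S" and add: "\<And>x y. x \<in> S \<Longrightarrow> y \<in> S \<Longrightarrow> x + y \<in> S"
    and scale: "\<And>c x. x \<in> S \<Longrightarrow> c *s x \<in> S" and inv: "\<And>x. x \<in> S \<Longrightarrow> M *v x \<in> S"
  shows "poly_act M p x \<in> S"
proof -
  have f: "((*v) M ^^ i) x \<in> S" for i by (induction i) (simp_all add: inv \<open>x \<in> S\<close>)
  have "(\<Sum>i\<le>n. coeff p i *s ((*v) M ^^ i) x) \<in> S" for n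
  proof (induction n)
    case 0 show ?case using scale[OF f[of 0]] by simp
  next
    case (Suc n) then show ?case using add scale[OF f[of "Suc n"]] by simp
  qed
  then show ?thesis by (simp add: poly_act_def)
qed

text \<open>The iterates of \<open>v\<close> lie in a space of finite real dimension, so some of them coincide or are dependent.\<close>

lemma exists_annihilating_poly: "\<exists>p. p \<noteq> 0 \<and> poly_act M p v = 0"
proof -
  let ?f = "\<lambda>i. ((*v) M ^^ i) v" and ?N = "DIM(complex^'a)"
  show ?thesis
  proof (cases "inj_on ?f {..?N}")
    case True
    then have "card (?f ` {..?N}) > ?N" by (simp add: card_image)
    then have "dependent (?f ` {..?N})" by (intro dependent_biggerset) auto
    then obtain u where u: "\<exists>w\<in>?f ` {..?N}. u w \<noteq> (0::real)" "(\<Sum>w\<in>?f ` {..?N}. u w *\<^sub>R w) = 0"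
      by (subst (asm) dependent_finite) auto
    define p where "p = (\<Sum>i\<le>?N. monom (complex_of_real (u (?f i))) i)"
    have cp: "coeff p i = (if i \<le> ?N then complex_of_real (u (?f i)) else 0)" for i
      by (auto simp: p_def coeff_sum)
    obtain i where "i \<le> ?N" "u (?f i) \<noteq> 0" using u(1) by auto
    then have "coeff p i \<noteq> 0" by (simp add: cp)
    then have "p \<noteq> 0" by auto
    moreover have "poly_act M p v = (\<Sum>i\<le>?N. coeff p i *s ?f i)"
      by (intro poly_act_upto degree_le) (auto simp: cp)
    then have "poly_act M p v = (\<Sum>i\<le>?N. u (?f i) *\<^sub>R ?f i)"
      by (auto simp: cp vec_eq_iff scaleR_conv_of_real[where 'a=complex] intro!: sum.cong)
    then have "poly_act M p v = 0"
      using u(2) unfolding sum.reindex[OF True] by (simp add: o_def)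
    ultimately show ?thesis by blast
  next
    case False
    then obtain i j where ij: "i < j" "?f i = ?f j"
      by (auto simp: inj_on_def) (metis linorder_neqE_nat)
    define p :: "complex poly" where "p = monom 1 j - monom 1 i"
    have "coeff p j = 1" using ij by (simp add: p_def)
    then have "p \<noteq> 0" by auto
    moreover have "poly_act M p v = (\<Sum>k\<le>j. coeff p k *s ?f k)"
      using ij by (intro poly_act_upto) (auto simp: p_def intro!: degree_diff_le order_trans[OF degree_monom_le])
    moreover have "\<dots> = (\<Sum>k\<le>j. (if k = j then ?f j else 0) - (if k = i then ?f i else 0))"
      using ij by (intro sum.cong) (auto simp: p_def)
    ultimately show ?thesis using ij by (auto simp: sum_subtractf)
  qed
qed

text \<open>Split a polynomial annihilating \<open>v\<close> into linear factors and apply them one after another: the last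
  nonzero vector is an eigenvector, and it has not left the subspace.\<close>

lemma invariant_subspace_eigenvector:
  fixes M :: "complex^'n::finite^'n"
  assumes v: "v \<in> S" "v \<noteq> 0" and add: "\<And>x y. x \<in> S \<Longrightarrow> y \<in> S \<Longrightarrow> x + y \<in> S"
    and scale: "\<And>c x. x \<in> S \<Longrightarrow> c *s x \<in> S" and inv: "\<And>x. x \<in> S \<Longrightarrow> M *v x \<in> S"
  obtains z w where "w \<in> S" "w \<noteq> 0" "M *v w = z *s w"
proof -
  have "\<exists>z w. w \<in> S \<and> w \<noteq> 0 \<and> M *v w = z *s w" if "p \<noteq> 0" "poly_act M p v = 0" for p
    using that
  proof (induction "degree p" arbitrary: p)
    case 0
    then have "coeff p 0 \<noteq> 0" by (metis leading_coeff_0_iff)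
    with 0 v show ?case by (simp add: poly_act_def)
  next
    case (Suc n)
    then have "\<not> constant (poly p)" by (simp add: constant_degree)
    then obtain z where "poly p z = 0" using fundamental_theorem_of_algebra by blast
    then obtain q where q: "p = [:-z, 1:] * q" by (metis dvdE poly_eq_0_iff_dvd)
    have q0: "q \<noteq> 0" using Suc.prems(1) q by auto
    have "degree p = Suc (degree q)" using q0 unfolding q by (subst degree_mult_eq) auto
    then have dq: "degree q = n" using Suc.hyps(2) by simp
    show ?case
    proof (cases "poly_act M q v = 0")
      case True then show ?thesis using Suc.hyps(1)[of q] dq q0 by blast
    next
      case False
      have "M *v poly_act M q v - z *s poly_act M q v = 0"
        using Suc.prems unfolding q poly_act_linear_factor by simp
      moreover have "poly_act M q v \<in> S" by (rule poly_act_in[OF v(1) add scale inv])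
      ultimately show ?thesis using False by auto
    qed
  qed
  then show thesis using exists_annihilating_poly[of M v] that by blast
qed

section \<open>Real matrices acting on complex vectors\<close>

definition cact :: "real^'n::finite^'n \<Rightarrow> complex^'n \<Rightarrow> complex^'n" where
  "cact A w = map_matrix complex_of_real A *v w"

lemma cact_nth: "cact A w $ i = (\<Sum>j\<in>UNIV. of_real (A $ i $ j) * w $ j)"
  by (simp add: cact_def matrix_vector_mult_def)

lemma cact_add: "cact A (v + w) = cact A v + cact A w"
  by (simp add: vec_eq_iff cact_nth algebra_simps sum.distrib)

lemma cact_scale: "cact A (c *s v) = c *s cact A v"
  by (simp add: vec_eq_iff cact_nth algebra_simps sum_distrib_left)

lemma cact_diff_left: "cact (A - B) w = cact A w - cact B w"
  by (simp add: vec_eq_iff cact_nth algebra_simps sum_subtractf)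

lemma cact_mult: "cact (A ** B) w = cact A (cact B w)"
proof -
  have "map_matrix complex_of_real (A ** B) = map_matrix complex_of_real A ** map_matrix complex_of_real B"
    by (simp add: vec_eq_iff matrix_matrix_mult_def)
  then show ?thesis by (simp add: cact_def matrix_vector_mul_assoc)
qed

lemma cact_mat_1: "cact (mat 1) w = w"
  by (auto simp: vec_eq_iff cact_nth mat_def if_distrib[of of_real] if_distrib[of "\<lambda>x. x * _"] cong: if_cong)

lemma bounded_linear_cact: "bounded_linear (\<lambda>A. cact A w)"
proof -
  have "linear (\<lambda>A. cact A w)"
    by (intro linearI) (simp_all add: vec_eq_iff cact_nth distrib_right sum.distrib sum_distrib_left
      mult.assoc scaleR_conv_of_real[where 'a=complex])
  then show ?thesis by (simp add: linear_conv_bounded_linear)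
qed

lemma complex_eigenvalue_cact: "complex_eigenvalue A z \<longleftrightarrow> (\<exists>v. v \<noteq> 0 \<and> cact A v = z *s v)"
  by (simp add: complex_eigenvalue_def cact_def)

text \<open>Compare the two sides of the eigenvalue equation at an entry of maximal modulus.\<close>

lemma complex_eigenvalue_bound:
  assumes "complex_eigenvalue A z" shows "cmod z \<le> real CARD('n) * norm (A :: real^'n::finite^'n)"
proof -
  obtain v where v: "v \<noteq> 0" "cact A v = z *s v" using assms by (auto simp: complex_eigenvalue_cact)
  define m where "m = Max (range (\<lambda>i. cmod (v $ i)))"
  have le: "cmod (v $ j) \<le> m" for j unfolding m_def by (intro Max_ge) auto
  have "m \<in> range (\<lambda>i. cmod (v $ i))" unfolding m_def by (intro Max_in) auto
  then obtain i where i: "m = cmod (v $ i)" by auto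
  from v(1) obtain j where "v $ j \<noteq> 0" by (auto simp: vec_eq_iff)
  with le[of j] have m: "m > 0" by (meson less_le_trans zero_less_norm_iff)
  have "cmod z * m = cmod (cact A v $ i)" by (simp add: v i norm_mult)
  also have "\<dots> \<le> (\<Sum>j\<in>(UNIV::'n set). norm A * m)"
    unfolding cact_nth
  proof (intro order_trans[OF norm_sum] sum_mono)
    fix j
    have "\<bar>A $ i $ j\<bar> \<le> norm A"
      using component_le_norm_cart[of "A $ i" j] Finite_Cartesian_Product.norm_nth_le[of A i] by linarith
    then show "cmod (of_real (A $ i $ j) * v $ j) \<le> norm A * m"
      using le[of j] by (simp add: norm_mult mult_mono)
  qed
  finally show ?thesis using m by simp
qed

lemma log_domain_near_identity:
  assumes "real CARD('n) * norm (X - mat 1) < 1" shows "X \<in> (log_domain :: (real^'n::finite^'n) set)"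
  unfolding log_domain_def
proof (clarify)
  fix z assume "complex_eigenvalue X z" and z: "Im z = 0" "Re z \<le> 0"
  then obtain v where v: "v \<noteq> 0" "cact X v = z *s v" by (auto simp: complex_eigenvalue_cact)
  then have "cact (X - mat 1) v = (z - 1) *s v"
    by (simp add: cact_diff_left cact_mat_1 vec.scale_left_diff_distrib)
  then have "cmod (z - 1) < 1"
    using complex_eigenvalue_bound[of "X - mat 1" "z - 1"] assms v(1) by (force simp: complex_eigenvalue_cact)
  moreover have "\<bar>Re (z - 1)\<bar> \<le> cmod (z - 1)" by (rule abs_Re_le_cmod)
  ultimately show False using z by simp
qed

section \<open>Uniqueness of the principal logarithm\<close>

lemma cact_mpow_eigen: "cact C w = g *s w \<Longrightarrow> cact (mpow C k) w = g ^ k *s w"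
  by (induction k) (simp_all add: mpow_def cact_mat_1 cact_mult cact_scale mult.commute)

text \<open>\<open>\<Sum>k. C ^ k / (k + 1)!\<close>, the value at \<open>C\<close> of the entire function \<open>(e ^ z - 1) / z\<close>.\<close>

definition mphi :: "real^'n::finite^'n \<Rightarrow> real^'n^'n" where
  "mphi C = (\<Sum>k. (1 / fact (Suc k)) *\<^sub>R mpow C k)"

lemma norm_mpow_le: "norm (mpow C k) \<le> norm C ^ k * norm (mat 1 :: real^'n::finite^'n)" for C :: "real^'n^'n"
proof (induction k)
  case (Suc k)
  have "norm (mpow C (Suc k)) \<le> norm C * norm (mpow C k)"
    by (simp add: mpow_def norm_matrix_mult_le)
  also have "\<dots> \<le> norm C * (norm C ^ k * norm (mat 1 :: real^'n^'n))" by (intro mult_left_mono Suc) simp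
  finally show ?case by (simp add: mult.assoc)
qed (simp add: mpow_def)

lemma mphi_sums: "(\<lambda>k. (1 / fact (Suc k)) *\<^sub>R mpow C k) sums mphi C" for C :: "real^'n::finite^'n"
proof -
  have "summable (\<lambda>k. (norm C ^ k /\<^sub>R fact k) * norm (mat 1 :: real^'n^'n))"
    by (intro summable_mult2 summable_exp_generic)
  then have "summable (\<lambda>k. (1 / fact (Suc k)) *\<^sub>R mpow C k)"
  proof (rule summable_comparison_test[rotated], intro exI allI impI)
    fix k :: nat
    have "norm ((1 / fact (Suc k)) *\<^sub>R mpow C k) \<le> (1 / fact k) * (norm C ^ k * norm (mat 1 :: real^'n^'n))"
      unfolding norm_scaleR
      by (intro mult_mono norm_mpow_le) (auto simp: divide_simps fact_mono simp del: fact_Suc)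
    then show "norm ((1 / fact (Suc k)) *\<^sub>R mpow C k) \<le> (norm C ^ k /\<^sub>R fact k) * norm (mat 1 :: real^'n^'n)"
      by (simp add: field_simps)
  qed
  then show ?thesis unfolding mphi_def by (rule summable_sums)
qed

lemma mpow_Suc_right: "mpow C (Suc k) = mpow C k ** C"
  by (induction k) (simp_all add: mpow_def matrix_mul_assoc)

lemma mexp_eq_mphi: "mexp C = mat 1 + mphi C ** C"
proof -
  have "(\<lambda>k. ((1 / fact (Suc k)) *\<^sub>R mpow C k) ** C) sums (mphi C ** C)"
    by (rule bounded_linear.sums[OF mm.bounded_linear_left mphi_sums])
  then have "(\<lambda>k. (1 / fact (Suc k)) *\<^sub>R mpow C (Suc k)) sums (mphi C ** C)"
    by (simp only: mm.scaleR_left mpow_Suc_right)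
  then have "(\<lambda>k. (1 / fact k) *\<^sub>R mpow C k) sums (mphi C ** C + mat 1)"
    by (subst (asm) sums_Suc_iff) (simp add: mpow_def)
  then show ?thesis using mexp_sums[of C] by (metis add.commute mexp_eq sums_unique2)
qed

lemma mphi_commute: assumes "C ** A = A ** C" shows "mphi C ** A = A ** mphi C"
proof -
  have eq: "(\<lambda>k. ((1 / fact (Suc k)) *\<^sub>R mpow C k) ** A) = (\<lambda>k. A ** ((1 / fact (Suc k)) *\<^sub>R mpow C k))"
    by (simp add: mm.scaleR_left mm.scaleR_right mpow_commute[OF assms])
  have "(\<lambda>k. ((1 / fact (Suc k)) *\<^sub>R mpow C k) ** A) sums (mphi C ** A)"
    by (rule bounded_linear.sums[OF mm.bounded_linear_left mphi_sums])
  moreover have "(\<lambda>k. A ** ((1 / fact (Suc k)) *\<^sub>R mpow C k)) sums (A ** mphi C)"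
    by (rule bounded_linear.sums[OF mm.bounded_linear_right mphi_sums])
  ultimately show ?thesis unfolding eq by (rule sums_unique2)
qed

text \<open>On an eigenvector of \<open>C\<close> for \<open>g\<close>, \<open>mphi C\<close> acts as the number \<open>(e ^ g - 1) / g\<close>, whose zeros are
  the nonzero integer multiples of \<open>2 \<pi> \<i>\<close>.\<close>

lemma mphi_kernel_eigenvalue:
  assumes "cact C w = g *s w" "w \<noteq> 0" "cact (mphi C) w = 0"
  shows "2 * pi \<le> \<bar>Im g\<bar>"
proof -
  obtain i where i: "w $ i \<noteq> 0" using assms(2) by (auto simp: vec_eq_iff)
  have "(\<lambda>k. cact ((1 / fact (Suc k)) *\<^sub>R mpow C k) w) sums cact (mphi C) w"
    by (rule bounded_linear.sums[OF bounded_linear_cact mphi_sums])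
  then have "(\<lambda>k. cact ((1 / fact (Suc k)) *\<^sub>R mpow C k) w $ i) sums (0 $ i)"
    unfolding assms(3) by (rule bounded_linear.sums[OF bounded_linear_vec_nth])
  moreover have "cact ((1 / fact (Suc k)) *\<^sub>R mpow C k) w $ i = (g ^ k /\<^sub>R fact (Suc k)) * w $ i" for k
    using linear_scale[OF bounded_linear.linear[OF bounded_linear_cact[of w]], of "1 / fact (Suc k)" "mpow C k"]
      cact_mpow_eigen[OF assms(1), of k]
    by (simp add: scaleR_conv_of_real[where 'a=complex] field_simps del: fact_Suc)
  ultimately have "(\<lambda>k. (g ^ k /\<^sub>R fact (Suc k)) * w $ i) sums 0" by simp
  then have "(\<lambda>k. ((g ^ k /\<^sub>R fact (Suc k)) * w $ i) / w $ i) sums (0 / w $ i)" by (rule sums_divide)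
  then have phi: "(\<lambda>k. g ^ k /\<^sub>R fact (Suc k)) sums 0"
    by (simp only: nonzero_mult_div_cancel_right[OF i] div_0)
  have "g \<noteq> 0"
  proof
    assume "g = 0"
    then have "(\<lambda>k. g ^ k /\<^sub>R fact (Suc k)) = (\<lambda>k. if k = 0 then 1 else 0)"
      by (auto simp: power_0_left fun_eq_iff)
    with phi have "(\<lambda>k. if k = 0 then 1 else (0::complex)) sums 0" by simp
    moreover have "(\<lambda>k. if k = 0 then 1 else (0::complex)) sums 1" by (rule sums_single)
    ultimately show False using sums_unique2 zero_neq_one by blast
  qed
  have "(\<lambda>k. (g ^ k /\<^sub>R fact (Suc k)) * g) sums (0 * g)" by (rule sums_mult2[OF phi])
  then have "(\<lambda>k. g ^ Suc k /\<^sub>R fact (Suc k)) sums 0" by (simp add: mult.commute del: fact_Suc)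
  then have "(\<lambda>k. g ^ k /\<^sub>R fact k) sums 1"
    by (subst (asm) sums_Suc_iff) simp
  then have "exp g = 1" using exp_converges sums_unique2 by blast
  then obtain m :: int where m: "Re g = 0" "Im g = of_int (2 * m) * pi" by (auto simp: exp_eq_1)
  then have "m \<noteq> 0" using \<open>g \<noteq> 0\<close> complex_eq_iff by fastforce
  then have "1 \<le> \<bar>real_of_int m\<bar>" by linarith
  then have "1 * pi \<le> \<bar>real_of_int m\<bar> * pi" by (intro mult_right_mono) auto
  then show ?thesis by (simp add: m abs_mult)
qed

text \<open>If \<open>A\<close> is another logarithm, it commutes with \<open>B\<close>, so \<open>C = A - B\<close> satisfies
  \<open>mphi C ** C = 0\<close>. Were \<open>mphi C\<close> singular, its kernel would contain a common eigenvector of \<open>A\<close> and \<open>C\<close>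
  on which the imaginary parts of the eigenvalues of \<open>A\<close> and \<open>B\<close> differ by at least \<open>2 \<pi>\<close>.\<close>

lemma principal_log_eqI:
  fixes B :: "real^'n::finite^'n"
  assumes exp: "mexp B = X" and small: "real CARD('n) * norm B < pi"
    and bicomm: "\<And>A. A ** X = X ** A \<Longrightarrow> A ** B = B ** A"
  shows "principal_log X = B"
  unfolding principal_log_def
proof (rule the_equality)
  show "mexp B = X \<and> (\<forall>z. complex_eigenvalue B z \<longrightarrow> - pi < Im z \<and> Im z < pi)"
  proof (intro conjI allI impI exp)
    fix z assume "complex_eigenvalue B z"
    then have "\<bar>Im z\<bar> < pi"
      using complex_eigenvalue_bound small abs_Im_le_cmod[of z] by (meson le_less_trans order_trans)
    then show "- pi < Im z" "Im z < pi" by auto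
  qed
next
  fix A assume A: "mexp A = X \<and> (\<forall>z. complex_eigenvalue A z \<longrightarrow> - pi < Im z \<and> Im z < pi)"
  have "A ** X = X ** A" using mexp_commute[of A A] A by simp
  then have AB: "A ** B = B ** A" by (rule bicomm)
  define C where "C = A - B"
  have CA: "C ** A = A ** C" using AB by (simp add: C_def mm.diff_left mm.diff_right)
  have "mexp C = mexp A ** mexp (- B)"
    using mexp_add[of A "- B"] AB by (simp add: C_def mm.minus_left mm.minus_right)
  also have "\<dots> = mat 1" using A exp mexp_minus(2)[of B] by simp
  finally have UC: "mphi C ** C = 0" using mexp_eq_mphi[of C] by simp
  have "invertible (mphi C)"
  proof (rule ccontr)
    assume "\<not> invertible (mphi C)"
    then have "\<not> (\<exists>B. B ** mphi C = mat 1)" by (simp add: invertible_left_inverse)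
    then obtain x where x: "mphi C *v x = 0" "x \<noteq> 0" 
      by (auto simp: matrix_left_invertible_ker)
    define v :: "complex^'n" where "v = (\<chi> i. complex_of_real (x $ i))"
    have "cact (mphi C) v = (\<chi> i. complex_of_real ((mphi C *v x) $ i))"
      by (simp add: vec_eq_iff cact_nth v_def matrix_vector_mult_def)
    then have v: "cact (mphi C) v = 0" "v \<noteq> 0"
      using x by (auto simp: vec_eq_iff v_def)
    have z[simp]: "cact M 0 = 0" for M :: "real^'n^'n" by (simp add: vec_eq_iff cact_nth)
    have UCc: "mphi C ** C = C ** mphi C" by (rule mphi_commute) simp
    obtain g w where w: "cact (mphi C) w = 0" "w \<noteq> 0" "cact C w = g *s w"
    proof (rule invariant_subspace_eigenvector[of v "{w. cact (mphi C) w = 0}" "map_matrix complex_of_real C"])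
      show "map_matrix complex_of_real C *v y \<in> {w. cact (mphi C) w = 0}"
        if "y \<in> {w. cact (mphi C) w = 0}" for y
        using that cact_mult[of "mphi C" C y] cact_mult[of C "mphi C" y] UCc
        by (simp add: cact_def[of C, symmetric])
    qed (use v in \<open>auto simp: cact_add cact_scale cact_def[of C]\<close>)
    obtain al y where y: "cact (mphi C) y = 0" "cact C y = g *s y" "y \<noteq> 0" "cact A y = al *s y"
    proof (rule invariant_subspace_eigenvector[of w "{w. cact (mphi C) w = 0 \<and> cact C w = g *s w}" "map_matrix complex_of_real A"])
      show "map_matrix complex_of_real A *v y \<in> {w. cact (mphi C) w = 0 \<and> cact C w = g *s w}"
        if "y \<in> {w. cact (mphi C) w = 0 \<and> cact C w = g *s w}" for y
        using that cact_mult[of "mphi C" A y] cact_mult[of A "mphi C" y] mphi_commute[OF CA]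
          cact_mult[of C A y] cact_mult[of A C y] CA
        by (simp add: cact_def[of A, symmetric] cact_scale)
    qed (use w in \<open>auto simp: cact_add cact_scale cact_def[of A] vec.scale_right_distrib vec.scale_left_commute\<close>)
    have "cact B y = cact (A - C) y" by (simp add: C_def)
    then have "cact B y = (al - g) *s y" by (simp add: cact_diff_left y vec.scale_left_diff_distrib)
    then have "cmod (al - g) < pi"
      using y(3) small complex_eigenvalue_bound[of B "al - g"] by (force simp: complex_eigenvalue_cact)
    then have "\<bar>Im (al - g)\<bar> < pi" using abs_Im_le_cmod le_less_trans by blast
    moreover have "- pi < Im al \<and> Im al < pi" using A y by (auto simp: complex_eigenvalue_cact)
    ultimately show False using mphi_kernel_eigenvalue[OF y(2,3,1)] by auto
  qed
  then obtain V where "V ** mphi C = mat 1" by (auto simp: invertible_def)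
  then have "C = V ** (mphi C ** C)" by (simp add: matrix_mul_assoc)
  then show "A = B" using UC by (simp add: C_def)
qed

section \<open>The logarithm near the identity\<close>

lemma tendsto_exp_banach:
  fixes x :: "'a::{real_normed_algebra_1,banach}"
  assumes "(f \<longlongrightarrow> x) F" shows "((\<lambda>k. exp (f k)) \<longlongrightarrow> exp x) F"
proof -
  define r where "r = norm x + 1"
  have n: "((\<lambda>k. norm (f k - x)) \<longlongrightarrow> 0) F" using assms by (simp add: LIM_zero tendsto_norm_zero)
  have "((\<lambda>k. exp r * norm (f k - x)) \<longlongrightarrow> 0) F" by (rule tendsto_mult_right_zero[OF n])
  moreover have "eventually (\<lambda>k. norm (exp (f k) - exp x) \<le> exp r * norm (f k - x)) F"
    using order_tendstoD(2)[OF n zero_less_one]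
  proof eventually_elim
    case (elim k)
    have "norm (f k) \<le> r" "norm x \<le> r" using elim norm_triangle_ineq2[of "f k" x] by (auto simp: r_def)
    from norm_exp_diff_le[OF this]
    have "norm (exp (f k) - exp x - (f k - x)) \<le> (exp r - 1) * norm (f k - x)" .
    moreover have "norm (exp (f k) - exp x) \<le> norm (exp (f k) - exp x - (f k - x)) + norm (f k - x)"
      by (metis diff_add_cancel norm_triangle_ineq)
    ultimately show ?case by (simp add: algebra_simps)
  qed
  ultimately have "((\<lambda>k. exp (f k) - exp x) \<longlongrightarrow> 0) F" by (rule Lim_null_comparison[rotated])
  then show ?thesis by (rule LIM_zero_cancel)
qed

lemma tendsto_mexp: "(f \<longlongrightarrow> A) F \<Longrightarrow> ((\<lambda>k. mexp (f k)) \<longlongrightarrow> mexp A) F"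
  unfolding mexp_eq
  by (intro bounded_linear.tendsto[OF bounded_linear_mat_of] tendsto_exp_banach
      bounded_linear.tendsto[OF bounded_linear_Sqmat])

text \<open>The exponential and the principal logarithm are mutually inverse near the identity, both with small
  Lipschitz remainder. The constants depend on the dimension only; the last parameter fixes it.\<close>

locale exp_log_bounds =
  fixes rho c :: real and dimension :: "'n::finite itself"
  assumes rho: "0 < rho" "rho \<le> 1" and c: "1 \<le> c" "c * rho \<le> 1/2"
    and mexp_diff: "\<And>A B :: real^'n^'n. \<And>r. norm A \<le> r \<Longrightarrow> norm B \<le> r \<Longrightarrow> r \<le> rho \<Longrightarrow>
       norm (mexp A - mexp B - (A - B)) \<le> c * r * norm (A - B)"
    and mexp_log: "\<And>X :: real^'n^'n. norm (X - mat 1) < rho \<Longrightarrow> mexp (principal_log X) = X"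
    and log_bound: "\<And>X :: real^'n^'n. norm (X - mat 1) < rho \<Longrightarrow> norm (principal_log X) \<le> 2 * norm (X - mat 1)"
    and log_diff: "\<And>X Y :: real^'n^'n. norm (X - mat 1) < rho \<Longrightarrow> norm (Y - mat 1) < rho \<Longrightarrow>
       norm (principal_log X - principal_log Y - (X - Y)) \<le> c * (norm (X - mat 1) + norm (Y - mat 1)) * norm (X - Y)"
    and log_mexp: "\<And>B :: real^'n^'n. norm B < rho \<Longrightarrow> principal_log (mexp B) = B"
    and log_domain: "\<And>X :: real^'n^'n. norm (X - mat 1) < rho \<Longrightarrow> X \<in> log_domain"

text \<open>The logarithm of \<open>X\<close> is the fixed point of the contraction \<open>B \<mapsto> X - (mexp B - B)\<close>. Carrying the
  contraction out among the matrices that commute with everything commuting with \<open>X\<close> gives the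
  commutation required for identifying it with the principal logarithm.\<close>

lemma exists_small_log:
  fixes X :: "real^'n::finite^'n"
  assumes c: "c \<ge> 1" "\<And>A B :: real^'n^'n. \<And>r. norm A \<le> r \<Longrightarrow> norm B \<le> r \<Longrightarrow> r \<le> 1 \<Longrightarrow>
       norm (mexp A - mexp B - (A - B)) \<le> c * r * norm (A - B)"
    and X: "norm (X - mat 1) * (4 * c * real CARD('n)) \<le> 1"
  shows "mexp (principal_log X) = X \<and> norm (principal_log X) \<le> 2 * norm (X - mat 1)"
proof -
  define r where "r = 2 * norm (X - mat 1)"
  define S where "S = cball 0 r \<inter> {B. \<forall>A. A ** X = X ** A \<longrightarrow> A ** B = B ** A}"
  define T where "T B = X - (mexp B - B)" for B
  have n: "1 \<le> real CARD('n)" by (simp add: Suc_leI)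
  have r0: "0 \<le> r" by (simp add: r_def)
  have rn: "c * r * real CARD('n) \<le> 1/2" using X by (simp add: r_def algebra_simps)
  have "c * r * 1 \<le> c * r * real CARD('n)" using r0 c(1) n by (intro mult_left_mono) auto
  then have cr: "c * r \<le> 1/2" using rn by simp
  have "1 * r \<le> c * r" using r0 c(1) by (intro mult_right_mono)
  then have r1: "r \<le> 1" using cr by simp
  have lip: "norm (T A - T B) \<le> 1/2 * norm (A - B)" if "norm A \<le> r" "norm B \<le> r" for A B
  proof -
    have "T A - T B = - (mexp A - mexp B - (A - B))" by (simp add: T_def)
    then have "norm (T A - T B) \<le> c * r * norm (A - B)"
      using c(2)[OF that r1] by (simp only: norm_minus_cancel)
    also have "\<dots> \<le> 1/2 * norm (A - B)" using cr by (rule mult_right_mono) simp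
    finally show ?thesis .
  qed
  have "\<exists>!B\<in>S. T B = B"
  proof (rule Banach_fix)
    have "closed {B. \<forall>A. A ** X = X ** A \<longrightarrow> A ** B = B ** A}"
      by (intro closed_Collect_all closed_Collect_imp closed_Collect_eq open_Collect_const)
        (auto intro!: bounded_linear.continuous_on[OF mm.bounded_linear_left]
          bounded_linear.continuous_on[OF mm.bounded_linear_right])
    then show "complete S" unfolding S_def by (simp add: closed_Int complete_eq_closed)
    have "0 \<in> S" using r0 by (simp add: S_def mm.zero_left mm.zero_right)
    then show "S \<noteq> {}" by auto
    show "T ` S \<subseteq> S"
    proof
      fix y assume "y \<in> T ` S"
      then obtain B where B: "B \<in> S" "y = T B" by auto
      have "norm (T B) \<le> norm (T B - T 0) + norm (T 0)" by (metis diff_add_cancel norm_triangle_ineq)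
      also have "\<dots> \<le> 1/2 * norm B + norm (X - mat 1)"
        using lip[of B 0] B(1) r0 by (simp add: S_def T_def)
      also have "\<dots> \<le> r" using B(1) by (simp add: S_def r_def)
      finally have "norm (T B) \<le> r" .
      moreover have "A ** T B = T B ** A" if "A ** X = X ** A" for A
      proof -
        have "A ** B = B ** A" using B(1) that by (simp add: S_def)
        moreover from this have "mexp B ** A = A ** mexp B" by (intro mexp_commute) simp
        ultimately show ?thesis using that by (simp add: T_def mm.diff_left mm.diff_right)
      qed
      ultimately show "y \<in> S" by (simp add: S_def B)
    qed
    show "dist (T x) (T y) \<le> 1/2 * dist x y" if "x \<in> S" "y \<in> S" for x y
      using lip[of x y] that by (simp add: S_def dist_norm)
  qed auto
  then obtain B where B: "B \<in> S" "T B = B" by auto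
  have "mexp B = X" using B(2) by (simp add: T_def algebra_simps)
  moreover have "principal_log X = B"
  proof (rule principal_log_eqI)
    have "real CARD('n) * norm B \<le> real CARD('n) * r" using B(1) by (simp add: S_def)
    also have "1 * (real CARD('n) * r) \<le> c * (real CARD('n) * r)"
      using r0 c(1) by (intro mult_right_mono) auto
    then have "real CARD('n) * r \<le> 1/2" using rn by (simp add: mult_ac)
    also have "1/2 < pi" using pi_gt3 by simp
    finally show "real CARD('n) * norm B < pi" .
  qed (use B \<open>mexp B = X\<close> in \<open>auto simp: S_def\<close>)
  ultimately show ?thesis using B(1) by (simp add: S_def r_def)
qed

lemma exp_log_bounds_exist: "\<exists>rho c. exp_log_bounds TYPE('n::finite) rho c"
proof -
  obtain c0 where c0: "c0 \<ge> 1" "\<And>A B :: real^'n^'n. \<And>r. norm A \<le> r \<Longrightarrow> norm B \<le> r \<Longrightarrow> r \<le> 1 \<Longrightarrow>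
       norm (mexp A - mexp B - (A - B)) \<le> c0 * r * norm (A - B)" by (rule mexp_diff_le) blast
  define N where "N = real CARD('n)"
  have N: "1 \<le> N" unfolding N_def by (simp add: Suc_leI)
  \<comment> \<open>small enough for logarithms within distance \<open>2 rho\<close> of the identity, where \<open>mexp B\<close> lies for \<open>norm B < rho\<close>\<close>
  define rho where "rho = 1 / (8 * c0 * N)"
  have cN: "1 \<le> c0 * N" using mult_mono[OF c0(1) N] c0(1) by simp
  have rho: "rho > 0" "8 * c0 * N * rho = 1" using c0 N by (auto simp: rho_def)
  have "8 * c0 * rho * 1 \<le> 8 * c0 * rho * N" using N c0 rho by (intro mult_left_mono) auto
  then have c0rho: "8 * c0 * rho \<le> 1" using rho(2) by (simp add: mult_ac)
  have "1 * rho \<le> c0 * rho" using c0(1) rho by (intro mult_right_mono) auto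
  then have rho1: "8 * rho \<le> 1" using c0rho by simp
  have log: "mexp (principal_log X) = X \<and> norm (principal_log X) \<le> 2 * norm (X - mat 1)"
    if "norm (X - mat 1) \<le> 2 * rho" for X :: "real^'n^'n"
  proof (rule exists_small_log[OF c0])
    have "norm (X - mat 1) * (4 * c0 * real CARD('n)) \<le> (2 * rho) * (4 * c0 * N)"
      using that c0 N unfolding N_def by (intro mult_right_mono) auto
    then show "norm (X - mat 1) * (4 * c0 * real CARD('n)) \<le> 1" using rho(2) by (simp add: mult_ac)
  qed
  have inj: "norm (A - B) \<le> 2 * norm (mexp A - mexp B)" if "norm A \<le> 4 * rho" "norm B \<le> 4 * rho" for A B :: "real^'n^'n"
  proof -
    have "norm (mexp A - mexp B - (A - B)) \<le> c0 * (4 * rho) * norm (A - B)"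
      using rho1 by (intro c0(2) that) auto
    also have "\<dots> \<le> 1/2 * norm (A - B)" using c0rho by (intro mult_right_mono) auto
    finally have *: "norm (mexp A - mexp B - (A - B)) \<le> 1/2 * norm (A - B)" .
    have "norm (A - B) \<le> norm (mexp A - mexp B) + norm (mexp A - mexp B - (A - B))"
      by (metis diff_diff_eq2 add_diff_cancel_left' norm_triangle_ineq4)
    with * show ?thesis by simp
  qed
  have "exp_log_bounds TYPE('n) rho (4 * c0)"
  proof
    show "0 < rho" "rho \<le> 1" "1 \<le> 4 * c0" "4 * c0 * rho \<le> 1/2" using rho rho1 c0 c0rho by auto
    show "norm (mexp A - mexp B - (A - B)) \<le> 4 * c0 * r * norm (A - B)"
      if "norm A \<le> r" "norm B \<le> r" "r \<le> rho" for A B :: "real^'n^'n" and r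
    proof -
      have "r \<ge> 0" using that norm_ge_zero order_trans by blast
      then have "c0 * r * norm (A - B) \<le> 4 * c0 * r * norm (A - B)"
        using c0 by (intro mult_right_mono) auto
      then show ?thesis using c0(2)[OF that(1,2)] that(3) rho1 rho(1) by linarith
    qed
    fix X :: "real^'n^'n" assume X: "norm (X - mat 1) < rho"
    then have X2: "norm (X - mat 1) \<le> 2 * rho" using rho by simp
    show "mexp (principal_log X) = X" "norm (principal_log X) \<le> 2 * norm (X - mat 1)"
      using log[OF X2] by auto
    have "N * norm (X - mat 1) \<le> N * rho" using X N by (intro mult_left_mono) auto
    also have "1 * (N * rho) \<le> c0 * (N * rho)" using c0 N rho by (intro mult_right_mono) auto
    then have "N * rho < 1" using rho(2) by (simp add: mult_ac)
    finally show "X \<in> log_domain" unfolding N_def by (rule log_domain_near_identity)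
    fix Y :: "real^'n^'n" assume Y: "norm (Y - mat 1) < rho"
    define r where "r = 2 * (norm (X - mat 1) + norm (Y - mat 1))"
    have lX: "mexp (principal_log X) = X" "norm (principal_log X) \<le> 2 * norm (X - mat 1)"
      and lY: "mexp (principal_log Y) = Y" "norm (principal_log Y) \<le> 2 * norm (Y - mat 1)"
      using log[OF X2] log[of Y] Y rho by auto
    have "norm (mexp (principal_log X) - mexp (principal_log Y) - (principal_log X - principal_log Y))
        \<le> c0 * r * norm (principal_log X - principal_log Y)"
    proof (intro c0(2))
      have "2 * norm (X - mat 1) \<le> r" "2 * norm (Y - mat 1) \<le> r" by (simp_all add: r_def)
      then show "norm (principal_log X) \<le> r" "norm (principal_log Y) \<le> r" using lX(2) lY(2) by linarith+
      have "r \<le> 2 * (rho + rho)" unfolding r_def using X Y by (intro mult_left_mono add_mono) auto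
      also have "\<dots> \<le> 1" using rho1 rho(1) by simp
      finally show "r \<le> 1" .
    qed
    also have "\<dots> \<le> c0 * r * (2 * norm (X - Y))"
      using inj[of "principal_log X" "principal_log Y"] X Y lX lY c0 rho
      by (intro mult_left_mono) (auto simp: r_def)
    finally have "norm (X - Y - (principal_log X - principal_log Y)) \<le> c0 * r * (2 * norm (X - Y))"
      by (simp add: lX lY)
    then show "norm (principal_log X - principal_log Y - (X - Y))
        \<le> 4 * c0 * (norm (X - mat 1) + norm (Y - mat 1)) * norm (X - Y)"
      by (subst norm_minus_commute) (simp add: r_def algebra_simps)
  next
    fix B :: "real^'n^'n" assume B: "norm B < rho"
    have "norm (mexp B - mexp 0 - (B - 0)) \<le> c0 * rho * norm (B - 0)"
      using B rho1 rho by (intro c0(2)) auto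
    also have "\<dots> \<le> 1 * norm (B - 0)" using c0rho rho c0 by (intro mult_right_mono) auto
    finally have "norm (mexp B - mat 1 - B) \<le> norm B" by simp
    then have mB: "norm (mexp B - mat 1) \<le> 2 * norm B"
      using norm_triangle_ineq[of "mexp B - mat 1 - B" B] by simp
    then have l: "mexp (principal_log (mexp B)) = mexp B \<and> norm (principal_log (mexp B)) \<le> 2 * norm (mexp B - mat 1)"
      using B by (intro log) auto
    have "norm (principal_log (mexp B) - B) \<le> 2 * norm (mexp (principal_log (mexp B)) - mexp B)"
      using l B mB rho(1) by (intro inj) auto
    then show "principal_log (mexp B) = B" using l by simp
  qed
  then show ?thesis by blast
qed

context exp_log_bounds
begin

lemma log_mat_1: "principal_log (mat 1 :: real^'n^'n) = 0"
  using log_mexp[of 0] rho by simp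

lemma log_minus: "norm (X - mat 1) < rho \<Longrightarrow>
    norm (principal_log X - (X - mat 1)) \<le> c * norm (X - mat 1) * norm (X - mat 1)" for X :: "real^'n^'n"
  using log_diff[of X "mat 1"] rho by (simp add: log_mat_1)

lemma mexp_minus_mat_1: "norm A \<le> rho \<Longrightarrow> norm (mexp A - mat 1 - A) \<le> c * norm A * norm A" for A :: "real^'n^'n"
  using mexp_diff[of A "norm A" 0] by simp

end

section \<open>The Lie algebra of a closed matrix group\<close>

lemma invertible_inverse:
  fixes A :: "real^'n::finite^'n"
  assumes "invertible A" shows "A ** matrix_inv A = mat 1" "matrix_inv A ** A = mat 1"
  using someI_ex[of "\<lambda>B. A ** B = mat 1 \<and> B ** A = mat 1"] assms
  unfolding invertible_def matrix_inv_def by auto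

lemma matrix_inv_eqI:
  fixes A :: "real^'n::finite^'n"
  assumes "A ** B = mat 1" shows "matrix_inv A = B"
proof -
  have "B ** A = mat 1" using assms matrix_left_right_inverse by blast
  then have i: "invertible A" using assms invertible_def by blast
  have "matrix_inv A ** (A ** B) = B"
    by (simp add: matrix_mul_assoc invertible_inverse[OF i])
  then show ?thesis using assms by simp
qed

lemma invertible_mexp: "invertible (mexp A)" "matrix_inv (mexp A) = mexp (- A)"
  using mexp_minus[of A] by (auto simp: invertible_def intro: matrix_inv_eqI)

lemma mexp_Suc: "mexp (real (Suc k) *\<^sub>R B) = mexp B ** mexp (real k *\<^sub>R B)"
  by (subst mexp_add[symmetric]) (auto simp: mm.scaleR_left mm.scaleR_right algebra_simps)

locale lie_group = exp_log_bounds rho c dimension for rho c and dimension :: "'n::finite itself" +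
  fixes G :: "(real^'n^'n) set"
  assumes lie_group: "linear_lie_group G"
begin

lemma G_invertible: "A \<in> G \<Longrightarrow> invertible A"
  and G_one: "mat 1 \<in> G" and G_mult: "A \<in> G \<Longrightarrow> B \<in> G \<Longrightarrow> A ** B \<in> G"
  and G_inv: "A \<in> G \<Longrightarrow> matrix_inv A \<in> G"
  using lie_group by (auto simp: linear_lie_group_def)

lemma G_closed_limit:
  assumes "eventually (\<lambda>k. f k \<in> G) F" "(f \<longlongrightarrow> L) F" "invertible L" "F \<noteq> bot" shows "L \<in> G"
proof -
  obtain T where T: "closed T" "G = {A. invertible A} \<inter> T"
    using lie_group by (auto simp: linear_lie_group_def closedin_closed)
  have "L \<in> T" using assms(1) T
    by (intro Lim_in_closed_set[OF T(1) _ assms(4,2)]) (auto elim: eventually_mono)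
  then show ?thesis using T assms by auto
qed

lemma mexp_int_in_G: assumes "mexp B \<in> G" shows "mexp (of_int z *\<^sub>R B) \<in> G"
proof -
  have n: "mexp (real k *\<^sub>R B) \<in> G" for k
    by (induction k) (auto simp: G_one mexp_Suc G_mult assms simp del: of_nat_Suc)
  show ?thesis
  proof (cases "z \<ge> 0")
    case True then show ?thesis using n[of "nat z"] by simp
  next
    case False
    have "mexp (- (real (nat (- z)) *\<^sub>R B)) \<in> G"
      using G_inv[OF n[of "nat (-z)"]] by (simp only: invertible_mexp)
    then show ?thesis using False by simp
  qed
qed

text \<open>Tangent vectors are realised by one-parameter groups: if \<open>g k = mexp (B k)\<close> and \<open>B k / s k\<close> tends to \<open>A\<close>,
  then \<open>mexp (t A)\<close> is the limit of the integer powers of \<open>g k\<close> of exponent \<open>\<lfloor>t / s k\<rfloor>\<close>.\<close>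

lemma tangent_in_lie_algebra:
  assumes g: "\<And>k. g k \<in> G" and s: "\<And>k. s k > 0" "s \<longlonglongrightarrow> 0"
    and lim: "(\<lambda>k. (1 / s k) *\<^sub>R (g k - mat 1)) \<longlonglongrightarrow> A"
  shows "A \<in> lie_algebra G"
  unfolding lie_algebra_def
proof clarify
  fix t :: real
  have "(\<lambda>k. s k *\<^sub>R ((1 / s k) *\<^sub>R (g k - mat 1))) \<longlonglongrightarrow> 0 *\<^sub>R A" by (intro tendsto_intros s lim)
  then have g1: "(\<lambda>k. g k - mat 1) \<longlonglongrightarrow> 0" using s(1) by (simp add: less_imp_neq[THEN not_sym])
  then have gn: "(\<lambda>k. norm (g k - mat 1)) \<longlonglongrightarrow> 0" by (rule tendsto_norm_zero)
  define B where "B k = principal_log (g k)" for k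
  have ev: "eventually (\<lambda>k. norm (g k - mat 1) < rho) sequentially"
    using order_tendstoD(2)[OF gn] rho by auto
  have "(\<lambda>k. (1 / s k) *\<^sub>R (B k - (g k - mat 1))) \<longlonglongrightarrow> 0"
  proof (rule Lim_null_comparison)
    show "(\<lambda>k. c * norm (g k - mat 1) * norm ((1 / s k) *\<^sub>R (g k - mat 1))) \<longlonglongrightarrow> 0"
      using tendsto_mult[OF tendsto_mult[OF tendsto_const gn] tendsto_norm[OF lim], of c] by simp
    show "\<forall>\<^sub>F k in sequentially. norm ((1 / s k) *\<^sub>R (B k - (g k - mat 1)))
        \<le> c * norm (g k - mat 1) * norm ((1 / s k) *\<^sub>R (g k - mat 1))"
      using ev
    proof eventually_elim
      case (elim k)
      have "norm (B k - (g k - mat 1)) / s k \<le> (c * norm (g k - mat 1) * norm (g k - mat 1)) / s k"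
        using log_minus[OF elim] s(1)[of k] by (intro divide_right_mono) (auto simp: B_def)
      then show ?case using s(1)[of k] by (simp add: divide_inverse mult_ac)
    qed
  qed
  from tendsto_add[OF this lim] have B: "(\<lambda>k. (1 / s k) *\<^sub>R B k) \<longlonglongrightarrow> A"
    by (simp add: scaleR_diff_right)
  define z where "z k = \<lfloor>t / s k\<rfloor>" for k
  have "(\<lambda>k. of_int (z k) * s k - t) \<longlonglongrightarrow> 0"
  proof (rule Lim_null_comparison[OF _ s(2)], intro always_eventually allI)
    fix k
    have "of_int (z k) \<le> t / s k" "t / s k < of_int (z k) + 1" by (auto simp: z_def)
    then have "of_int (z k) * s k \<le> t" "t < (of_int (z k) + 1) * s k"
      using s(1)[of k] by (auto simp: field_simps)
    then show "norm (of_int (z k) * s k - t) \<le> s k" by (simp add: algebra_simps)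
  qed
  then have "(\<lambda>k. of_int (z k) * s k) \<longlonglongrightarrow> t" by (rule LIM_zero_cancel)
  from tendsto_scaleR[OF this B] have "(\<lambda>k. of_int (z k) *\<^sub>R B k) \<longlonglongrightarrow> t *\<^sub>R A"
    using s(1) by (simp add: less_imp_neq[THEN not_sym])
  then have "(\<lambda>k. mexp (of_int (z k) *\<^sub>R B k)) \<longlonglongrightarrow> mexp (t *\<^sub>R A)" by (rule tendsto_mexp)
  moreover have "eventually (\<lambda>k. mexp (of_int (z k) *\<^sub>R B k) \<in> G) sequentially"
    using ev by eventually_elim (auto intro!: mexp_int_in_G simp: B_def mexp_log g)
  ultimately show "mexp (t *\<^sub>R A) \<in> G"
    by (intro G_closed_limit invertible_mexp) auto
qed

lemma mexp_in_G: "A \<in> lie_algebra G \<Longrightarrow> mexp (t *\<^sub>R A) \<in> G"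
  by (simp add: lie_algebra_def)

lemma mexp_difference_quotient:
  fixes A :: "real^'n^'n"
  assumes s: "\<And>k. s k > 0" "s \<longlonglongrightarrow> 0" shows "(\<lambda>k. (1 / s k) *\<^sub>R (mexp (s k *\<^sub>R A) - mat 1)) \<longlonglongrightarrow> A"
proof -
  have "(\<lambda>k. (1 / s k) *\<^sub>R (mexp (s k *\<^sub>R A) - mat 1) - A) \<longlonglongrightarrow> 0"
  proof (rule Lim_null_comparison)
    show "(\<lambda>k. s k * (c * norm A * norm A)) \<longlonglongrightarrow> 0" by (rule tendsto_mult_left_zero[OF s(2)])
    have "(\<lambda>k. norm (s k *\<^sub>R A)) \<longlonglongrightarrow> norm (0 *\<^sub>R A)" by (intro tendsto_intros s)
    then have "eventually (\<lambda>k. norm (s k *\<^sub>R A) < rho) sequentially"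
      using order_tendstoD(2) rho by fastforce
    then show "\<forall>\<^sub>F k in sequentially. norm ((1 / s k) *\<^sub>R (mexp (s k *\<^sub>R A) - mat 1) - A)
      \<le> s k * (c * norm A * norm A)"
    proof eventually_elim
      case (elim k)
      have "(1 / s k) *\<^sub>R (mexp (s k *\<^sub>R A) - mat 1) - A = (1 / s k) *\<^sub>R (mexp (s k *\<^sub>R A) - mat 1 - s k *\<^sub>R A)"
        using s(1)[of k] by (simp add: scaleR_diff_right)
      also have "norm \<dots> \<le> (1 / s k) * (c * norm (s k *\<^sub>R A) * norm (s k *\<^sub>R A))"
        unfolding norm_scaleR[of "1 / s k"]
        using mexp_minus_mat_1[of "s k *\<^sub>R A"] elim s(1)[of k] by (intro mult_mono) auto
      also have "\<dots> = s k * (c * norm A * norm A)"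
        using s(1)[of k] by (simp add: field_simps)
      finally show ?case .
    qed
  qed
  then show ?thesis by (rule LIM_zero_cancel)
qed

lemma subspace_lie_algebra: "subspace (lie_algebra G)"
proof (rule subspaceI)
  show "0 \<in> lie_algebra G" by (simp add: lie_algebra_def G_one)
  show "r *\<^sub>R A \<in> lie_algebra G" if "A \<in> lie_algebra G" for r A
    using that by (simp add: lie_algebra_def)
  fix A B assume AB: "A \<in> lie_algebra G" "B \<in> lie_algebra G"
  define s :: "nat \<Rightarrow> real" where "s k = inverse (real (Suc k))" for k
  have s: "\<And>k. s k > 0" "s \<longlonglongrightarrow> 0" 
    unfolding s_def by (simp, rule LIMSEQ_inverse_real_of_nat)
  show "A + B \<in> lie_algebra G"
  proof (rule tangent_in_lie_algebra[OF _ s])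
    show "mexp (s k *\<^sub>R A) ** mexp (s k *\<^sub>R B) \<in> G" for k by (intro G_mult mexp_in_G AB)
    have "(\<lambda>k. mexp (s k *\<^sub>R B)) \<longlonglongrightarrow> mexp (0 *\<^sub>R B)" by (intro tendsto_mexp tendsto_intros s)
    then have "(\<lambda>k. ((1 / s k) *\<^sub>R (mexp (s k *\<^sub>R A) - mat 1)) ** mexp (s k *\<^sub>R B)
        + (1 / s k) *\<^sub>R (mexp (s k *\<^sub>R B) - mat 1)) \<longlonglongrightarrow> A ** mexp (0 *\<^sub>R B) + B"
      by (intro tendsto_add mm.tendsto mexp_difference_quotient s)
    then show "(\<lambda>k. (1 / s k) *\<^sub>R (mexp (s k *\<^sub>R A) ** mexp (s k *\<^sub>R B) - mat 1)) \<longlonglongrightarrow> A + B"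
      by (simp add: mm.scaleR_left mm.diff_left scaleR_diff_right)
  qed
qed

text \<open>The closed subgroup theorem. Otherwise there are \<open>X k \<in> G\<close> tending to the identity with logarithm
  outside the Lie algebra. Choose \<open>A k\<close> in the Lie algebra making \<open>h k = mexp (- A k) ** X k\<close> as close to
  the identity as possible. A limit \<open>v\<close> of the normalised \<open>h k - 1\<close> is a tangent vector, and then
  \<open>A k + s k v\<close>, with \<open>s k\<close> the distance of \<open>h k\<close> from the identity, does better than \<open>A k\<close>.\<close>

lemma log_in_lie_algebra:
  "\<exists>\<delta>>0. \<forall>X\<in>G. norm (X - mat 1) < \<delta> \<longrightarrow> principal_log X \<in> lie_algebra G"
proof (rule ccontr)
  assume "\<not> ?thesis"
  then have "\<exists>X\<in>G. norm (X - mat 1) < inverse (real (Suc k)) \<and> principal_log X \<notin> lie_algebra G" for k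
    by (metis inverse_positive_iff_positive of_nat_0_less_iff zero_less_Suc)
  then obtain X where X: "\<And>k. X k \<in> G" "\<And>k. norm (X k - mat 1) < inverse (real (Suc k))"
      "\<And>k. principal_log (X k) \<notin> lie_algebra G" by metis
  have X0: "(\<lambda>k. norm (X k - mat 1)) \<longlonglongrightarrow> 0"
    by (rule Lim_null_comparison[OF _ LIMSEQ_inverse_real_of_nat])
      (use X(2) in \<open>auto intro!: always_eventually less_imp_le\<close>)
  define K where "K = lie_algebra G \<inter> cball 0 (rho / 2)"
  have K: "compact K" "0 \<in> K" unfolding K_def
    using rho subspace_0[OF subspace_lie_algebra]
    by (auto intro!: closed_Int_compact closed_subspace[OF subspace_lie_algebra])
  define phi where "phi k A = norm (mexp (- A) ** X k - mat 1)" for k A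
  have "\<exists>A\<in>K. \<forall>B\<in>K. phi k A \<le> phi k B" for k
  proof (rule continuous_attains_inf)
    have "continuous_on K (\<lambda>A. mexp (- A))"
      unfolding continuous_on_def by (auto intro!: tendsto_mexp tendsto_intros)
    then show "continuous_on K (phi k)" unfolding phi_def
      by (intro continuous_intros mm.continuous_on)
  qed (use K in auto)
  then obtain A where A: "\<And>k. A k \<in> K" "\<And>k B. B \<in> K \<Longrightarrow> phi k (A k) \<le> phi k B" by metis
  define h where "h k = mexp (- A k) ** X k" for k
  define s where "s k = norm (h k - mat 1)" for k
  have sphi: "s k = phi k (A k)" for k by (simp add: s_def h_def phi_def)
  have sX: "s k \<le> norm (X k - mat 1)" for k using A(2)[OF K(2), of k] by (simp add: sphi phi_def)
  have s0: "s \<longlonglongrightarrow> 0" by (rule Lim_null_comparison[OF _ X0]) (use sX in \<open>auto simp: s_def\<close>)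
  have Ag: "A k \<in> lie_algebra G" and An: "norm (A k) \<le> rho / 2" for k using A(1) by (auto simp: K_def)
  have spos: "s k > 0" for k
  proof (rule ccontr)
    assume "\<not> s k > 0"
    then have "h k = mat 1" by (simp add: s_def)
    moreover have "mexp (A k) ** h k = X k"
      by (simp add: h_def matrix_mul_assoc mexp_minus)
    ultimately have "X k = mexp (A k)" by simp
    then have "principal_log (X k) = A k" using An[of k] rho by (simp add: log_mexp)
    then show False using X(3)[of k] Ag by simp
  qed
  have hG: "h k \<in> G" for k
    using mexp_in_G[OF Ag, of "-1" k] X(1) by (simp add: h_def G_mult)
  define M where "M = norm (mat 1 :: real^'n^'n) + 1"
  have Abound: "norm (A k) \<le> 2 * (1 + M) * norm (X k - mat 1)" for k
  proof -
    have "norm (mexp (- A k) - mat 1 - (- A k)) \<le> c * norm (A k) * norm (A k)"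
      using mexp_minus_mat_1[of "- A k"] An[of k] rho by simp
    moreover have "c * norm (A k) \<le> c * rho" using An[of k] rho c by (intro mult_left_mono) auto
    then have "c * norm (A k) * norm (A k) \<le> 1/2 * norm (A k)"
      using c by (intro mult_right_mono order_trans[OF _ c(2)]) auto
    ultimately have e: "norm (mexp (- A k) - mat 1 + A k) \<le> 1/2 * norm (A k)" by simp
    then have "norm (mexp (- A k) - mat 1) \<le> 1"
      using norm_triangle_ineq4[of "mexp (- A k) - mat 1 + A k" "A k"] An[of k] rho by simp
    then have m: "norm (mexp (- A k)) \<le> M"
      using norm_triangle_sub[of "mexp (- A k)" "mat 1"] by (simp add: M_def)
    have "mexp (- A k) - mat 1 = (h k - mat 1) - mexp (- A k) ** (X k - mat 1)"
      by (simp add: h_def mm.diff_right)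
    then have "norm (mexp (- A k) - mat 1) \<le> s k + norm (mexp (- A k) ** (X k - mat 1))"
      by (metis norm_triangle_ineq4 s_def)
    also have "\<dots> \<le> norm (X k - mat 1) + M * norm (X k - mat 1)"
      using m by (intro add_mono sX order_trans[OF norm_matrix_mult_le] mult_right_mono) auto
    finally have "norm (mexp (- A k) - mat 1) \<le> (1 + M) * norm (X k - mat 1)" by (simp add: algebra_simps)
    moreover have "norm (A k) \<le> norm (mexp (- A k) - mat 1 + A k) + norm (mexp (- A k) - mat 1)"
      using norm_triangle_ineq4[of "mexp (- A k) - mat 1 + A k" "mexp (- A k) - mat 1"] by simp
    ultimately show ?thesis using e unfolding mult.assoc by linarith
  qed
  have A0: "(\<lambda>k. norm (A k)) \<longlonglongrightarrow> 0"
  proof (rule Lim_null_comparison)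
    show "(\<lambda>k. 2 * (1 + M) * norm (X k - mat 1)) \<longlonglongrightarrow> 0" by (rule tendsto_mult_right_zero[OF X0])
  qed (use Abound in auto)
  define U where "U k = (1 / s k) *\<^sub>R (h k - mat 1)" for k
  have "U k \<in> sphere 0 1" for k using spos[of k] by (simp add: U_def s_def[symmetric])
  then obtain v \<sigma> where v: "v \<in> sphere 0 1" "strict_mono \<sigma>" "(U \<circ> \<sigma>) \<longlonglongrightarrow> v"
    using compact_sphere[of "0::real^'n^'n" 1] unfolding compact_def by blast
  have sub: "f \<longlonglongrightarrow> l \<Longrightarrow> (\<lambda>k. f (\<sigma> k)) \<longlonglongrightarrow> l" for f :: "nat \<Rightarrow> real" and l
    using LIMSEQ_subseq_LIMSEQ[OF _ v(2)] by (simp add: o_def)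
  have vg: "v \<in> lie_algebra G"
    using v(3) by (intro tangent_in_lie_algebra[of "\<lambda>k. h (\<sigma> k)" "\<lambda>k. s (\<sigma> k)"] sub)
      (auto simp: hG spos s0 U_def o_def)
  define R where "R k = norm (U k - v) + norm (X k - mat 1) + c * (norm (A k) + s k) * (norm (X k - mat 1) + norm (mat 1 :: real^'n^'n))" for k
  have "(\<lambda>k. norm (A k) + s k) \<longlonglongrightarrow> 0" using tendsto_add[OF A0 s0] by simp
  from order_tendstoD(2)[OF sub[OF this], of "rho/2"] rho
  have "eventually (\<lambda>k. norm (A (\<sigma> k)) + s (\<sigma> k) < rho / 2) sequentially" by simp
  then have "eventually (\<lambda>k. 1 \<le> R (\<sigma> k)) sequentially"
  proof eventually_elim
    case (elim j)
    define k where "k = \<sigma> j"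
    have el: "norm (A k) + s k < rho / 2" using elim by (simp add: k_def)
    define A' where "A' = A k + s k *\<^sub>R v"
    have nv: "norm v = 1" using v(1) by simp
    have nA': "norm A' \<le> norm (A k) + s k" unfolding A'_def
      using norm_triangle_ineq[of "A k" "s k *\<^sub>R v"] nv spos[of k] by simp
    have "A' \<in> K" unfolding K_def using nA' el
      by (auto simp: A'_def intro!: subspace_add[OF subspace_lie_algebra] subspace_scale[OF subspace_lie_algebra] Ag vg)
    then have le: "s k \<le> norm (mexp (- A') ** X k - mat 1)" using A(2) by (simp add: sphi phi_def)
    define Q where "Q = mexp (- A') - mexp (- A k) - (- A' - - A k)"
    have Q: "norm Q \<le> c * (norm (A k) + s k) * s k"
    proof -
      have "norm Q \<le> c * (norm (A k) + s k) * norm (- A' - - A k)"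
        unfolding Q_def using nA' el spos[of k] rho(1) by (intro mexp_diff) auto
      then show ?thesis using nv spos[of k] by (simp add: A'_def)
    qed
    have "mexp (- A') = mexp (- A k) - s k *\<^sub>R v + Q" by (simp add: Q_def A'_def)
    then have "mexp (- A') ** X k - mat 1 = (h k - mat 1) - s k *\<^sub>R v - s k *\<^sub>R (v ** (X k - mat 1)) + Q ** X k"
      by (simp add: h_def mm.add_left mm.diff_left mm.diff_right mm.scaleR_left scaleR_diff_right)
    also have "(h k - mat 1) - s k *\<^sub>R v = s k *\<^sub>R (U k - v)"
      using spos[of k] by (simp add: U_def scaleR_diff_right)
    finally have "s k \<le> norm (s k *\<^sub>R (U k - v) - s k *\<^sub>R (v ** (X k - mat 1)) + Q ** X k)"
      using le by simp
    also have "\<dots> \<le> norm (s k *\<^sub>R (U k - v)) + norm (s k *\<^sub>R (v ** (X k - mat 1))) + norm (Q ** X k)"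
      by (intro norm_triangle_le add_right_mono norm_triangle_ineq4)
    also have "\<dots> \<le> s k * norm (U k - v) + s k * norm (X k - mat 1)
        + (c * (norm (A k) + s k) * s k) * (norm (X k - mat 1) + norm (mat 1 :: real^'n^'n))"
    proof (intro add_mono)
      show "norm (s k *\<^sub>R (v ** (X k - mat 1))) \<le> s k * norm (X k - mat 1)"
        using norm_matrix_mult_le[of v "X k - mat 1"] nv spos[of k] by simp
      have "norm (X k) \<le> norm (X k - mat 1) + norm (mat 1 :: real^'n^'n)"
        by (metis diff_add_cancel norm_triangle_ineq)
      then show "norm (Q ** X k) \<le> (c * (norm (A k) + s k) * s k) * (norm (X k - mat 1) + norm (mat 1 :: real^'n^'n))"
        using Q by (intro order_trans[OF norm_matrix_mult_le] mult_mono) (auto intro: order_trans[OF norm_ge_zero])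
    qed (use spos[of k] in simp)
    also have "\<dots> = s k * R k" by (simp add: R_def algebra_simps)
    finally show ?case using spos[of k] by (simp add: k_def)
  qed
  moreover have "(\<lambda>k. R (\<sigma> k)) \<longlonglongrightarrow> norm (v - v) + 0 + c * (0 + 0) * (0 + norm (mat 1 :: real^'n^'n))"
    unfolding R_def using v(3) by (intro tendsto_intros sub X0 A0 s0) (simp add: o_def)
  then have "eventually (\<lambda>k. R (\<sigma> k) < 1) sequentially" by (intro order_tendstoD(2)) auto
  ultimately have "eventually (\<lambda>k. False) sequentially" by eventually_elim auto
  then show False by simp
qed

end

section \<open>A Lyapunov form for a Hurwitz polynomial\<close>

text \<open>On polynomials of degree less than \<open>d\<close>, identified with their coefficients, this is multiplication by the variable
  modulo the monic polynomial with coefficients \<open>a\<close>.\<close>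

definition mult_var :: "nat \<Rightarrow> (nat \<Rightarrow> real) \<Rightarrow> (nat \<Rightarrow> 'a::real_vector) \<Rightarrow> nat \<Rightarrow> 'a" where
  "mult_var d a z k = (if k = 0 then 0 else z (k - 1)) - a k *\<^sub>R z (d - 1)"

text \<open>\<open>newton_coeff l j k\<close> is the coordinate of the monomial of degree \<open>k\<close> at the \<open>j\<close>-th Newton basis
  polynomial, the product of the \<open>x - l i\<close> with \<open>i < j\<close>.\<close>

fun newton_coeff :: "(nat \<Rightarrow> complex) \<Rightarrow> nat \<Rightarrow> nat \<Rightarrow> complex" where
  "newton_coeff l j 0 = (if j = 0 then 1 else 0)"
| "newton_coeff l j (Suc k) = l j * newton_coeff l j k + (if j = 0 then 0 else newton_coeff l (j - 1) k)"

lemma newton_coeff_less: "k < j \<Longrightarrow> newton_coeff l j k = 0"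
  by (induction k arbitrary: j) auto

lemma newton_coeff_same: "newton_coeff l j j = 1"
  by (induction j) (auto simp: newton_coeff_less)

definition newton_functional :: "(nat \<Rightarrow> complex) \<Rightarrow> nat \<Rightarrow> complex poly \<Rightarrow> complex" where
  "newton_functional l j q = (\<Sum>k\<le>degree q. coeff q k * newton_coeff l j k)"

lemma newton_functional_upto:
  "degree q \<le> N \<Longrightarrow> newton_functional l j q = (\<Sum>k\<le>N. coeff q k * newton_coeff l j k)"
  unfolding newton_functional_def by (intro sum.mono_neutral_left) (auto simp: coeff_eq_0)

lemma newton_functional_linear_factor:
  "newton_functional l j ([:-x, 1:] * q) =
    (l j - x) * newton_functional l j q + (if j = 0 then 0 else newton_functional l (j - 1) q)"
proof -
  let ?n = "degree q" and ?w = "newton_coeff l"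
  have "newton_functional l j ([:-x, 1:] * q) = (\<Sum>k\<le>Suc ?n. coeff ([:-x, 1:] * q) k * ?w j k)"
    by (intro newton_functional_upto order_trans[OF degree_mult_le]) simp
  also have "\<dots> = (\<Sum>k\<le>Suc ?n. coeff (pCons 0 q) k * ?w j k) - x * (\<Sum>k\<le>Suc ?n. coeff q k * ?w j k)"
    by (simp only: sum_distrib_left sum_subtractf[symmetric]) (intro sum.cong, simp_all add: algebra_simps)
  also have "(\<Sum>k\<le>Suc ?n. coeff (pCons 0 q) k * ?w j k) = (\<Sum>k\<le>?n. coeff q k * ?w j (Suc k))"
    by (subst sum.atMost_Suc_shift) simp
  also have "\<dots> = l j * newton_functional l j q + (if j = 0 then 0 else newton_functional l (j - 1) q)"
    by (simp add: newton_functional_def distrib_left sum.distrib sum_distrib_left mult.left_commute)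
  also have "(\<Sum>k\<le>Suc ?n. coeff q k * ?w j k) = newton_functional l j q"
    by (intro newton_functional_upto[symmetric]) simp
  finally show ?thesis by (simp add: algebra_simps)
qed

text \<open>The factor \<open>x - l j\<close> lowers the index of the functional by one, and nothing is left below index \<open>0\<close>.\<close>

lemma newton_functional_eq_0: "newton_functional l j ((\<Prod>i\<le>j. [:-l i, 1:]) * q) = 0"
proof (induction j arbitrary: q)
  case 0
  then show ?case using newton_functional_linear_factor[of l 0 "l 0" q] by simp
next
  case (Suc j)
  have "newton_functional l (Suc j) ([:-l (Suc j), 1:] * ((\<Prod>i\<le>j. [:-l i, 1:]) * q)) = 0"
    unfolding newton_functional_linear_factor using Suc[of q] by simp
  then show ?case by (simp only: prod.atMost_Suc mult_ac)
qed

lemma newton_functional_prod: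
  assumes "j < d" shows "newton_functional l j (\<Prod>i<d. [:-l i, 1:]) = 0"
proof -
  have "{..<d} = {..j} \<union> {Suc j..<d}" using assms by auto
  then have "(\<Prod>i<d. [:-l i, 1:]) = (\<Prod>i\<in>{..j} \<union> {Suc j..<d}. [:-l i, 1:])" by (rule arg_cong)
  also have "\<dots> = (\<Prod>i\<le>j. [:-l i, 1:]) * (\<Prod>i\<in>{Suc j..<d}. [:-l i, 1:])"
    by (rule prod.union_disjoint) auto
  finally show ?thesis by (simp add: newton_functional_eq_0)
qed

lemma degree_monic_poly: "degree (monic_poly d a) = d"
  and coeff_monic_poly: "coeff (monic_poly d a) k = (if k < d then a k else if k = d then 1 else 0)"
proof -
  have "coeff (\<Sum>i<d. monom (a i) i) k = (if k < d then a k else 0)" for k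
    by (simp add: coeff_sum)
  then show c: "coeff (monic_poly d a) k = (if k < d then a k else if k = d then 1 else 0)" for k
    by (auto simp: monic_poly_def)
  show "degree (monic_poly d a) = d"
    by (intro antisym degree_le le_degree) (auto simp: c)
qed

text \<open>All functionals of index below \<open>d\<close> vanish on the product of the \<open>d\<close> linear factors, so reduction modulo that product
  leaves only the recursion defining the Newton coordinates: a bidiagonal matrix with the roots on the diagonal.\<close>

lemma newton_coordinates_shift:
  fixes z :: "nat \<Rightarrow> real"
  assumes d: "d \<ge> 1" and p: "map_poly complex_of_real (monic_poly d a) = (\<Prod>i<d. [:-l i, 1:])" and j: "j < d"
  shows "(\<Sum>k<d. newton_coeff l j k * of_real (mult_var d a z k)) =
    l j * (\<Sum>k<d. newton_coeff l j k * of_real (z k))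
    + (if j = 0 then 0 else (\<Sum>k<d. newton_coeff l (j - 1) k * of_real (z k)))"
proof -
  obtain n where n: "d = Suc n" using d by (cases d) auto
  let ?w = "newton_coeff l"
  have "0 = newton_functional l j (map_poly complex_of_real (monic_poly d a))"
    using newton_functional_prod[OF j] p by simp
  also have "\<dots> = (\<Sum>k\<le>d. of_real (coeff (monic_poly d a) k) * ?w j k)"
    by (subst newton_functional_upto[where N = d])
      (auto simp: coeff_map_poly degree_map_poly degree_monic_poly mult.commute)
  also have "\<dots> = (\<Sum>k<d. of_real (a k) * ?w j k) + ?w j d"
    by (simp add: coeff_monic_poly lessThan_Suc_atMost[symmetric])
  finally have wd: "(\<Sum>k<d. of_real (a k) * ?w j k) = - ?w j d" by (simp add: eq_neg_iff_add_eq_0)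
  have "(\<Sum>k<d. ?w j k * of_real (mult_var d a z k)) =
      (\<Sum>k<d. ?w j k * of_real (if k = 0 then 0 else z (k - 1))) - (\<Sum>k<d. of_real (a k) * ?w j k) * of_real (z (d - 1))"
    unfolding sum_distrib_right sum_subtractf[symmetric]
    by (intro sum.cong) (auto simp: mult_var_def algebra_simps)
  also have "(\<Sum>k<d. ?w j k * of_real (if k = 0 then 0 else z (k - 1))) = (\<Sum>k<n. ?w j (Suc k) * of_real (z k))"
    unfolding n sum.lessThan_Suc_shift by simp
  also have "\<dots> - (\<Sum>k<d. of_real (a k) * ?w j k) * of_real (z (d - 1)) = (\<Sum>k<d. ?w j (Suc k) * of_real (z k))"
    unfolding wd unfolding n sum.lessThan_Suc by (simp del: newton_coeff.simps)
  also have "\<dots> = l j * (\<Sum>k<d. ?w j k * of_real (z k)) + (if j = 0 then 0 else (\<Sum>k<d. ?w (j - 1) k * of_real (z k)))"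
    by (simp add: distrib_right sum.distrib sum_distrib_left mult.assoc)
  finally show ?thesis .
qed

lemma hurwitz_roots:
  assumes "hurwitz (monic_poly d a)"
  obtains l s where "map_poly complex_of_real (monic_poly d a) = (\<Prod>i<d. [:-l i, 1:])"
    "s > 0" "\<And>i. i < d \<Longrightarrow> Re (l i) \<le> - s"
proof -
  let ?p = "map_poly complex_of_real (monic_poly d a)"
  have deg: "degree ?p = d" by (simp add: degree_map_poly degree_monic_poly)
  then have lc: "lead_coeff ?p = 1" by (simp add: coeff_map_poly coeff_monic_poly)
  obtain l where l: "smult (lead_coeff ?p) (\<Prod>i<degree ?p. [:-l i, 1:]) = ?p"
    by (rule complex_poly_decompose')
  then have p: "?p = (\<Prod>i<d. [:-l i, 1:])" using lc deg by simp
  have neg: "Re (l i) < 0" if "i < d" for i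
  proof -
    have "poly ?p (l i) = 0" unfolding p poly_prod using that by (intro prod_zero) auto
    then show ?thesis using assms unfolding hurwitz_def by blast
  qed
  define s where "s = Min (insert 1 ((\<lambda>i. - Re (l i)) ` {..<d}))"
  have "s > 0" unfolding s_def using neg by (subst Min_gr_iff) auto
  moreover have "Re (l i) \<le> - s" if "i < d" for i
  proof -
    have "s \<le> - Re (l i)" unfolding s_def using that by (intro Min_le) auto
    then show ?thesis by simp
  qed
  ultimately show thesis using that p by blast
qed

lemma Re_cnj_mult_le: "\<bar>Re (cnj x * y)\<bar> \<le> (cmod x ^ 2 + cmod y ^ 2) / 2"
proof -
  have "\<bar>Re (cnj x * y)\<bar> \<le> cmod (cnj x * y)" by (rule abs_Re_le_cmod)
  also have "\<dots> = cmod x * cmod y" by (simp add: norm_mult)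
  also have "\<dots> \<le> (cmod x ^ 2 + cmod y ^ 2) / 2" using sum_squares_bound[of "cmod x" "cmod y"] by simp
  finally show ?thesis .
qed

text \<open>Scaling the Newton coordinates by powers of a small number makes the off-diagonal part
  of the bidiagonal matrix small compared to the diagonal.\<close>

lemma bidiagonal_dissipation:
  fixes w w' :: "nat \<Rightarrow> complex" and s t :: real
  assumes s: "s > 0" "\<And>j. j < d \<Longrightarrow> Re (l j) \<le> - s" and t: "0 < t" "2 * t \<le> s"
    and w': "\<And>j. j < d \<Longrightarrow> w' j = l j * w j + (if j = 0 then 0 else t * w (j - 1))"
  shows "(\<Sum>j<d. Re (cnj (w j) * w' j)) \<le> - (s / 2) * (\<Sum>j<d. (cmod (w j))\<^sup>2)"
proof -
  have "Re (cnj (w j) * w' j) \<le> - s * (cmod (w j))\<^sup>2 + t / 2 * ((cmod (w j))\<^sup>2 + (if j = 0 then 0 else (cmod (w (j - 1)))\<^sup>2))"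
    if "j < d" for j
  proof -
    have "Re (cnj (w j) * (l j * w j)) = Re (l j) * (cmod (w j))\<^sup>2"
      unfolding cmod_power2 by (simp add: power2_eq_square algebra_simps)
    also have "\<dots> \<le> - s * (cmod (w j))\<^sup>2" using s(2)[OF that] by (intro mult_right_mono) auto
    finally have 1: "Re (cnj (w j) * (l j * w j)) \<le> - s * (cmod (w j))\<^sup>2" .
    have nn: "0 \<le> t / 2 * (cmod (w j))\<^sup>2" using t by simp
    show ?thesis
    proof (cases "j = 0")
      case True
      then show ?thesis using 1 nn unfolding w'[OF that] by (simp only: if_True refl add_0_right)
    next
      case False
      have "t * Re (cnj (w j) * w (j - 1)) \<le> t * (((cmod (w j))\<^sup>2 + (cmod (w (j - 1)))\<^sup>2) / 2)"
        using order_trans[OF abs_ge_self Re_cnj_mult_le[of "w j" "w (j - 1)"]] t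
        by (intro mult_left_mono) simp_all
      then have 2: "t * Re (cnj (w j) * w (j - 1)) \<le> t / 2 * ((cmod (w j))\<^sup>2 + (cmod (w (j - 1)))\<^sup>2)" by simp
      have 3: "Re (cnj (w j) * w' j) = Re (cnj (w j) * (l j * w j)) + t * Re (cnj (w j) * w (j - 1))"
        unfolding w'[OF that] using False by (simp add: algebra_simps)
      show ?thesis using 1 2 False unfolding 3 by (simp only: if_False)
    qed
  qed
  then have "(\<Sum>j<d. Re (cnj (w j) * w' j)) \<le>
      (\<Sum>j<d. - s * (cmod (w j))\<^sup>2 + t / 2 * ((cmod (w j))\<^sup>2 + (if j = 0 then 0 else (cmod (w (j - 1)))\<^sup>2)))"
    by (intro sum_mono) auto
  also have "\<dots> = (- s + t / 2) * (\<Sum>j<d. (cmod (w j))\<^sup>2) + t / 2 * (\<Sum>j<d. if j = 0 then 0 else (cmod (w (j - 1)))\<^sup>2)"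
    by (simp only: sum.distrib[symmetric] sum_distrib_left) (intro sum.cong refl, simp add: algebra_simps)
  also have "(\<Sum>j<d. if j = 0 then 0 else (cmod (w (j - 1)))\<^sup>2) \<le> (\<Sum>j<d. (cmod (w j))\<^sup>2)"
  proof (cases d)
    case (Suc n)
    then show ?thesis unfolding Suc by (subst sum.lessThan_Suc_shift) simp
  qed simp
  then have "(- s + t / 2) * (\<Sum>j<d. (cmod (w j))\<^sup>2) + t / 2 * (\<Sum>j<d. if j = 0 then 0 else (cmod (w (j - 1)))\<^sup>2)
     \<le> (- s + t / 2) * (\<Sum>j<d. (cmod (w j))\<^sup>2) + t / 2 * (\<Sum>j<d. (cmod (w j))\<^sup>2)"
    using t by (intro add_left_mono mult_left_mono) auto
  also have "\<dots> = (- s + t) * (\<Sum>j<d. (cmod (w j))\<^sup>2)" by (simp add: algebra_simps)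
  also have "\<dots> \<le> - (s / 2) * (\<Sum>j<d. (cmod (w j))\<^sup>2)"
    using t by (intro mult_right_mono sum_nonneg) auto
  finally show ?thesis .
qed

text \<open>Back substitution, from the last unknown to the first.\<close>

lemma triangular_bound:
  fixes T :: "nat \<Rightarrow> nat \<Rightarrow> complex"
  assumes "\<And>j. j < d \<Longrightarrow> T j j \<noteq> 0" "\<And>j k. k < j \<Longrightarrow> T j k = 0"
  obtains C where "C > 0" "\<And>z k. k < d \<Longrightarrow> \<bar>z k\<bar> \<le> C * (\<Sum>j<d. cmod (\<Sum>i<d. T j i * of_real (z i)))"
proof -
  have "\<exists>C\<ge>0. \<forall>z. \<bar>z k\<bar> \<le> C * (\<Sum>j<d. cmod (\<Sum>i<d. T j i * of_real (z i)))" if "k < d" for k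
    using that
  proof (induction "d - k" arbitrary: k rule: less_induct)
    case less
    have "\<forall>i\<in>{k<..<d}. \<exists>C\<ge>0. \<forall>z. \<bar>z i\<bar> \<le> C * (\<Sum>j<d. cmod (\<Sum>i<d. T j i * of_real (z i)))"
      using less.hyps by auto
    from bchoice[OF this] obtain C where C: "\<And>i. i \<in> {k<..<d} \<Longrightarrow> C i \<ge> 0"
      "\<And>i z. i \<in> {k<..<d} \<Longrightarrow> \<bar>z i\<bar> \<le> C i * (\<Sum>j<d. cmod (\<Sum>i<d. T j i * of_real (z i)))" by blast
    define B where "B = (1 + (\<Sum>i\<in>{k<..<d}. cmod (T k i) * C i)) / cmod (T k k)"
    have "B \<ge> 0" unfolding B_def using C(1) by (intro divide_nonneg_nonneg add_nonneg_nonneg sum_nonneg) auto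
    moreover have "\<bar>z k\<bar> \<le> B * (\<Sum>j<d. cmod (\<Sum>i<d. T j i * of_real (z i)))" for z
    proof -
      define S where "S = (\<Sum>j<d. cmod (\<Sum>i<d. T j i * of_real (z i)))"
      have "(\<Sum>i<d. T k i * of_real (z i)) = (\<Sum>i\<in>insert k {k<..<d}. T k i * of_real (z i))"
        using less.prems assms(2) by (intro sum.mono_neutral_right) auto
      then have eq: "T k k * of_real (z k) = (\<Sum>i<d. T k i * of_real (z i)) - (\<Sum>i\<in>{k<..<d}. T k i * of_real (z i))"
        by simp
      have "cmod (T k k) * \<bar>z k\<bar> = cmod (T k k * of_real (z k))" by (simp add: norm_mult)
      also have "\<dots> \<le> cmod (\<Sum>i<d. T k i * of_real (z i)) + cmod (\<Sum>i\<in>{k<..<d}. T k i * of_real (z i))"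
        unfolding eq by (rule norm_triangle_ineq4)
      also have "\<dots> \<le> S + (\<Sum>i\<in>{k<..<d}. cmod (T k i) * (C i * S))"
      proof (rule add_mono)
        show "cmod (\<Sum>i<d. T k i * of_real (z i)) \<le> S"
          unfolding S_def using less.prems
          by (intro member_le_sum[of k "{..<d}" "\<lambda>j. cmod (\<Sum>i<d. T j i * of_real (z i))"]) auto
        have "cmod (T k i * of_real (z i)) \<le> cmod (T k i) * (C i * S)" if "i \<in> {k<..<d}" for i
          using C(2)[OF that, of z] by (simp add: norm_mult S_def mult_left_mono)
        then show "cmod (\<Sum>i\<in>{k<..<d}. T k i * of_real (z i)) \<le> (\<Sum>i\<in>{k<..<d}. cmod (T k i) * (C i * S))"
          by (intro order_trans[OF norm_sum] sum_mono)
      qed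
      also have "\<dots> = (1 + (\<Sum>i\<in>{k<..<d}. cmod (T k i) * C i)) * S"
        by (simp add: sum_distrib_right distrib_right mult.assoc)
      finally show ?thesis using assms(1)[OF less.prems]
        unfolding S_def[symmetric] B_def by (simp add: field_simps)
    qed
    ultimately show ?case by blast
  qed
  then have "\<exists>C. \<forall>k\<in>{..<d}. C k \<ge> 0 \<and> (\<forall>z. \<bar>z k\<bar> \<le> C k * (\<Sum>j<d. cmod (\<Sum>i<d. T j i * of_real (z i))))"
    by (intro bchoice) auto
  then obtain C where C: "\<And>k. k < d \<Longrightarrow> C k \<ge> 0"
    "\<And>k z. k < d \<Longrightarrow> \<bar>z k\<bar> \<le> C k * (\<Sum>j<d. cmod (\<Sum>i<d. T j i * of_real (z i)))" by auto
  show thesis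
  proof (rule that[of "1 + (\<Sum>k<d. C k)"])
    show "0 < 1 + (\<Sum>k<d. C k)" using C(1) by (intro add_pos_nonneg sum_nonneg) auto
    fix z k assume k: "k < d"
    have "C k \<le> 1 + (\<Sum>k<d. C k)"
      using member_le_sum[of k "{..<d}" C] k C(1) by auto
    then have "C k * (\<Sum>j<d. cmod (\<Sum>i<d. T j i * of_real (z i))) \<le> (1 + (\<Sum>k<d. C k)) * (\<Sum>j<d. cmod (\<Sum>i<d. T j i * of_real (z i)))"
      by (intro mult_right_mono sum_nonneg) auto
    then show "\<bar>z k\<bar> \<le> (1 + (\<Sum>k<d. C k)) * (\<Sum>j<d. cmod (\<Sum>i<d. T j i * of_real (z i)))"
      using C(2)[OF k, of z] by linarith
  qed
qed

lemma scalar_lyapunov_form: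
  assumes d: "d \<ge> 1" and h: "hurwitz (monic_poly d a)"
  obtains P :: "nat \<Rightarrow> nat \<Rightarrow> real" and m s :: real where "m > 0" "s > 0" "\<And>k l. P k l = P l k"
    "\<And>z. m * (\<Sum>k<d. (z k)\<^sup>2) \<le> (\<Sum>k<d. \<Sum>l<d. P k l * (z k * z l))"
    "\<And>z. (\<Sum>k<d. \<Sum>l<d. P k l * (z k * mult_var d a z l)) \<le> - s * (\<Sum>k<d. \<Sum>l<d. P k l * (z k * z l))"
proof -
  obtain l s where p: "map_poly complex_of_real (monic_poly d a) = (\<Prod>i<d. [:-l i, 1:])"
    and s: "s > 0" "\<And>i. i < d \<Longrightarrow> Re (l i) \<le> - s" using hurwitz_roots[OF h] by metis
  define t where "t = s / 2"
  have t: "0 < t" "2 * t \<le> s" using s by (auto simp: t_def)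
  define T where "T j k = of_real (t ^ j) * newton_coeff l j k" for j k
  define W where "W z j = (\<Sum>k<d. T j k * of_real (z k))" for z :: "nat \<Rightarrow> real" and j
  define P where "P k i = (\<Sum>j<d. Re (cnj (T j k) * T j i))" for k i
  have PW: "(\<Sum>k<d. \<Sum>i<d. P k i * (z k * y i)) = (\<Sum>j<d. Re (cnj (W z j) * W y j))" for z y
  proof -
    have "Re (cnj (W z j) * W y j) = (\<Sum>k<d. \<Sum>i<d. Re (cnj (T j k) * T j i) * (z k * y i))" for j
    proof -
      have "cnj (W z j) * W y j = (\<Sum>k<d. \<Sum>i<d. (cnj (T j k) * T j i) * of_real (z k * y i))"
        unfolding W_def cnj_sum complex_cnj_mult complex_cnj_complex_of_real sum_product
        by (intro sum.cong) (auto simp: mult_ac)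
      then show ?thesis by (simp only: Re_sum Re_complex_of_real times_complex.sel Im_complex_of_real mult_zero_right diff_zero)
    qed
    then have "(\<Sum>j<d. Re (cnj (W z j) * W y j)) = (\<Sum>j<d. \<Sum>k<d. \<Sum>i<d. Re (cnj (T j k) * T j i) * (z k * y i))"
      by simp
    also have "\<dots> = (\<Sum>k<d. \<Sum>j<d. \<Sum>i<d. Re (cnj (T j k) * T j i) * (z k * y i))" by (rule sum.swap)
    also have "\<dots> = (\<Sum>k<d. \<Sum>i<d. \<Sum>j<d. Re (cnj (T j k) * T j i) * (z k * y i))"
      by (rule sum.cong[OF refl], rule sum.swap)
    finally show ?thesis by (simp add: P_def sum_distrib_right)
  qed
  have PWW: "(\<Sum>k<d. \<Sum>i<d. P k i * (z k * z i)) = (\<Sum>j<d. (cmod (W z j))\<^sup>2)" for z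
    unfolding PW cmod_power2 by (simp add: power2_eq_square)
  obtain C where C: "C > 0" "\<And>z k. k < d \<Longrightarrow> \<bar>z k\<bar> \<le> C * (\<Sum>j<d. cmod (W z j))"
    unfolding W_def
    by (rule triangular_bound[of d T]) (use t in \<open>auto simp: T_def newton_coeff_less newton_coeff_same\<close>)
  define m where "m = 1 / (real d * (C\<^sup>2 * real d))"
  show thesis
  proof (rule that[of m "s / 2" P])
    show "m > 0" using C d by (simp add: m_def)
    show "s / 2 > 0" using s by simp
    show "P k i = P i k" for k i
      unfolding P_def by (intro sum.cong) (auto simp: mult.commute)
    show "m * (\<Sum>k<d. (z k)\<^sup>2) \<le> (\<Sum>k<d. \<Sum>l<d. P k l * (z k * z l))" for z
    proof -
      have "(z k)\<^sup>2 \<le> C\<^sup>2 * real d * (\<Sum>j<d. (cmod (W z j))\<^sup>2)" if "k < d" for k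
      proof -
        have "(z k)\<^sup>2 \<le> (C * (\<Sum>j<d. cmod (W z j)))\<^sup>2"
          using power_mono[OF C(2)[OF that, of z], of 2] by simp
        also have "\<dots> = C\<^sup>2 * (\<Sum>j<d. cmod (W z j))\<^sup>2" by (simp add: power_mult_distrib)
        also have "\<dots> \<le> C\<^sup>2 * ((\<Sum>j<d. (cmod (W z j))\<^sup>2) * real d)"
          using sum_squared_le_sum_of_squares[of "\<lambda>j. cmod (W z j)" "{..<d}"] by (intro mult_left_mono) auto
        finally show ?thesis by (simp add: mult_ac)
      qed
      then have "(\<Sum>k<d. (z k)\<^sup>2) \<le> (\<Sum>k<d. C\<^sup>2 * real d * (\<Sum>j<d. (cmod (W z j))\<^sup>2))" by (intro sum_mono) auto
      then show ?thesis unfolding PWW using C d by (simp add: m_def field_simps)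
    qed
    show "(\<Sum>k<d. \<Sum>l<d. P k l * (z k * mult_var d a z l)) \<le> - (s / 2) * (\<Sum>k<d. \<Sum>l<d. P k l * (z k * z l))" for z
      unfolding PWW unfolding PW
    proof (rule bidiagonal_dissipation[OF s t])
      fix j assume j: "j < d"
      have W: "W z j = of_real (t ^ j) * (\<Sum>k<d. newton_coeff l j k * of_real (z k))" for z j
        by (simp add: W_def T_def sum_distrib_left mult_ac)
      show "W (mult_var d a z) j = l j * W z j + (if j = 0 then 0 else t * W z (j - 1))"
        unfolding W newton_coordinates_shift[OF d p j] by (cases j) (auto simp: algebra_simps)
    qed
  qed
qed

text \<open>For vectors, apply the scalar form to each component.\<close>

lemma lyapunov_form:
  assumes d: "d \<ge> 1" and h: "hurwitz (monic_poly d a)"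
  obtains P :: "nat \<Rightarrow> nat \<Rightarrow> real" and m s :: real where "m > 0" "s > 0" "\<And>k l. P k l = P l k"
    "\<And>z :: nat \<Rightarrow> 'a::euclidean_space. m * (\<Sum>k<d. (norm (z k))\<^sup>2) \<le> (\<Sum>k<d. \<Sum>l<d. P k l * (z k \<bullet> z l))"
    "\<And>z :: nat \<Rightarrow> 'a. (\<Sum>k<d. \<Sum>l<d. P k l * (z k \<bullet> mult_var d a z l)) \<le> - s * (\<Sum>k<d. \<Sum>l<d. P k l * (z k \<bullet> z l))"
proof (rule scalar_lyapunov_form[OF assms])
  fix P :: "nat \<Rightarrow> nat \<Rightarrow> real" and m s :: real
  assume *: "m > 0" "s > 0" "\<And>k l. P k l = P l k"
    "\<And>z. m * (\<Sum>k<d. (z k)\<^sup>2) \<le> (\<Sum>k<d. \<Sum>l<d. P k l * (z k * z l))"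
    "\<And>z. (\<Sum>k<d. \<Sum>l<d. P k l * (z k * mult_var d a z l)) \<le> - s * (\<Sum>k<d. \<Sum>l<d. P k l * (z k * z l))"
  have B: "(\<Sum>k<d. \<Sum>l<d. P k l * (z k \<bullet> y l)) = (\<Sum>b\<in>Basis. \<Sum>k<d. \<Sum>l<d. P k l * ((z k \<bullet> b) * (y l \<bullet> b)))"
    for z y :: "nat \<Rightarrow> 'a"
  proof -
    have "(\<Sum>k<d. \<Sum>l<d. P k l * (z k \<bullet> y l)) = (\<Sum>k<d. \<Sum>l<d. \<Sum>b\<in>Basis. P k l * ((z k \<bullet> b) * (y l \<bullet> b)))"
      by (rule sum.cong[OF refl], rule sum.cong[OF refl], subst euclidean_inner) (simp add: sum_distrib_left)
    also have "\<dots> = (\<Sum>k<d. \<Sum>b\<in>Basis. \<Sum>l<d. P k l * ((z k \<bullet> b) * (y l \<bullet> b)))"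
      by (rule sum.cong[OF refl], rule sum.swap)
    also have "\<dots> = (\<Sum>b\<in>Basis. \<Sum>k<d. \<Sum>l<d. P k l * ((z k \<bullet> b) * (y l \<bullet> b)))" by (rule sum.swap)
    finally show ?thesis .
  qed
  show thesis
  proof (rule that[OF *(1,2,3)])
    fix z :: "nat \<Rightarrow> 'a"
    have "m * (\<Sum>k<d. (norm (z k))\<^sup>2) = (\<Sum>b\<in>Basis. m * (\<Sum>k<d. (z k \<bullet> b)\<^sup>2))"
    proof -
      have "(norm (z k))\<^sup>2 = (\<Sum>b\<in>Basis. (z k \<bullet> b)\<^sup>2)" for k
        unfolding power2_norm_eq_inner by (subst euclidean_inner) (simp add: power2_eq_square)
      then have "(\<Sum>k<d. (norm (z k))\<^sup>2) = (\<Sum>b\<in>Basis. \<Sum>k<d. (z k \<bullet> b)\<^sup>2)"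
        by (simp only:) (rule sum.swap)
      then show ?thesis by (simp add: sum_distrib_left)
    qed
    also have "\<dots> \<le> (\<Sum>k<d. \<Sum>l<d. P k l * (z k \<bullet> z l))"
      unfolding B by (intro sum_mono *(4))
    finally show "m * (\<Sum>k<d. (norm (z k))\<^sup>2) \<le> (\<Sum>k<d. \<Sum>l<d. P k l * (z k \<bullet> z l))" .
    have mv: "mult_var d a z k \<bullet> b = mult_var d a (\<lambda>k. z k \<bullet> b) k" for k b
      by (simp add: mult_var_def inner_diff_left)
    have "(\<Sum>k<d. \<Sum>l<d. P k l * (z k \<bullet> mult_var d a z l)) \<le>
        (\<Sum>b\<in>Basis. - s * (\<Sum>k<d. \<Sum>l<d. P k l * ((z k \<bullet> b) * (z l \<bullet> b))))"
      unfolding B mv by (intro sum_mono *(5))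
    then show "(\<Sum>k<d. \<Sum>l<d. P k l * (z k \<bullet> mult_var d a z l)) \<le> - s * (\<Sum>k<d. \<Sum>l<d. P k l * (z k \<bullet> z l))"
      unfolding B by (simp add: sum_distrib_left)
  qed
qed

section \<open>Exponential decay under quadratic perturbations\<close>

lemma norm_quadratic_form_le:
  fixes z y :: "nat \<Rightarrow> 'a::real_inner"
  assumes z: "\<And>k. k < d \<Longrightarrow> norm (z k) \<le> A" and y: "\<And>k. k < d \<Longrightarrow> norm (y k) \<le> B"
  shows "\<bar>\<Sum>k<d. \<Sum>l<d. P k l * (z k \<bullet> y l)\<bar> \<le> (\<Sum>k<d. \<Sum>l<d. \<bar>P k l\<bar>) * (A * B)"
proof -
  have "\<bar>\<Sum>k<d. \<Sum>l<d. P k l * (z k \<bullet> y l)\<bar> \<le> (\<Sum>k<d. \<Sum>l<d. \<bar>P k l\<bar> * (A * B))"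
  proof (intro order_trans[OF sum_abs] sum_mono)
    fix k l assume "k \<in> {..<d}" "l \<in> {..<d}"
    then have *: "norm (z k) \<le> A" "norm (y l) \<le> B" using z y by auto
    then have "norm (z k) * norm (y l) \<le> A * B" by (intro mult_mono) (auto intro: order_trans[OF norm_ge_zero])
    then have "\<bar>z k \<bullet> y l\<bar> \<le> A * B" using Cauchy_Schwarz_ineq2 order_trans by blast
    then show "\<bar>P k l * (z k \<bullet> y l)\<bar> \<le> \<bar>P k l\<bar> * (A * B)" by (simp add: abs_mult mult_left_mono)
  qed
  then show ?thesis by (simp add: sum_distrib_right)
qed

text \<open>Where the norm is below some \<open>r1\<close>, the quadratic perturbation costs at most half of the decay rate of the Lyapunov form, so the
  form decays exponentially there. Starting well below \<open>r1\<close> the solution cannot reach \<open>r1\<close>: the decay bound would already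
  have failed at the first time when it does.\<close>

lemma exponential_decay:
  assumes d: "d \<ge> 1" and h: "hurwitz (monic_poly d a)" and C: "C \<ge> 0" and r: "r > 0"
  obtains \<delta> M \<kappa> where "\<delta> > 0" "M > 0" "\<kappa> > 0" "M * \<delta> < r"
    "\<And>(z :: nat \<Rightarrow> real \<Rightarrow> 'a::euclidean_space) (N :: nat \<Rightarrow> real \<Rightarrow> 'a) t.
      (\<And>t k. t \<ge> 0 \<Longrightarrow> k < d \<Longrightarrow>
        (z k has_vector_derivative mult_var d a (\<lambda>k. z k t) k + N k t) (at t within {0..})) \<Longrightarrow>
      (\<And>t k. t \<ge> 0 \<Longrightarrow> k < d \<Longrightarrow> (\<Sum>k<d. norm (z k t)) < r \<Longrightarrow> norm (N k t) \<le> C * (\<Sum>k<d. norm (z k t))\<^sup>2) \<Longrightarrow>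
      (\<Sum>k<d. norm (z k 0)) < \<delta> \<Longrightarrow> t \<ge> 0 \<Longrightarrow>
      (\<Sum>k<d. norm (z k t)) \<le> M * exp (- \<kappa> * t) * (\<Sum>k<d. norm (z k 0))"
proof (rule lyapunov_form[OF d h, where 'a = 'a])
  fix P :: "nat \<Rightarrow> nat \<Rightarrow> real" and m s :: real
  assume m: "m > 0" and s: "s > 0" and sym: "\<And>k l. P k l = P l k"
    and lower: "\<And>z :: nat \<Rightarrow> 'a. m * (\<Sum>k<d. (norm (z k))\<^sup>2) \<le> (\<Sum>k<d. \<Sum>l<d. P k l * (z k \<bullet> z l))"
    and diss: "\<And>z :: nat \<Rightarrow> 'a. (\<Sum>k<d. \<Sum>l<d. P k l * (z k \<bullet> mult_var d a z l)) \<le> - s * (\<Sum>k<d. \<Sum>l<d. P k l * (z k \<bullet> z l))"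
  define p where "p = (\<Sum>k<d. \<Sum>l<d. \<bar>P k l\<bar>)"
  have p: "p \<ge> 0" by (simp add: p_def sum_nonneg)
  define Q where "Q z = (\<Sum>k<d. \<Sum>l<d. P k l * (z k \<bullet> z l))" for z :: "nat \<Rightarrow> 'a"
  define S where "S z = (\<Sum>k<d. norm (z k))" for z :: "nat \<Rightarrow> 'a"
  have S0: "S z \<ge> 0" for z by (simp add: S_def sum_nonneg)
  have nS: "norm (z k) \<le> S z" if "k < d" for z k unfolding S_def using that by (intro member_le_sum) auto
  have Q_upper: "Q z \<le> p * (S z)\<^sup>2" for z
    using norm_quadratic_form_le[of d z "S z" z "S z" P] nS by (simp add: Q_def p_def power2_eq_square)
  have Q_lower: "m / d * (S z)\<^sup>2 \<le> Q z" for z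
  proof -
    have "(S z)\<^sup>2 \<le> (\<Sum>k<d. (norm (z k))\<^sup>2) * real d"
      unfolding S_def using sum_squared_le_sum_of_squares[of "\<lambda>k. norm (z k)" "{..<d}"] by simp
    then have "m / d * (S z)\<^sup>2 \<le> m / d * ((\<Sum>k<d. (norm (z k))\<^sup>2) * real d)" using m by (intro mult_left_mono) auto
    also have "\<dots> = m * (\<Sum>k<d. (norm (z k))\<^sup>2)" using d by simp
    finally show ?thesis using lower[of z] by (simp add: Q_def)
  qed
  have Q0: "Q z \<ge> 0" for z using Q_lower[of z] m by (meson divide_nonneg_nonneg less_imp_le mult_nonneg_nonneg of_nat_0_le_iff order_trans zero_le_power2)
  define r1 where "r1 = min (r / 2) (s * m / (2 * p * C * d + 1))"
  have den: "2 * p * C * d + 1 > 0" using p C by (intro add_nonneg_pos mult_nonneg_nonneg) auto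
  have r1: "r1 > 0" "r1 < r" using r s m den by (auto simp: r1_def)
  have r1s: "2 * p * C * r1 \<le> s * (m / d)"
  proof -
    have "r1 \<le> s * m / (2 * p * C * d + 1)" by (simp add: r1_def)
    then have "r1 * (2 * p * C * d + 1) \<le> s * m" using den by (simp add: pos_le_divide_eq)
    then have "r1 * (2 * p * C * d) \<le> s * m" using r1 by (simp add: algebra_simps)
    then show ?thesis using d by (simp add: field_simps)
  qed
  define M where "M = sqrt (p * d / m) + 1"
  have M: "M \<ge> 1" "p * d / m \<le> M\<^sup>2"
  proof -
    have nn: "p * d / m \<ge> 0" using p m by simp
    then show "M \<ge> 1" by (simp add: M_def)
    have "(sqrt (p * d / m))\<^sup>2 \<le> M\<^sup>2" unfolding M_def using nn by (intro power_mono) auto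
    then show "p * d / m \<le> M\<^sup>2" using nn by simp
  qed
  define \<delta> where "\<delta> = r1 / M"
  show thesis
  proof (rule that[of \<delta> M "s / 2"])
    show "\<delta> > 0" "M > 0" "s / 2 > 0" using r1 M s by (auto simp: \<delta>_def)
    show "M * \<delta> < r" using M r1 by (simp add: \<delta>_def)
    fix z N :: "nat \<Rightarrow> real \<Rightarrow> 'a" and t :: real
    assume der: "\<And>t k. t \<ge> 0 \<Longrightarrow> k < d \<Longrightarrow>
        (z k has_vector_derivative mult_var d a (\<lambda>k. z k t) k + N k t) (at t within {0..})"
      and N: "\<And>t k. t \<ge> 0 \<Longrightarrow> k < d \<Longrightarrow> (\<Sum>k<d. norm (z k t)) < r \<Longrightarrow> norm (N k t) \<le> C * (\<Sum>k<d. norm (z k t))\<^sup>2"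
      and init: "(\<Sum>k<d. norm (z k 0)) < \<delta>" and t0: "t \<ge> 0"
    define zt where "zt t = (\<lambda>k. z k t)" for t
    have cz: "continuous_on {0..} (z k)" if "k < d" for k
      unfolding continuous_on_eq_continuous_within
    proof
      fix x :: real assume "x \<in> {0..}"
      then show "continuous (at x within {0..}) (z k)"
        using has_vector_derivative_continuous[OF der[of x k]] that by simp
    qed
    have cS: "continuous_on {0..} (\<lambda>t. S (zt t))" 
      unfolding S_def zt_def by (intro continuous_on_sum continuous_on_norm cz) simp
    have cQ: "continuous_on {0..} (\<lambda>t. Q (zt t))" 
      unfolding Q_def zt_def
      by (intro continuous_on_sum continuous_on_mult continuous_on_const continuous_on_inner cz) simp_all
    have dQ: "\<exists>D. ((\<lambda>t. Q (zt t)) has_real_derivative D) (at t) \<and> D \<le> - s * Q (zt t)"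
      if t: "t > 0" and St: "S (zt t) < r1" for t
    proof -
      define z' where "z' k = mult_var d a (zt t) k + N k t" for k
      have "(z k has_vector_derivative z' k) (at t)" if "k < d" for k
      proof -
        have "at t within {0..} = at t" using t by (intro at_within_interior) simp
        then show ?thesis using der[OF less_imp_le[OF t] that] by (simp only: z'_def zt_def)
      qed
      then have D: "((\<lambda>t. Q (zt t)) has_real_derivative
          (\<Sum>k<d. \<Sum>l<d. P k l * (z k t \<bullet> z' l + z' k \<bullet> z l t))) (at t)"
        unfolding Q_def zt_def
        by (intro DERIV_sum DERIV_cmult)
          (auto simp: has_real_derivative_iff_has_vector_derivative intro!: bounded_bilinear.has_vector_derivative[OF bounded_bilinear_inner])
      have sw: "(\<Sum>k<d. \<Sum>l<d. P k l * (z' k \<bullet> z l t)) = (\<Sum>k<d. \<Sum>l<d. P k l * (z k t \<bullet> z' l))"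
        by (subst sum.swap) (intro sum.cong refl, simp add: sym inner_commute)
      have "(\<Sum>k<d. \<Sum>l<d. P k l * (z k t \<bullet> z' l + z' k \<bullet> z l t)) = 2 * (\<Sum>k<d. \<Sum>l<d. P k l * (z k t \<bullet> z' l))"
        using sw by (simp add: distrib_left sum.distrib)
      also have "(\<Sum>k<d. \<Sum>l<d. P k l * (z k t \<bullet> z' l)) =
          (\<Sum>k<d. \<Sum>l<d. P k l * (zt t k \<bullet> mult_var d a (zt t) l)) + (\<Sum>k<d. \<Sum>l<d. P k l * (zt t k \<bullet> N l t))"
        by (simp add: z'_def zt_def inner_add_right distrib_left sum.distrib)
      also have "(\<Sum>k<d. \<Sum>l<d. P k l * (zt t k \<bullet> mult_var d a (zt t) l)) \<le> - s * Q (zt t)"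
        unfolding Q_def by (rule diss)
      also have "(\<Sum>k<d. \<Sum>l<d. P k l * (zt t k \<bullet> N l t)) \<le> (s / 2) * Q (zt t)"
      proof -
        have "norm (N k t) \<le> C * (S (zt t))\<^sup>2" if "k < d" for k
          using N[of t k] that t St r1 by (simp add: S_def zt_def)
        then have "\<bar>\<Sum>k<d. \<Sum>l<d. P k l * (zt t k \<bullet> N l t)\<bar> \<le> p * (S (zt t) * (C * (S (zt t))\<^sup>2))"
          unfolding p_def using nS[of _ "zt t"] by (intro norm_quadratic_form_le)
        also have "\<dots> = (p * C * S (zt t)) * (S (zt t))\<^sup>2" by simp
        also have "\<dots> \<le> (p * C * r1) * (S (zt t))\<^sup>2"
          using St p C by (intro mult_right_mono mult_left_mono) auto
        also have "\<dots> \<le> (s / 2 * (m / d)) * (S (zt t))\<^sup>2"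
        proof (rule mult_right_mono)
          have "2 * (p * C * r1) \<le> 2 * (s / 2 * (m / d))" using r1s by (simp only: mult.assoc) simp
          then show "p * C * r1 \<le> s / 2 * (m / d)" by linarith
        qed simp
        also have "\<dots> \<le> (s / 2) * Q (zt t)"
          using mult_left_mono[OF Q_lower[of "zt t"], of "s / 2"] s by (simp add: mult.assoc)
        finally show ?thesis by simp
      qed
      finally have "(\<Sum>k<d. \<Sum>l<d. P k l * (z k t \<bullet> z' l + z' k \<bullet> z l t)) \<le> - s * Q (zt t)" by simp
      with D show ?thesis by blast
    qed
    have bound: "S (zt T) \<le> M * exp (- (s / 2) * T) * S (zt 0)"
      if T: "T \<ge> 0" and below: "\<And>t. 0 < t \<Longrightarrow> t < T \<Longrightarrow> S (zt t) < r1" for T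
    proof -
      have "exp (s * T) * Q (zt T) \<le> exp (s * 0) * Q (zt 0)"
      proof (rule DERIV_nonpos_imp_decreasing_open[OF T])
        show "continuous_on {0..T} (\<lambda>t. exp (s * t) * Q (zt t))"
          by (intro continuous_intros continuous_on_subset[OF cQ]) auto
        fix x assume x: "0 < x" "x < T"
        obtain D where D: "((\<lambda>t. Q (zt t)) has_real_derivative D) (at x)" "D \<le> - s * Q (zt x)"
          using dQ[OF x(1) below[OF x]] by blast
        have "((\<lambda>t. exp (s * t) * Q (zt t)) has_real_derivative (exp (s * x) * s) * Q (zt x) + D * exp (s * x)) (at x)"
          by (rule DERIV_mult[OF _ D(1)]) (auto intro!: derivative_eq_intros)
        moreover have "D * exp (s * x) \<le> (- s * Q (zt x)) * exp (s * x)" using D(2) by (rule mult_right_mono) simp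
        then have "(exp (s * x) * s) * Q (zt x) + D * exp (s * x) \<le> 0" by (simp add: algebra_simps)
        ultimately show "\<exists>y. ((\<lambda>t. exp (s * t) * Q (zt t)) has_real_derivative y) (at x) \<and> y \<le> 0" by blast
      qed
      then have QT: "Q (zt T) \<le> exp (- s * T) * Q (zt 0)"
        by (simp add: exp_minus field_simps)
      have "(S (zt T))\<^sup>2 \<le> (d / m) * Q (zt T)" using Q_lower[of "zt T"] m d by (simp add: field_simps)
      also have "\<dots> \<le> (d / m) * (exp (- s * T) * (p * (S (zt 0))\<^sup>2))"
        using m by (intro mult_left_mono order_trans[OF QT] Q_upper) auto
      also have "\<dots> = (p * d / m) * (exp (- s * T) * (S (zt 0))\<^sup>2)" by simp
      also have "\<dots> \<le> M\<^sup>2 * (exp (- s * T) * (S (zt 0))\<^sup>2)" using M by (intro mult_right_mono) auto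
      also have "exp (- s * T) = (exp (- (s / 2) * T))\<^sup>2" by (simp add: exp_double[symmetric])
      also have "M\<^sup>2 * ((exp (- (s / 2) * T))\<^sup>2 * (S (zt 0))\<^sup>2) = (M * exp (- (s / 2) * T) * S (zt 0))\<^sup>2"
        by (simp add: power_mult_distrib)
      finally show ?thesis
      proof (rule power2_le_imp_le)
        show "0 \<le> M * exp (- (s / 2) * T) * S (zt 0)" using M(1) S0[of "zt 0"] by simp
      qed
    qed
    have init': "S (zt 0) < r1 / M" using init by (simp add: S_def zt_def \<delta>_def)
    have "S (zt t) < r1" if "t \<ge> 0" for t
    proof (rule ccontr)
      assume "\<not> S (zt t) < r1"
      then have tr: "r1 \<le> S (zt t)" by simp
      have z0: "S (zt 0) < r1"
      proof -
        have "r1 / M \<le> r1" using M r1 by (simp add: divide_le_eq)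
        then show ?thesis using init' by simp
      qed
      \<comment> \<open>the first time at which the bound is reached\<close>
      have "\<exists>T\<in>{0..t}. S (zt T) = r1 \<and> (\<forall>x. 0 \<le> x \<and> x < T \<longrightarrow> S (zt x) \<noteq> r1)"
      proof -
        have ne: "{x \<in> {0..t}. S (zt x) = r1} \<noteq> {}"
          using IVT'[of "\<lambda>x. S (zt x)" 0 r1 t] z0 tr \<open>t \<ge> 0\<close> continuous_on_subset[OF cS, of "{0..t}"] by auto
        have "closed {x \<in> {0..t}. S (zt x) = r1}"
          by (intro continuous_closed_preimage_constant continuous_on_subset[OF cS]) auto
        then have "compact {x \<in> {0..t}. S (zt x) = r1}"
          by (rule compact_eq_bounded_closed[THEN iffD2, OF conjI, rotated])
            (rule bounded_subset[of "{0..t}"], auto)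
        from compact_attains_inf[OF this ne] show ?thesis by force
      qed
      then obtain T where T: "T \<ge> 0" "S (zt T) = r1" "\<And>x. 0 \<le> x \<Longrightarrow> x < T \<Longrightarrow> S (zt x) \<noteq> r1" by auto
      have "S (zt x) < r1" if x: "0 < x" "x < T" for x
      proof (rule ccontr)
        assume "\<not> S (zt x) < r1"
        then obtain y where "0 \<le> y" "y \<le> x" "S (zt y) = r1"
          using IVT'[of "\<lambda>x. S (zt x)" 0 r1 x] z0 x continuous_on_subset[OF cS, of "{0..x}"] by auto
        then show False using T(3)[of y] x by simp
      qed
      then have "r1 \<le> M * exp (- (s / 2) * T) * S (zt 0)" using bound[of T] T by simp
      also have "\<dots> \<le> M * 1 * S (zt 0)" using M s T S0 by (intro mult_right_mono mult_left_mono) auto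
      also have "\<dots> < r1" using init' M by (simp add: field_simps)
      finally show False by simp
    qed
    then show "(\<Sum>k<d. norm (z k t)) \<le> M * exp (- (s / 2) * t) * (\<Sum>k<d. norm (z k 0))"
      using bound[OF t0] by (simp add: S_def zt_def)
  qed
qed

section \<open>Differential equations with globally Lipschitz right-hand side\<close>

lemma indefinite_integral_derivative:
  fixes g :: "real \<Rightarrow> 'a::banach"
  assumes "continuous_on {0..} g" "t \<ge> 0"
  shows "((\<lambda>t. integral {0..t} g) has_vector_derivative g t) (at t within {0..})"
proof -
  have "((\<lambda>t. integral {0..t} g) has_vector_derivative g t) (at t within {0..t+1})"
    using assms by (intro integral_has_vector_derivative continuous_on_subset[OF assms(1)]) auto
  also have "at t within {0..t+1} = at t within {0..}"
    by (rule at_within_nhd[of t "{..<t+1}"]) auto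
  finally show ?thesis .
qed

lemma weighted_integral_bound:
  fixes g :: "real \<Rightarrow> 'a::banach"
  assumes L: "L > 0" and g: "continuous_on {0..} g" "\<And>s. s \<ge> 0 \<Longrightarrow> norm (g s) \<le> L * exp (2 * L * s) * D"
    and D: "D \<ge> 0" and t: "t \<ge> 0"
  shows "norm (exp (- 2 * L * t) *\<^sub>R integral {0..t} g) \<le> D / 2"
proof -
  have "((\<lambda>s. L * exp (2 * L * s) * D) has_integral exp (2 * L * t) * D / 2 - exp (2 * L * 0) * D / 2) {0..t}"
    using t L by (intro fundamental_theorem_of_calculus)
      (auto intro!: derivative_eq_intros simp: has_real_derivative_iff_has_vector_derivative[symmetric])
  note I = this
  have "norm (integral {0..t} g) \<le> integral {0..t} (\<lambda>s. L * exp (2 * L * s) * D)"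
    using g by (intro integral_norm_bound_integral integrable_continuous_real continuous_on_subset[OF g(1)])
      (auto intro!: continuous_intros)
  also have "\<dots> = exp (2 * L * t) * D / 2 - D / 2" unfolding integral_unique[OF I] by simp
  finally have "norm (integral {0..t} g) \<le> exp (2 * L * t) * D / 2 - D / 2" .
  then have "norm (integral {0..t} g) \<le> exp (2 * L * t) * (D / 2)" using D by simp
  then have "exp (- 2 * L * t) * norm (integral {0..t} g) \<le> exp (- 2 * L * t) * (exp (2 * L * t) * (D / 2))"
    by (intro mult_left_mono) auto
  then show ?thesis by (simp add: mult.assoc[symmetric] exp_add[symmetric])
qed

text \<open>Picard iteration on the bounded continuous functions, after weighting with \<open>exp (- 2 L t)\<close>: the weight makes
  the integral operator a contraction on the whole half-line.\<close>

lemma lipschitz_ode_global: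
  fixes F :: "'a::banach \<Rightarrow> 'a"
  assumes L: "L > 0" and lip: "\<And>x y. norm (F x - F y) \<le> L * norm (x - y)" and F0: "F 0 = 0"
  shows "\<exists>y. y 0 = y0 \<and> (\<forall>t\<ge>0. (y has_vector_derivative F (y t)) (at t within {0..}))"
proof -
  define g where "g z s = F (exp (2 * L * s) *\<^sub>R apply_bcontfun z s)" for z :: "real \<Rightarrow>\<^sub>C 'a" and s
  have cF: "continuous_on UNIV F"
    using lipschitz_on_continuous_on[of L UNIV F] lip L by (auto simp: lipschitz_on_def dist_norm)
  have cg: "continuous_on S (g z)" for z S unfolding g_def
    by (intro continuous_on_compose2[OF cF] continuous_intros) auto
  define J where "J z t = integral {0..t} (g z)" for z t
  have dJ: "(J z has_vector_derivative g z t) (at t within {0..})" if "t \<ge> 0" for z t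
    unfolding J_def using that by (intro indefinite_integral_derivative cg)
  have cJ: "continuous_on {0..} (J z)" for z
    unfolding continuous_on_eq_continuous_within
    using has_vector_derivative_continuous[OF dJ] by (meson atLeast_iff)
  define Phi where "Phi z t = exp (- 2 * L * max 0 t) *\<^sub>R (y0 + J z (max 0 t))" for z t
  have cPhi: "continuous_on UNIV (Phi z)" for z
    unfolding Phi_def by (intro continuous_intros continuous_on_compose2[OF cJ]) auto
  have gb: "norm (g z s) \<le> L * exp (2 * L * s) * norm z" for z s
  proof -
    have "norm (g z s) \<le> L * norm (exp (2 * L * s) *\<^sub>R apply_bcontfun z s)"
      using lip[of "exp (2 * L * s) *\<^sub>R apply_bcontfun z s" 0] F0 by (simp add: g_def)
    also have "\<dots> \<le> L * (exp (2 * L * s) * norm z)"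
      using L norm_bounded[of z s] by (intro mult_left_mono) auto
    finally show ?thesis by simp
  qed
  have gd: "norm (g z s - g w s) \<le> L * exp (2 * L * s) * norm (z - w)" for z w s
  proof -
    have "norm (g z s - g w s) \<le> L * norm (exp (2 * L * s) *\<^sub>R apply_bcontfun (z - w) s)"
      using lip by (simp add: g_def scaleR_diff_right)
    also have "\<dots> \<le> L * (exp (2 * L * s) * norm (z - w))"
      using L norm_bounded[of "z - w" s] by (intro mult_left_mono) auto
    finally show ?thesis by simp
  qed
  have Phi_in: "Phi z \<in> bcontfun" for z
  proof (rule bcontfun_normI[OF cPhi])
    fix t :: real
    have "norm (Phi z t) \<le> norm (exp (- 2 * L * max 0 t) *\<^sub>R y0) + norm (exp (- 2 * L * max 0 t) *\<^sub>R J z (max 0 t))"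
      unfolding Phi_def scaleR_add_right by (rule norm_triangle_ineq)
    also have "\<dots> \<le> norm y0 + norm z / 2"
    proof (rule add_mono)
      have "exp (- 2 * L * max 0 t) \<le> 1" using L by simp
      then show "norm (exp (- 2 * L * max 0 t) *\<^sub>R y0) \<le> norm y0" by (simp add: mult_left_le_one_le)
      show "norm (exp (- 2 * L * max 0 t) *\<^sub>R J z (max 0 t)) \<le> norm z / 2"
        unfolding J_def by (intro weighted_integral_bound L cg gb) auto
    qed
    finally show "norm (Phi z t) \<le> norm y0 + norm z / 2" .
  qed
  have "\<exists>!z. Bcontfun (Phi z) = z"
  proof (rule banach_fix_type[of "1/2"])
    show "\<forall>z w. dist (Bcontfun (Phi z)) (Bcontfun (Phi w)) \<le> 1/2 * dist z w"
    proof (intro allI, rule dist_bound)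
      fix z w :: "real \<Rightarrow>\<^sub>C 'a" and t :: real
      have i: "g z integrable_on {0..max 0 t}" for z by (intro integrable_continuous_real cg)
      have "Phi z t - Phi w t = exp (- 2 * L * max 0 t) *\<^sub>R integral {0..max 0 t} (\<lambda>s. g z s - g w s)"
        unfolding Phi_def J_def by (simp add: integral_diff[OF i i] scaleR_diff_right[symmetric] del: max_def)
      then have "norm (Phi z t - Phi w t) \<le> norm (z - w) / 2"
        by (simp only:) (intro weighted_integral_bound L continuous_intros cg gd, auto)
      then show "dist (apply_bcontfun (Bcontfun (Phi z)) t) (apply_bcontfun (Bcontfun (Phi w)) t) \<le> 1/2 * dist z w"
        by (simp add: Bcontfun_inverse[OF Phi_in] dist_norm)
    qed
  qed auto
  then obtain z where "Bcontfun (Phi z) = z" by blast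
  then have z: "apply_bcontfun z = Phi z" by (metis Bcontfun_inverse Phi_in)
  define y where "y t = y0 + J z t" for t
  have gy: "g z t = F (y t)" if "t \<ge> 0" for t
    using that unfolding g_def z Phi_def y_def by (simp add: exp_add[symmetric])
  have "y 0 = y0" by (simp add: y_def J_def)
  moreover have "(y has_vector_derivative F (y t)) (at t within {0..})" if "t \<ge> 0" for t
    using has_vector_derivative_add[OF has_vector_derivative_const dJ[OF that, of z], of y0] gy[OF that]
    by (simp add: y_def[abs_def])
  ultimately show ?thesis by blast
qed

instance bcontfun :: (metric_space, banach) banach ..

text \<open>A finite system is an equation for bounded functions on the discrete space of indices.\<close>

lemma lipschitz_ode_system:
  fixes F :: "(nat \<Rightarrow> 'a::banach) \<Rightarrow> nat \<Rightarrow> 'a"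
  assumes L: "L \<ge> 0"
    and lip: "\<And>x y k. k < d \<Longrightarrow> norm (F x k - F y k) \<le> L * (\<Sum>j<d. norm (x j - y j))"
    and F0: "\<And>k. k < d \<Longrightarrow> F (\<lambda>_. 0) k = 0"
  obtains y where "\<And>k. k < d \<Longrightarrow> y k 0 = y0 k"
    "\<And>k t. k < d \<Longrightarrow> t \<ge> 0 \<Longrightarrow> (y k has_vector_derivative F (\<lambda>j. y j t) k) (at t within {0..})"
proof -
  define cut where "cut f = (\<lambda>k. if of_discrete k < d then f (of_discrete k) else (0::'a))" for f
  have cut: "cut f \<in> bcontfun" for f
  proof (rule bcontfun_normI)
    show "continuous_on UNIV (cut f)" by (simp add: continuous_on_open_vimage open_discrete)
    show "norm (cut f k) \<le> (\<Sum>j<d. norm (f j))" for k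
      unfolding cut_def by (auto intro!: member_le_sum sum_nonneg)
  qed
  define inc :: "(nat \<Rightarrow> 'a) \<Rightarrow> nat discrete \<Rightarrow>\<^sub>C 'a" where "inc f = Bcontfun (cut f)" for f
  have inc: "apply_bcontfun (inc f) (discrete k) = (if k < d then f k else 0)" for f k
    unfolding inc_def Bcontfun_inverse[OF cut] by (simp add: cut_def discrete_inverse)
  define vals where "vals x k = apply_bcontfun x (discrete k)" for x :: "nat discrete \<Rightarrow>\<^sub>C 'a" and k
  have "\<exists>Y. Y 0 = inc y0 \<and> (\<forall>t\<ge>0. (Y has_vector_derivative inc (F (vals (Y t)))) (at t within {0..}))"
  proof (rule lipschitz_ode_global[of "L * d + 1" "\<lambda>Y. inc (F (vals Y))"])
    show "L * d + 1 > 0" using L by (simp add: add_nonneg_pos)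
    fix x y :: "nat discrete \<Rightarrow>\<^sub>C 'a"
    show "norm (inc (F (vals x)) - inc (F (vals y))) \<le> (L * d + 1) * norm (x - y)"
    proof (rule norm_bound)
      fix i :: "nat discrete"
      obtain k where i: "i = discrete k" by (metis of_discrete_inverse)
      show "norm (apply_bcontfun (inc (F (vals x)) - inc (F (vals y))) i) \<le> (L * d + 1) * norm (x - y)"
      proof (cases "k < d")
        case True
        have "norm (F (vals x) k - F (vals y) k) \<le> L * (\<Sum>j<d. norm (vals x j - vals y j))"
          by (rule lip[OF True])
        also have "\<dots> \<le> L * (\<Sum>j<d. norm (x - y))"
          using norm_bounded[of "x - y"] L by (intro mult_left_mono sum_mono) (auto simp: vals_def)
        also have "\<dots> \<le> (L * d + 1) * norm (x - y)" by (simp add: algebra_simps)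
        finally show ?thesis using True by (simp add: inc i)
      next
        case False then show ?thesis using L by (simp add: inc i)
      qed
    qed
  next
    show "inc (F (vals 0)) = 0"
    proof (rule bcontfun_eqI)
      fix i :: "nat discrete"
      obtain k where i: "i = discrete k" by (metis of_discrete_inverse)
      have "vals 0 = (\<lambda>_. 0)" by (simp add: vals_def fun_eq_iff)
      then show "apply_bcontfun (inc (F (vals 0))) i = apply_bcontfun 0 i" by (simp add: inc i F0)
    qed
  qed
  then obtain Y where Y: "Y 0 = inc y0"
    "\<And>t. t \<ge> 0 \<Longrightarrow> (Y has_vector_derivative inc (F (vals (Y t)))) (at t within {0..})" by blast
  have bl: "bounded_linear (\<lambda>x. vals x k)" for k
    by (rule bounded_linear_intro[where K = 1]) (auto simp: norm_bounded vals_def)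
  show thesis
  proof (rule that[of "\<lambda>k t. vals (Y t) k"])
    show "vals (Y 0) k = y0 k" if "k < d" for k using that by (simp add: Y inc vals_def)
    fix k t assume "k < d" "(t::real) \<ge> 0"
    then show "((\<lambda>t. vals (Y t) k) has_vector_derivative F (\<lambda>j. vals (Y t) j) k) (at t within {0..})"
      using bounded_linear.has_vector_derivative[OF bl Y(2), of t k] by (simp add: inc vals_def[of "inc _"])
  qed
qed

section \<open>The error system in coordinates\<close>

text \<open>The coordinate of index \<open>d - 1\<close> is \<open>E - 1\<close>, the one of index \<open>d - i\<close> is \<open>- e i\<close>. The linear part of the error
  dynamics is then multiplication by the variable modulo the characteristic polynomial.\<close>

definition err_rest :: "nat \<Rightarrow> (nat \<Rightarrow> real) \<Rightarrow> (nat \<Rightarrow> real^'n::finite^'n) \<Rightarrow> nat \<Rightarrow> real^'n^'n" where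
  "err_rest d a z k =
     - a k *\<^sub>R (principal_log (mat 1 + z (d - 1)) - z (d - 1))
     + (if k = d - 1 then z (d - 2) ** z (d - 1) - a (d - 1) *\<^sub>R (z (d - 1) ** principal_log (mat 1 + z (d - 1))) else 0)"

definition err_field :: "nat \<Rightarrow> (nat \<Rightarrow> real) \<Rightarrow> (nat \<Rightarrow> real^'n::finite^'n) \<Rightarrow> nat \<Rightarrow> real^'n^'n" where
  "err_field d a z k = mult_var d a z k + err_rest d a z k"

lemma err_field_lower:
  "k < d - 1 \<Longrightarrow> err_field d a z k = (if k = 0 then 0 else z (k - 1)) - a k *\<^sub>R principal_log (mat 1 + z (d - 1))"
  by (simp add: err_field_def mult_var_def err_rest_def algebra_simps)

lemma err_field_top:
  assumes "d \<ge> 2"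
  shows "err_field d a z (d - 1) = z (d - 2) ** (mat 1 + z (d - 1))
    - a (d - 1) *\<^sub>R ((mat 1 + z (d - 1)) ** principal_log (mat 1 + z (d - 1)))"
proof -
  have "d - 1 - 1 = d - 2" "d - 1 \<noteq> 0" using assms by auto
  then show ?thesis
    by (simp add: err_field_def mult_var_def err_rest_def mm.add_left mm.add_right algebra_simps)
qed

text \<open>Over \<open>n\<close> steps of length \<open>t / n\<close> the errors \<open>C h^2\<close> accumulate to at most \<open>C t^2 exp (L t) / n\<close>.\<close>

lemma discrete_gronwall_zero:
  fixes D :: "real \<Rightarrow> real"
  assumes h0: "h0 > 0" and L: "L \<ge> 0" and C: "C \<ge> 0" and D: "\<And>t. t \<ge> 0 \<Longrightarrow> D t \<ge> 0" "D 0 = 0"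
    and step: "\<And>t h. t \<ge> 0 \<Longrightarrow> 0 < h \<Longrightarrow> h \<le> h0 \<Longrightarrow> D (t + h) \<le> (1 + L * h) * D t + C * h\<^sup>2"
    and t: "t \<ge> 0"
  shows "D t = 0"
proof (cases "t = 0")
  case False
  then have t: "t > 0" using t by simp
  have bound: "D t \<le> C * t\<^sup>2 * exp (L * t) * inverse (real n)" if n: "real n \<ge> t / h0" "n > 0" for n
  proof -
    define h where "h = t / real n"
    have h: "0 < h" "h \<le> h0" "real n * h = t" using n t h0 by (auto simp: h_def field_simps)
    have "D (real k * h) \<le> C * h\<^sup>2 * real k * (1 + L * h) ^ k" for k
    proof (induction k)
      case 0 show ?case using D by simp
    next
      case (Suc k)
      have "D (real (Suc k) * h) = D (real k * h + h)" by (simp add: algebra_simps)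
      also have "\<dots> \<le> (1 + L * h) * D (real k * h) + C * h\<^sup>2" using h by (intro step) auto
      also have "\<dots> \<le> (1 + L * h) * (C * h\<^sup>2 * real k * (1 + L * h) ^ k) + C * h\<^sup>2"
        using Suc L h by (intro add_right_mono mult_left_mono) auto
      also have "\<dots> \<le> (1 + L * h) * (C * h\<^sup>2 * real k * (1 + L * h) ^ k) + C * h\<^sup>2 * (1 + L * h) ^ Suc k"
      proof -
        have "1 \<le> (1 + L * h) ^ Suc k" using L h by (intro one_le_power) auto
        then have "C * h\<^sup>2 * 1 \<le> C * h\<^sup>2 * (1 + L * h) ^ Suc k" using C by (intro mult_left_mono) auto
        then show ?thesis by simp
      qed
      also have "\<dots> = C * h\<^sup>2 * real (Suc k) * (1 + L * h) ^ Suc k" by (simp add: algebra_simps)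
      finally show ?case .
    qed
    from this[of n] have "D t \<le> C * h\<^sup>2 * real n * (1 + L * h) ^ n" by (simp only: h)
    also have "(1 + L * h) ^ n \<le> exp (L * h) ^ n" using L h by (intro power_mono exp_ge_add_one_self) auto
    also have "exp (L * h) ^ n = exp (L * t)" using h(3) by (simp add: exp_of_nat_mult[symmetric] mult.left_commute)
    finally have "D t \<le> C * h\<^sup>2 * real n * exp (L * t)" using C by (simp add: mult_left_mono)
    also have "h\<^sup>2 * real n = t\<^sup>2 * inverse (real n)" using n by (simp add: h_def power2_eq_square field_simps)
    then have "C * h\<^sup>2 * real n * exp (L * t) = C * t\<^sup>2 * exp (L * t) * inverse (real n)" by (simp add: mult_ac)
    finally show ?thesis .
  qed
  have "(\<lambda>n. C * t\<^sup>2 * exp (L * t) * inverse (real n)) \<longlonglongrightarrow> C * t\<^sup>2 * exp (L * t) * 0"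
    by (intro tendsto_mult tendsto_const lim_inverse_n)
  then have "(\<lambda>n. C * t\<^sup>2 * exp (L * t) * inverse (real n)) \<longlonglongrightarrow> 0" by simp
  moreover have "eventually (\<lambda>n. D t \<le> C * t\<^sup>2 * exp (L * t) * inverse (real n)) sequentially"
    using eventually_ge_at_top[of "nat \<lceil>t / h0\<rceil>"] eventually_gt_at_top[of 0]
    by eventually_elim (intro bound, auto simp: nat_le_iff ceiling_le_iff)
  ultimately have "D t \<le> 0" by (rule tendsto_lowerbound) simp
  then show ?thesis using D(1)[of t] t by simp
qed (use D in simp)

lemma infdist_approx:
  assumes "A \<noteq> {}" "e > 0" obtains y where "y \<in> A" "dist x y < infdist x A + e"
proof -
  have "Inf (dist x ` A) < infdist x A + e" using assms by (simp add: infdist_notempty)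
  then show thesis using cInf_lessD[of "dist x ` A"] assms that by auto
qed

locale observer_error = lie_group rho c dimension G for rho c and dimension :: "'n::finite itself" and G +
  fixes d :: nat and a :: "nat \<Rightarrow> real"
  assumes d: "d \<ge> 2" and hurwitz: "hurwitz (monic_poly d a)"
begin

abbreviation size_of :: "(nat \<Rightarrow> real^'n^'n) \<Rightarrow> real" where "size_of z \<equiv> \<Sum>k<d. norm (z k)"

definition asum :: real where "asum = (\<Sum>k<d. \<bar>a k\<bar>)"

lemma asum: "k < d \<Longrightarrow> \<bar>a k\<bar> \<le> asum" "asum \<ge> 0"
  unfolding asum_def by (auto intro!: member_le_sum sum_nonneg)

lemma norm_le_size: "k < d \<Longrightarrow> norm (z k) \<le> size_of z"
  by (intro member_le_sum) auto

lemma err_rest_quadratic: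
  assumes "size_of z < rho" "k < d"
  shows "norm (err_rest d a z k) \<le> (asum * (c + 2) + 1) * (size_of z)\<^sup>2"
proof -
  define S where "S = size_of z"
  define e where "e = z (d - 1)"
  define l where "l = principal_log (mat 1 + e)"
  have S: "S \<ge> 0" unfolding S_def by (intro sum_nonneg) auto
  have e: "norm e \<le> S" "norm (z (d - 2)) \<le> S" using d unfolding e_def S_def by (intro norm_le_size; simp)+
  then have er: "norm (mat 1 + e - mat 1) < rho" using assms by (simp add: S_def)
  have "norm (l - e) \<le> c * norm e * norm e" using log_minus[OF er] by (simp add: l_def)
  also have "\<dots> \<le> c * S * S" using e S c by (intro mult_mono) auto
  finally have le: "norm (l - e) \<le> c * S * S" .
  have l: "norm l \<le> 2 * S" using log_bound[OF er] e by (simp add: l_def)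
  have "norm (err_rest d a z k) \<le> norm (- a k *\<^sub>R (l - e)) +
      norm (if k = d - 1 then z (d - 2) ** e - a (d - 1) *\<^sub>R (e ** l) else 0)"
    unfolding err_rest_def e_def[symmetric] l_def[symmetric] by (rule norm_triangle_ineq)
  also have "\<dots> \<le> asum * (c * S * S) + (S * S + asum * (S * (2 * S)))"
  proof (rule add_mono)
    show "norm (- a k *\<^sub>R (l - e)) \<le> asum * (c * S * S)"
      unfolding norm_scaleR using asum assms(2) le by (intro mult_mono) auto
    have "norm (z (d - 2) ** e - a (d - 1) *\<^sub>R (e ** l)) \<le> norm (z (d - 2) ** e) + norm (a (d - 1) *\<^sub>R (e ** l))"
      by (rule norm_triangle_ineq4)
    also have "\<dots> \<le> S * S + asum * (S * (2 * S))"
      unfolding norm_scaleR using asum d e l S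
      by (intro add_mono mult_mono order_trans[OF norm_matrix_mult_le]) auto
    finally show "norm (if k = d - 1 then z (d - 2) ** e - a (d - 1) *\<^sub>R (e ** l) else 0) \<le> S * S + asum * (S * (2 * S))"
      using S asum by auto
  qed
  also have "\<dots> = (asum * (c + 2) + 1) * S\<^sup>2" by (simp add: power2_eq_square algebra_simps)
  finally show ?thesis by (simp add: S_def)
qed

lemma norm_mult_diff_le:
  fixes A A' B B' :: "real^'n^'n"
  assumes "norm A \<le> r" "norm B' \<le> r'"
  shows "norm (A ** B - A' ** B') \<le> r * norm (B - B') + norm (A - A') * r'"
proof -
  have "A ** B - A' ** B' = A ** (B - B') + (A - A') ** B'" by (simp add: mm.diff_left mm.diff_right)
  also have "norm \<dots> \<le> norm A * norm (B - B') + norm (A - A') * norm B'"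
    by (intro norm_triangle_le add_mono norm_matrix_mult_le)
  also have "\<dots> \<le> r * norm (B - B') + norm (A - A') * r'" using assms by (intro add_mono mult_mono) (auto intro: order_trans[OF norm_ge_zero])
  finally show ?thesis .
qed

lemma err_rest_lipschitz:
  fixes x y :: "nat \<Rightarrow> real^'n^'n"
  assumes x: "\<And>k. k < d \<Longrightarrow> norm (x k) \<le> rho / 2" and y: "\<And>k. k < d \<Longrightarrow> norm (y k) \<le> rho / 2" and k: "k < d"
  shows "norm (err_rest d a x k - err_rest d a y k) \<le> (5 * asum + 2) * (\<Sum>j<d. norm (x j - y j))"
proof -
  define D where "D = (\<Sum>j<d. norm (x j - y j))"
  define e f where "e = x (d - 1)" and "f = y (d - 1)"
  define l m where "l = principal_log (mat 1 + e)" and "m = principal_log (mat 1 + f)"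
  have D: "norm (e - f) \<le> D" "norm (x (d - 2) - y (d - 2)) \<le> D"
    unfolding D_def e_def f_def using d by (intro member_le_sum[of _ "{..<d}" "\<lambda>j. norm (x j - y j)"]; simp)+
  have D0: "D \<ge> 0" unfolding D_def by (intro sum_nonneg) auto
  have n: "norm e \<le> rho / 2" "norm f \<le> rho / 2" "norm (x (d - 2)) \<le> rho / 2"
    using x y d by (auto simp: e_def f_def)
  have r: "norm (mat 1 + e - mat 1) < rho" "norm (mat 1 + f - mat 1) < rho" using n rho by auto
  have "norm (l - m - (e - f)) \<le> c * (norm e + norm f) * norm (e - f)"
    using log_diff[OF r] by (simp add: l_def m_def)
  also have "\<dots> \<le> 1 * D"
  proof (intro mult_mono)
    have "c * (norm e + norm f) \<le> c * rho" using n c by (intro mult_left_mono) auto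
    then show "c * (norm e + norm f) \<le> 1" using c by linarith
  qed (use D in auto)
  finally have le: "norm ((l - e) - (m - f)) \<le> D" by (simp add: algebra_simps)
  have lm: "norm (l - m) \<le> 2 * D"
    using norm_triangle_ineq[of "(l - e) - (m - f)" "e - f"] le D by simp
  have m: "norm m \<le> 1" using log_bound[OF r(2)] n rho by (simp add: m_def)
  have n1: "norm (x (d - 2)) \<le> 1" "norm f \<le> 1" "norm e \<le> 1" using n rho by auto
  have xe: "norm (x (d - 2) ** e - y (d - 2) ** f) \<le> 2 * D"
    using norm_mult_diff_le[OF n1(1,2), of e "y (d - 2)"] D by simp
  have el: "norm (e ** l - f ** m) \<le> 4 * D"
    using norm_mult_diff_le[OF n1(3) m, of l f] lm D D0 by simp
  have "err_rest d a x k - err_rest d a y k = - a k *\<^sub>R ((l - e) - (m - f)) +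
      (if k = d - 1 then (x (d - 2) ** e - y (d - 2) ** f) - a (d - 1) *\<^sub>R (e ** l - f ** m) else 0)"
    unfolding err_rest_def e_def[symmetric] f_def[symmetric] l_def[symmetric] m_def[symmetric]
    by (simp add: algebra_simps)
  also have "norm \<dots> \<le> norm (- a k *\<^sub>R ((l - e) - (m - f))) +
      norm (if k = d - 1 then (x (d - 2) ** e - y (d - 2) ** f) - a (d - 1) *\<^sub>R (e ** l - f ** m) else 0)"
    by (rule norm_triangle_ineq)
  also have "\<dots> \<le> asum * D + (2 * D + asum * (4 * D))"
  proof (rule add_mono)
    show "norm (- a k *\<^sub>R ((l - e) - (m - f))) \<le> asum * D"
      unfolding norm_scaleR using asum k le by (intro mult_mono) auto
    have "norm ((x (d - 2) ** e - y (d - 2) ** f) - a (d - 1) *\<^sub>R (e ** l - f ** m)) \<le> 2 * D + asum * (4 * D)"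
    proof (rule order_trans[OF norm_triangle_ineq4 add_mono[OF xe]])
      show "norm (a (d - 1) *\<^sub>R (e ** l - f ** m)) \<le> asum * (4 * D)"
        unfolding norm_scaleR using asum d el by (intro mult_mono) auto
    qed
    then show "norm (if k = d - 1 then (x (d - 2) ** e - y (d - 2) ** f) - a (d - 1) *\<^sub>R (e ** l - f ** m) else 0)
        \<le> 2 * D + asum * (4 * D)"
      using D0 asum by auto
  qed
  finally show ?thesis by (simp add: D_def[symmetric] algebra_simps)
qed

lemma mult_var_lipschitz:
  fixes x y :: "nat \<Rightarrow> real^'n^'n"
  assumes "k < d"
  shows "norm (mult_var d a x k - mult_var d a y k) \<le> (1 + asum) * (\<Sum>j<d. norm (x j - y j))"
proof -
  define D where "D = (\<Sum>j<d. norm (x j - y j))"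
  have D: "norm (x j - y j) \<le> D" if "j < d" for j
    unfolding D_def using that by (intro member_le_sum) auto
  have D0: "D \<ge> 0" unfolding D_def by (intro sum_nonneg) auto
  have "mult_var d a x k - mult_var d a y k =
      (if k = 0 then 0 else x (k - 1) - y (k - 1)) - a k *\<^sub>R (x (d - 1) - y (d - 1))"
    by (simp add: mult_var_def algebra_simps)
  also have "norm \<dots> \<le> norm (if k = 0 then 0 else x (k - 1) - y (k - 1)) + norm (a k *\<^sub>R (x (d - 1) - y (d - 1)))"
    by (rule norm_triangle_ineq4)
  also have "\<dots> \<le> D + asum * D"
  proof (rule add_mono)
    show "norm (if k = 0 then 0 else x (k - 1) - y (k - 1)) \<le> D" using D[of "k - 1"] D0 assms by auto
    show "norm (a k *\<^sub>R (x (d - 1) - y (d - 1))) \<le> asum * D"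
      unfolding norm_scaleR using asum assms d by (intro mult_mono D) auto
  qed
  finally show ?thesis by (simp add: D_def[symmetric] algebra_simps)
qed

lemma err_field_lipschitz:
  fixes x y :: "nat \<Rightarrow> real^'n^'n"
  assumes "\<And>k. k < d \<Longrightarrow> norm (x k) \<le> rho / 2" "\<And>k. k < d \<Longrightarrow> norm (y k) \<le> rho / 2" "k < d"
  shows "norm (err_field d a x k - err_field d a y k) \<le> (6 * asum + 3) * (\<Sum>j<d. norm (x j - y j))"
proof -
  have "err_field d a x k - err_field d a y k = (mult_var d a x k - mult_var d a y k) + (err_rest d a x k - err_rest d a y k)"
    by (simp add: err_field_def)
  also have "norm \<dots> \<le> norm (mult_var d a x k - mult_var d a y k) + norm (err_rest d a x k - err_rest d a y k)"
    by (rule norm_triangle_ineq)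
  also have "\<dots> \<le> (1 + asum) * (\<Sum>j<d. norm (x j - y j)) + (5 * asum + 2) * (\<Sum>j<d. norm (x j - y j))"
    by (intro add_mono mult_var_lipschitz err_rest_lipschitz assms)
  finally show ?thesis by (simp add: algebra_simps)
qed

lemma err_field_0: "err_field d a (\<lambda>_. 0) k = (0 :: real^'n^'n)"
  by (simp add: err_field_def mult_var_def err_rest_def log_mat_1 mm.zero_left)

lemma err_field_bound:
  assumes "\<And>k. k < d \<Longrightarrow> norm (x k) \<le> rho / 2" "k < d"
  shows "norm (err_field d a x k) \<le> (6 * asum + 3) * size_of x"
  using err_field_lipschitz[of x "\<lambda>_. 0" k] assms rho by (simp add: err_field_0)

text \<open>Projecting the arguments of the nonlinear part to a small ball makes the field globally Lipschitz.
  Small solutions do not feel the difference, and by the decay estimate they stay small.\<close>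

lemma error_dynamics:
  assumes r: "0 < r" "r \<le> rho / 2"
  obtains \<delta> M \<kappa> where "\<delta> > 0" "M > 0" "\<kappa> > 0"
    "\<And>z t. (\<And>t k. t \<ge> 0 \<Longrightarrow> k < d \<Longrightarrow>
        (z k has_vector_derivative err_field d a (\<lambda>k. z k t) k) (at t within {0..})) \<Longrightarrow>
      size_of (\<lambda>k. z k 0) < \<delta> \<Longrightarrow> t \<ge> 0 \<Longrightarrow>
      size_of (\<lambda>k. z k t) \<le> M * exp (- \<kappa> * t) * size_of (\<lambda>k. z k 0)"
    "\<And>z0. size_of z0 < \<delta> \<Longrightarrow> \<exists>z. (\<forall>k<d. z k 0 = z0 k) \<and> (\<forall>t\<ge>0. size_of (\<lambda>k. z k t) < r) \<and>
      (\<forall>t\<ge>0. \<forall>k<d. (z k has_vector_derivative err_field d a (\<lambda>k. z k t) k) (at t within {0..}))"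
proof -
  have d1: "d \<ge> 1" using d by simp
  have "0 \<le> asum * (c + 2) + 1" using asum c by simp
  from exponential_decay[OF d1 hurwitz this r(1), where 'a = "real^'n^'n"]
  obtain \<delta> M \<kappa> where *: "\<delta> > 0" "M > 0" "\<kappa> > 0" "M * \<delta> < r"
    and decay: "\<And>(z :: nat \<Rightarrow> real \<Rightarrow> real^'n^'n) N t.
      (\<And>t k. t \<ge> 0 \<Longrightarrow> k < d \<Longrightarrow>
        (z k has_vector_derivative mult_var d a (\<lambda>k. z k t) k + N k t) (at t within {0..})) \<Longrightarrow>
      (\<And>t k. t \<ge> 0 \<Longrightarrow> k < d \<Longrightarrow> (\<Sum>k<d. norm (z k t)) < r \<Longrightarrow>
        norm (N k t) \<le> (asum * (c + 2) + 1) * (\<Sum>k<d. norm (z k t))\<^sup>2) \<Longrightarrow>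
      (\<Sum>k<d. norm (z k 0)) < \<delta> \<Longrightarrow> t \<ge> 0 \<Longrightarrow>
      (\<Sum>k<d. norm (z k t)) \<le> M * exp (- \<kappa> * t) * (\<Sum>k<d. norm (z k 0))" by blast
  show thesis
  proof (rule that[OF *(1-3)])
    fix z t
    assume "\<And>t k. t \<ge> 0 \<Longrightarrow> k < d \<Longrightarrow> (z k has_vector_derivative err_field d a (\<lambda>k. z k t) k) (at t within {0..})"
      and "size_of (\<lambda>k. z k 0) < \<delta>" "(t::real) \<ge> 0"
    then show "size_of (\<lambda>k. z k t) \<le> M * exp (- \<kappa> * t) * size_of (\<lambda>k. z k 0)"
      using r rho by (intro decay[where N = "\<lambda>k t. err_rest d a (\<lambda>k. z k t) k"] err_rest_quadratic)
        (auto simp: err_field_def)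
  next
    fix z0 assume z0: "size_of z0 < \<delta>"
    define clip where "clip x = closest_point (cball 0 r) x" for x :: "real^'n^'n"
    have clip_in: "norm (clip x) \<le> r" for x
      using closest_point_in_set[of "cball 0 r" x] r by (simp add: clip_def)
    have clip_rho: "norm (clip x) \<le> rho / 2" for x using clip_in[of x] r by simp
    have clip_id: "clip x = x" if "norm x \<le> r" for x
      using that by (simp add: clip_def closest_point_self)
    have clip_lip: "norm (clip x - clip y) \<le> norm (x - y)" for x y
      using closest_point_lipschitz[of "cball 0 r" x y] r by (simp add: clip_def dist_norm)
    define F where "F z k = mult_var d a z k + err_rest d a (\<lambda>k. clip (z k)) k" for z k
    obtain z where z: "\<And>k. k < d \<Longrightarrow> z k 0 = z0 k"
      "\<And>k t. k < d \<Longrightarrow> t \<ge> 0 \<Longrightarrow> (z k has_vector_derivative F (\<lambda>j. z j t) k) (at t within {0..})"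
    proof (rule lipschitz_ode_system[of "6 * asum + 3" d F z0])
      show "6 * asum + 3 \<ge> 0" using asum by simp
      fix x y k assume k: "k < d"
      have "norm (F x k - F y k) \<le> norm (mult_var d a x k - mult_var d a y k)
          + norm (err_rest d a (\<lambda>k. clip (x k)) k - err_rest d a (\<lambda>k. clip (y k)) k)"
        unfolding F_def by (rule order_trans[OF eq_refl norm_triangle_ineq]) (simp add: algebra_simps)
      also have "\<dots> \<le> (1 + asum) * (\<Sum>j<d. norm (x j - y j)) + (5 * asum + 2) * (\<Sum>j<d. norm (clip (x j) - clip (y j)))"
        by (intro add_mono mult_var_lipschitz err_rest_lipschitz k clip_rho)
      also have "\<dots> \<le> (1 + asum) * (\<Sum>j<d. norm (x j - y j)) + (5 * asum + 2) * (\<Sum>j<d. norm (x j - y j))"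
        using asum by (intro add_left_mono mult_left_mono sum_mono clip_lip) auto
      finally show "norm (F x k - F y k) \<le> (6 * asum + 3) * (\<Sum>j<d. norm (x j - y j))"
        by (simp add: algebra_simps)
    next
      show "F (\<lambda>_. 0) k = 0" if "k < d" for k
        using err_field_0[of k] r by (simp add: F_def err_field_def clip_id)
    qed (rule that)
    have rest_cong: "err_rest d a x k = err_rest d a y k" if "\<And>k. k < d \<Longrightarrow> x k = y k" for x y :: "nat \<Rightarrow> real^'n^'n" and k
      using that[of "d - 1"] that[of "d - 2"] d by (simp add: err_rest_def)
    have rest: "err_rest d a (\<lambda>k. clip (z k t)) k = err_rest d a (\<lambda>k. z k t) k" if "size_of (\<lambda>k. z k t) < r" for t k
    proof (rule rest_cong, rule clip_id)
      show "norm (z j t) \<le> r" if "j < d" for j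
        using norm_le_size[of j "\<lambda>k. z k t"] \<open>size_of (\<lambda>k. z k t) < r\<close> that by simp
    qed
    have "size_of (\<lambda>k. z k t) < r" if t: "t \<ge> 0" for t
    proof -
      have init: "size_of (\<lambda>k. z k 0) < \<delta>" using z0 z(1) by simp
      have "size_of (\<lambda>k. z k t) \<le> M * exp (- \<kappa> * t) * size_of (\<lambda>k. z k 0)"
      proof (rule decay[where z = z and N = "\<lambda>k t. err_rest d a (\<lambda>k. clip (z k t)) k", OF _ _ init t])
        show "(z k has_vector_derivative mult_var d a (\<lambda>k. z k t) k + err_rest d a (\<lambda>k. clip (z k t)) k) (at t within {0..})"
          if "t \<ge> 0" "k < d" for t k
          using z(2)[OF that(2,1)] by (simp add: F_def)
        show "norm (err_rest d a (\<lambda>k. clip (z k t)) k) \<le> (asum * (c + 2) + 1) * (size_of (\<lambda>k. z k t))\<^sup>2"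
          if "t \<ge> 0" "k < d" "size_of (\<lambda>k. z k t) < r" for t k
          unfolding rest[OF that(3)] using that r rho by (intro err_rest_quadratic) auto
      qed
      also have "\<dots> \<le> M * 1 * size_of (\<lambda>k. z k 0)"
        using * t by (intro mult_right_mono mult_left_mono sum_nonneg) auto
      also have "\<dots> \<le> M * \<delta>" using init * by simp
      finally show ?thesis using * by simp
    qed
    moreover from this have "(z k has_vector_derivative err_field d a (\<lambda>k. z k t) k) (at t within {0..})"
      if "t \<ge> 0" "k < d" for t k
      using z(2)[OF that(2,1)] rest[of t k] that by (simp add: F_def err_field_def)
    ultimately show "\<exists>z. (\<forall>k<d. z k 0 = z0 k) \<and> (\<forall>t\<ge>0. size_of (\<lambda>k. z k t) < r) \<and>
      (\<forall>t\<ge>0. \<forall>k<d. (z k has_vector_derivative err_field d a (\<lambda>k. z k t) k) (at t within {0..}))"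
      using z(1) by blast
  qed
qed

section \<open>Invariance of the group and its Lie algebra\<close>

text \<open>The group error moves by left and right multiplication; imitating both by exponentials stays in the group
  and is correct to first order.\<close>

lemma two_sided_step:
  fixes A B E :: "real^'n^'n"
  assumes A: "norm A \<le> \<alpha>" and B: "norm B \<le> \<alpha>" and E: "norm E \<le> e" and h: "0 \<le> h" "h \<le> 1" "h * \<alpha> \<le> rho"
  shows "norm (mexp (h *\<^sub>R A) ** E ** mexp (h *\<^sub>R B) - (E + h *\<^sub>R (A ** E + E ** B)))
    \<le> (2 * c * \<alpha>\<^sup>2 * e + (\<alpha> + c * \<alpha>\<^sup>2)\<^sup>2 * e) * h\<^sup>2"
proof -
  have \<alpha>: "\<alpha> \<ge> 0" and e: "e \<ge> 0" using A E norm_ge_zero order_trans by blast+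
  define P Q where "P = mexp (h *\<^sub>R A) - mat 1" and "Q = mexp (h *\<^sub>R B) - mat 1"
  define R T where "R = P - h *\<^sub>R A" and "T = Q - h *\<^sub>R B"
  have small: "norm (mexp (h *\<^sub>R Z) - mat 1 - h *\<^sub>R Z) \<le> c * \<alpha>\<^sup>2 * h\<^sup>2" if "norm Z \<le> \<alpha>" for Z :: "real^'n^'n"
  proof -
    have n: "norm (h *\<^sub>R Z) \<le> h * \<alpha>" using that h by (simp add: mult_left_mono)
    then have "norm (mexp (h *\<^sub>R Z) - mat 1 - h *\<^sub>R Z) \<le> c * norm (h *\<^sub>R Z) * norm (h *\<^sub>R Z)"
      using h by (intro mexp_minus_mat_1) simp
    also have "\<dots> \<le> c * (h * \<alpha>) * (h * \<alpha>)" using n c h \<alpha> by (intro mult_mono) auto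
    finally show ?thesis by (simp add: power2_eq_square mult_ac)
  qed
  have R: "norm R \<le> c * \<alpha>\<^sup>2 * h\<^sup>2" "norm T \<le> c * \<alpha>\<^sup>2 * h\<^sup>2"
    using small[OF A] small[OF B] by (auto simp: R_def T_def P_def Q_def)
  have h2: "h\<^sup>2 \<le> h" using h by (simp add: power2_eq_square mult_left_le)
  have lin: "norm (Z' + h *\<^sub>R Z) \<le> (\<alpha> + c * \<alpha>\<^sup>2) * h" if "norm Z \<le> \<alpha>" "norm Z' \<le> c * \<alpha>\<^sup>2 * h\<^sup>2" for Z Z' :: "real^'n^'n"
  proof -
    have "norm (Z' + h *\<^sub>R Z) \<le> norm Z' + h * norm Z" using norm_triangle_ineq[of Z' "h *\<^sub>R Z"] h by simp
    also have "\<dots> \<le> c * \<alpha>\<^sup>2 * h\<^sup>2 + h * \<alpha>" using that h by (intro add_mono mult_left_mono)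
    also have "c * \<alpha>\<^sup>2 * h\<^sup>2 \<le> c * \<alpha>\<^sup>2 * h" using h2 c by (intro mult_left_mono) auto
    finally show ?thesis by (simp add: algebra_simps)
  qed
  have P: "norm P \<le> (\<alpha> + c * \<alpha>\<^sup>2) * h" "norm Q \<le> (\<alpha> + c * \<alpha>\<^sup>2) * h"
    using lin[OF A R(1)] lin[OF B R(2)] by (auto simp: R_def T_def)
  have "mexp (h *\<^sub>R A) ** E ** mexp (h *\<^sub>R B) - (E + h *\<^sub>R (A ** E + E ** B)) = R ** E + E ** T + P ** E ** Q"
  proof -
    have "mexp (h *\<^sub>R A) = mat 1 + P" "mexp (h *\<^sub>R B) = mat 1 + Q" by (auto simp: P_def Q_def)
    then show ?thesis
      by (simp add: R_def T_def mm.add_left mm.add_right mm.diff_left mm.diff_right mm.scaleR_left mm.scaleR_right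
          scaleR_add_right)
  qed
  also have "norm \<dots> \<le> norm R * norm E + norm E * norm T + norm P * norm E * norm Q"
    by (intro norm_triangle_le add_mono norm_matrix_mult_le order_trans[OF norm_matrix_mult_le] mult_right_mono) auto
  also have "\<dots> \<le> (c * \<alpha>\<^sup>2 * h\<^sup>2) * e + e * (c * \<alpha>\<^sup>2 * h\<^sup>2) + ((\<alpha> + c * \<alpha>\<^sup>2) * h) * e * ((\<alpha> + c * \<alpha>\<^sup>2) * h)"
    using R P E e h \<alpha> c by (intro add_mono mult_mono) auto
  also have "\<dots> = (2 * c * \<alpha>\<^sup>2 * e + (\<alpha> + c * \<alpha>\<^sup>2)\<^sup>2 * e) * h\<^sup>2"
    by (simp add: power2_eq_square algebra_simps)
  finally show ?thesis .
qed

lemma in_G_if_infdist_0: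
  assumes "infdist E G = 0" "norm (E - mat 1) < rho" shows "E \<in> G"
proof -
  have "invertible E" using mexp_log[OF assms(2)] invertible_mexp(1) by metis
  moreover obtain T where T: "closed T" "G = {A. invertible A} \<inter> T"
    using lie_group by (auto simp: linear_lie_group_def closedin_closed)
  moreover have "E \<in> closure G" using assms(1) G_one by (subst in_closure_iff_infdist_zero) auto
  then have "E \<in> T" using T closure_minimal[of G T] by auto
  ultimately show ?thesis by simp
qed

lemma err_field_second_order:
  assumes der: "\<And>t k. t \<ge> 0 \<Longrightarrow> k < d \<Longrightarrow>
      (z k has_vector_derivative err_field d a (\<lambda>k. z k t) k) (at t within {0..})"
    and small: "\<And>t. t \<ge> 0 \<Longrightarrow> size_of (\<lambda>k. z k t) \<le> rho / 2"
    and t: "t \<ge> 0" and h: "h > 0" and k: "k < d"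
  shows "norm (z k (t + h) - (z k t + h *\<^sub>R err_field d a (\<lambda>k. z k t) k))
    \<le> (3 * (6 * asum + 3)\<^sup>2 * real d) * h\<^sup>2"
proof -
  define L where "L = 6 * asum + 3"
  have L: "L \<ge> 0" using asum by (simp add: L_def)
  have nz: "norm (z k s) \<le> rho / 2" if "s \<ge> 0" "k < d" for s k
    using norm_le_size[of k "\<lambda>k. z k s"] small[of s] that by simp
  have F: "norm (err_field d a (\<lambda>k. z k s) k) \<le> L" if "s \<ge> 0" "k < d" for s k
  proof -
    have "norm (err_field d a (\<lambda>k. z k s) k) \<le> L * size_of (\<lambda>k. z k s)"
      unfolding L_def using nz that by (intro err_field_bound) auto
    also have "\<dots> \<le> L * 1" using small[OF that(1)] rho L by (intro mult_left_mono) auto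
    finally show ?thesis by simp
  qed
  have der': "(z k has_vector_derivative err_field d a (\<lambda>k. z k s) k) (at s within {t..t+h'})"
    if "k < d" "s \<in> {t..t+h'}" for s h' k
  proof (rule has_vector_derivative_within_subset)
    show "(z k has_vector_derivative err_field d a (\<lambda>k. z k s) k) (at s within {0..})"
      using that t by (intro der) simp_all
  qed (use t in simp)
  have var: "norm (z k s - z k t) \<le> 3 * L * h" if s: "s \<in> {t..t+h}" and "k < d" for s k
  proof -
    have "norm (z k s - z k t - (s - t) *\<^sub>R err_field d a (\<lambda>k. z k t) k) \<le> norm (s - t) * (2 * L)"
    proof (rule vector_differentiable_bound_linearization[where S = "{t..t+h}"])
      fix x assume x: "x \<in> {t..t+h}"
      then show "(z k has_vector_derivative err_field d a (\<lambda>k. z k x) k) (at x within {t..t+h})"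
        using that by (intro der') auto
      show "norm (err_field d a (\<lambda>k. z k x) k - err_field d a (\<lambda>k. z k t) k) \<le> 2 * L"
        using F[of x k] F[of t k] x t that norm_triangle_ineq4[of "err_field d a (\<lambda>k. z k x) k" "err_field d a (\<lambda>k. z k t) k"]
        by simp
    qed (use s in \<open>auto simp: closed_segment_eq_real_ivl\<close>)
    moreover have "norm ((s - t) *\<^sub>R err_field d a (\<lambda>k. z k t) k) \<le> norm (s - t) * L"
      using F[OF t that(2)] by (simp add: mult_left_mono)
    moreover have "norm (z k s - z k t) \<le> norm (z k s - z k t - (s - t) *\<^sub>R err_field d a (\<lambda>k. z k t) k)
        + norm ((s - t) *\<^sub>R err_field d a (\<lambda>k. z k t) k)"
      by (metis diff_add_cancel norm_triangle_ineq)
    moreover have "norm (s - t) * (3 * L) \<le> h * (3 * L)" using s L by (intro mult_right_mono) auto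
    ultimately show ?thesis by (simp add: algebra_simps)
  qed
  have "norm (z k (t + h) - z k t - (t + h - t) *\<^sub>R err_field d a (\<lambda>k. z k t) k) \<le> norm (t + h - t) * (L * (real d * (3 * L * h)))"
  proof (rule vector_differentiable_bound_linearization[where S = "{t..t+h}"])
    fix x assume x: "x \<in> {t..t+h}"
    then show "(z k has_vector_derivative err_field d a (\<lambda>k. z k x) k) (at x within {t..t+h})"
      using k by (intro der') auto
    have "norm (err_field d a (\<lambda>k. z k x) k - err_field d a (\<lambda>k. z k t) k) \<le> L * (\<Sum>j<d. norm (z j x - z j t))"
      unfolding L_def using nz x t k by (intro err_field_lipschitz) auto
    also have "\<dots> \<le> L * (\<Sum>j<d. 3 * L * h)" using var[OF x] L by (intro mult_left_mono sum_mono) auto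
    finally show "norm (err_field d a (\<lambda>k. z k x) k - err_field d a (\<lambda>k. z k t) k) \<le> L * (real d * (3 * L * h))" by simp
  qed (use h in \<open>auto simp: closed_segment_eq_real_ivl\<close>)
  moreover have "norm (t + h - t) * (L * (real d * (3 * L * h))) = (3 * L\<^sup>2 * real d) * h\<^sup>2"
    using h by (simp add: power2_eq_square)
  ultimately have "norm (z k (t + h) - z k t - (t + h - t) *\<^sub>R err_field d a (\<lambda>k. z k t) k)
      \<le> (3 * L\<^sup>2 * real d) * h\<^sup>2" by (simp only:)
  then show ?thesis by (simp only: add_diff_cancel_left' diff_diff_eq L_def)
qed

text \<open>The distance \<open>D\<close> of the state from the set where the group error lies in the group and
  the other errors in the Lie algebra satisfies \<open>D (t + h) \<le> (1 + L h) D t + C h^2\<close>. Near every state of the set, one step of length \<open>h\<close>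
  along the field can be imitated inside the set up to \<open>O(h^2)\<close>, because the logarithm of the group error lies in the Lie algebra.\<close>

lemma invariance:
  assumes logG: "\<And>X. X \<in> G \<Longrightarrow> norm (X - mat 1) < \<delta> \<Longrightarrow> principal_log X \<in> lie_algebra G"
    and r: "r > 0" "6 * r \<le> rho" "3 * r < \<delta>"
    and der: "\<And>t k. t \<ge> 0 \<Longrightarrow> k < d \<Longrightarrow>
      (z k has_vector_derivative err_field d a (\<lambda>k. z k t) k) (at t within {0..})"
    and small: "\<And>t. t \<ge> 0 \<Longrightarrow> size_of (\<lambda>k. z k t) < r"
    and init: "mat 1 + z (d - 1) 0 \<in> G" "\<And>k. k < d - 1 \<Longrightarrow> z k 0 \<in> lie_algebra G"
    and t: "t \<ge> 0"
  shows "mat 1 + z (d - 1) t \<in> G \<and> (\<forall>k<d-1. z k t \<in> lie_algebra G)"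
proof -
  let ?g = "lie_algebra G"
  note sub = subspace_lie_algebra
  define dist_k where "dist_k k t = (if k = d - 1 then infdist (mat 1 + z k t) G else infdist (z k t) ?g)" for k t
  define D where "D t = (\<Sum>k<d. dist_k k t)" for t
  have dk0: "dist_k k t \<ge> 0" for k t by (simp add: dist_k_def infdist_nonneg)
  define L where "L = 6 * asum + 3"
  have L: "L \<ge> 0" using asum by (simp add: L_def)
  define C2 where "C2 = 3 * L\<^sup>2 * real d"
  define \<alpha> where "\<alpha> = 1 + asum"
  have \<alpha>: "\<alpha> \<ge> 1" using asum by (simp add: \<alpha>_def)
  define e where "e = norm (mat 1 :: real^'n^'n) + 1"
  define C1 where "C1 = 2 * c * \<alpha>\<^sup>2 * e + (\<alpha> + c * \<alpha>\<^sup>2)\<^sup>2 * e"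
  have C1: "C1 \<ge> 0" using c \<alpha> by (auto simp: C1_def e_def intro!: add_nonneg_nonneg mult_nonneg_nonneg)
  \<comment> \<open>keeps the nearby states within \<open>3 r\<close> and the exponents of the step within \<open>rho\<close>\<close>
  define h0 where "h0 = min (min 1 r) (rho / \<alpha>)"
  have h0: "h0 > 0" using r rho \<alpha> by (simp add: h0_def)
  define C where "C = real d * (C2 + 1 + L * real d + C1)"
  have "D t = 0"
  proof (rule discrete_gronwall_zero[OF h0, where D = D and t = t and L = "real d * L" and C = C])
    show "real d * L \<ge> 0" using L by simp
    show "C \<ge> 0" using L C1 by (simp add: C_def C2_def)
    show "D t \<ge> 0" for t :: real by (simp add: D_def sum_nonneg dk0)
    show "D 0 = 0" unfolding D_def using init by (intro sum.neutral) (auto simp: dist_k_def)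
    show "t \<ge> 0" by (rule t)
    fix t h :: real assume t: "t \<ge> 0" and h: "0 < h" "h \<le> h0"
    have h1: "h \<le> 1" "h \<le> r" "h * \<alpha> \<le> rho" using h(2) \<alpha> by (auto simp: h0_def pos_le_divide_eq)
    have h2: "h\<^sup>2 \<le> h" "h\<^sup>2 > 0" using h h1 by (auto simp: power2_eq_square mult_left_le)
    \<comment> \<open>a nearby state in the invariant set\<close>
    have "\<exists>w. (if k = d - 1 then mat 1 + w \<in> G else w \<in> ?g) \<and> norm (z k t - w) < dist_k k t + h\<^sup>2" for k
    proof (cases "k = d - 1")
      case True
      obtain E where E: "E \<in> G" "dist (mat 1 + z k t) E < infdist (mat 1 + z k t) G + h\<^sup>2"
        using infdist_approx[of G "h\<^sup>2"] G_one h2 by blast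
      then show ?thesis using True
        by (intro exI[of _ "E - mat 1"]) (simp add: dist_k_def dist_norm algebra_simps)
    next
      case False
      obtain w where "w \<in> ?g" "dist (z k t) w < infdist (z k t) ?g + h\<^sup>2"
        using infdist_approx[of ?g "h\<^sup>2"] subspace_0[OF sub] h2 by blast
      then show ?thesis using False by (intro exI[of _ w]) (simp add: dist_k_def dist_norm)
    qed
    then obtain w where w: "\<And>k. if k = d - 1 then mat 1 + w k \<in> G else w k \<in> ?g"
      "\<And>k. norm (z k t - w k) < dist_k k t + h\<^sup>2" by metis
    have wG: "mat 1 + w (d - 1) \<in> G" using w(1)[of "d - 1"] by simp
    have wg: "w k \<in> ?g" if "k < d - 1" for k using w(1)[of k] that by simp
    have zr: "norm (z k t) < r" if "k < d" for k
      using norm_le_size[of k "\<lambda>k. z k t"] small[OF t] that by simp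
    have wr: "norm (w k) < 3 * r" if "k < d" for k
    proof -
      have "dist_k k t \<le> norm (z k t)"
        using infdist_le[OF G_one, of "mat 1 + z k t"] infdist_le[OF subspace_0[OF sub], of "z k t"]
        by (auto simp: dist_k_def dist_norm)
      then have "norm (z k t - w k) < 2 * r" using w(2)[of k] zr[OF that] h1 h2 by linarith
      then show ?thesis using zr[OF that] norm_triangle_ineq4[of "z k t" "z k t - w k"] by simp
    qed
    define l where "l = principal_log (mat 1 + w (d - 1))"
    have wd: "norm (w (d - 1)) < 3 * r" using wr d by simp
    have l: "l \<in> ?g" unfolding l_def using wd r by (intro logG wG) simp
    have ln: "norm l \<le> 1" using log_bound[of "mat 1 + w (d - 1)"] wd r rho unfolding l_def by simp
    define V where "V k = (if k = d - 1 then mexp (h *\<^sub>R w (d - 2)) ** (mat 1 + w (d - 1)) ** mexp (h *\<^sub>R (- a (d - 1) *\<^sub>R l)) - mat 1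
      else w k + h *\<^sub>R err_field d a w k)" for k
    have V_in: "if k = d - 1 then mat 1 + V k \<in> G else V k \<in> ?g" if "k < d" for k
    proof (cases "k = d - 1")
      case True
      have "w (d - 2) \<in> ?g" using d by (intro wg) simp
      moreover have "- a (d - 1) *\<^sub>R l \<in> ?g" by (rule subspace_scale[OF sub l])
      ultimately have "mexp (h *\<^sub>R w (d - 2)) ** (mat 1 + w (d - 1)) ** mexp (h *\<^sub>R (- a (d - 1) *\<^sub>R l)) \<in> G"
        by (intro G_mult mexp_in_G wG)
      then show ?thesis using True by (simp add: V_def)
    next
      case False
      then have "k < d - 1" using that by simp
      then show ?thesis using False wg l[unfolded l_def]
        by (auto simp: V_def err_field_lower intro!: subspace_add[OF sub] subspace_scale[OF sub]
            subspace_diff[OF sub] subspace_0[OF sub])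
    qed
    have V_step: "norm (V k - (w k + h *\<^sub>R err_field d a w k)) \<le> C1 * h\<^sup>2" if "k < d" for k
    proof (cases "k = d - 1")
      case True
      have 1: "norm (w (d - 2)) \<le> \<alpha>" using wr[of "d - 2"] d r rho \<alpha> by simp
      have "\<bar>a (d - 1)\<bar> * norm l \<le> asum * 1" using asum d ln by (intro mult_mono) auto
      then have 2: "norm (- a (d - 1) *\<^sub>R l) \<le> \<alpha>" by (simp add: \<alpha>_def)
      have 3: "norm (mat 1 + w (d - 1)) \<le> e"
        using norm_triangle_ineq[of "mat 1" "w (d - 1)"] wd r rho by (simp add: e_def)
      have "V k - (w k + h *\<^sub>R err_field d a w k) =
          mexp (h *\<^sub>R w (d - 2)) ** (mat 1 + w (d - 1)) ** mexp (h *\<^sub>R (- a (d - 1) *\<^sub>R l))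
          - (mat 1 + w (d - 1) + h *\<^sub>R (w (d - 2) ** (mat 1 + w (d - 1)) + (mat 1 + w (d - 1)) ** (- a (d - 1) *\<^sub>R l)))"
        unfolding V_def True err_field_top[OF d] l_def[symmetric] mm.scaleR_right by (simp add: algebra_simps)
      then show ?thesis unfolding C1_def using two_sided_step[OF 1 2 3 _ h1(1,3)] h by simp
    next
      case False then show ?thesis using C1 by (simp add: V_def)
    qed
    have wz: "(\<Sum>j<d. norm (z j t - w j)) \<le> D t + real d * h\<^sup>2"
    proof -
      have "(\<Sum>j<d. norm (z j t - w j)) \<le> (\<Sum>j<d. dist_k j t + h\<^sup>2)" using w(2) by (intro sum_mono less_imp_le)
      then show ?thesis by (simp add: D_def sum.distrib)
    qed
    have step: "dist_k k (t + h) \<le> dist_k k t + (C2 + 1 + L * real d + C1) * h\<^sup>2 + h * L * D t" if k: "k < d" for k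
    proof -
      have "dist_k k (t + h) \<le> norm (z k (t + h) - V k)"
        using V_in[OF k] infdist_le[of "mat 1 + V k" G "mat 1 + z k (t + h)"] infdist_le[of "V k" ?g "z k (t + h)"]
        by (auto simp: dist_k_def dist_norm split: if_splits)
      also have "z k (t + h) - V k = (z k (t + h) - (z k t + h *\<^sub>R err_field d a (\<lambda>k. z k t) k)) + (z k t - w k)
          + h *\<^sub>R (err_field d a (\<lambda>k. z k t) k - err_field d a w k) - (V k - (w k + h *\<^sub>R err_field d a w k))"
        by (simp add: algebra_simps)
      also have "norm \<dots> \<le> norm (z k (t + h) - (z k t + h *\<^sub>R err_field d a (\<lambda>k. z k t) k)) + norm (z k t - w k)
          + norm (h *\<^sub>R (err_field d a (\<lambda>k. z k t) k - err_field d a w k)) + norm (V k - (w k + h *\<^sub>R err_field d a w k))"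
        by (intro order_trans[OF norm_triangle_ineq4] norm_triangle_le add_mono order_refl norm_triangle_ineq)
      also have "\<dots> \<le> C2 * h\<^sup>2 + (dist_k k t + h\<^sup>2) + h * (L * (D t + real d * h\<^sup>2)) + C1 * h\<^sup>2"
      proof (intro add_mono V_step k)
        have "size_of (\<lambda>k. z k s) \<le> rho / 2" if "s \<ge> 0" for s using small[OF that] r by simp
        then show "norm (z k (t + h) - (z k t + h *\<^sub>R err_field d a (\<lambda>k. z k t) k)) \<le> C2 * h\<^sup>2"
          unfolding C2_def L_def by (intro err_field_second_order der t h k)
        show "norm (z k t - w k) \<le> dist_k k t + h\<^sup>2" using w(2)[of k] by simp
        have "norm (err_field d a (\<lambda>k. z k t) k - err_field d a w k) \<le> L * (\<Sum>j<d. norm (z j t - w j))"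
          unfolding L_def
        proof (intro err_field_lipschitz k)
          show "norm (z k t) \<le> rho / 2" "norm (w k) \<le> rho / 2" if "k < d" for k
            using zr[OF that] wr[OF that] r by auto
        qed
        also have "\<dots> \<le> L * (D t + real d * h\<^sup>2)" using L by (intro mult_left_mono wz)
        finally show "norm (h *\<^sub>R (err_field d a (\<lambda>k. z k t) k - err_field d a w k)) \<le> h * (L * (D t + real d * h\<^sup>2))"
          using h by (simp add: mult_left_mono)
      qed
      also have "h * (L * (D t + real d * h\<^sup>2)) \<le> h * L * D t + 1 * (L * real d * h\<^sup>2)"
      proof -
        have "h * (L * real d * h\<^sup>2) \<le> 1 * (L * real d * h\<^sup>2)" using h1 L by (intro mult_right_mono) auto
        then show ?thesis by (simp add: algebra_simps)
      qed
      finally show ?thesis by (simp add: algebra_simps)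
    qed
    have "D (t + h) \<le> (\<Sum>k<d. dist_k k t + (C2 + 1 + L * real d + C1) * h\<^sup>2 + h * L * D t)"
      unfolding D_def[of "t + h"] using step by (intro sum_mono) auto
    also have "\<dots> = D t + real d * ((C2 + 1 + L * real d + C1) * h\<^sup>2 + h * L * D t)"
      by (simp add: sum.distrib D_def[of t, symmetric] algebra_simps)
    also have "\<dots> = (1 + real d * L * h) * D t + C * h\<^sup>2" by (simp add: C_def algebra_simps)
    finally show "D (t + h) \<le> (1 + real d * L * h) * D t + C * h\<^sup>2" .
  qed
  then have z: "dist_k k t = 0" if "k < d" for k
    using dk0 that unfolding D_def by (subst (asm) sum_nonneg_eq_0_iff) auto
  have "norm (mat 1 + z (d - 1) t - mat 1) < rho"
    using norm_le_size[of "d - 1" "\<lambda>k. z k t"] small[OF t] r d by simp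
  then have "mat 1 + z (d - 1) t \<in> G"
    using z[of "d - 1"] d by (intro in_G_if_infdist_0) (auto simp: dist_k_def)
  moreover have "z k t \<in> ?g" if "k < d - 1" for k
  proof -
    have "infdist (z k t) ?g = 0" using z[of k] that by (simp add: dist_k_def)
    then show ?thesis
      using in_closure_iff_infdist_zero[of ?g "z k t"] subspace_0[OF sub] closure_closed[OF closed_subspace[OF sub]] by auto
  qed
  ultimately show ?thesis by blast
qed

end

section \<open>From the error system to the observer\<close>

text \<open>The identity \<open>Y s - Y t = - Y s (X s - X t) Y t\<close> for the inverse \<open>Y\<close> of \<open>X\<close> bounds \<open>Y s\<close> near \<open>t\<close>, so it gives
  first continuity and then the derivative.\<close>

lemma has_vector_derivative_matrix_inv:
  fixes X :: "real \<Rightarrow> real^'n::finite^'n"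
  assumes X: "(X has_vector_derivative X') (at t within S)" and t: "t \<in> S" and inv: "\<And>s. s \<in> S \<Longrightarrow> invertible (X s)"
  shows "((\<lambda>s. matrix_inv (X s)) has_vector_derivative - (matrix_inv (X t) ** X' ** matrix_inv (X t))) (at t within S)"
proof -
  define Y where "Y s = matrix_inv (X s)" for s
  have Y: "Y s ** X s = mat 1" "X s ** Y s = mat 1" if "s \<in> S" for s
    using invertible_inverse[OF inv[OF that]] by (auto simp: Y_def)
  have diff: "Y s - Y t = - (Y s ** (X s - X t) ** Y t)" if "s \<in> S" for s
  proof -
    have "Y s ** (X s - X t) ** Y t = (Y s ** X s) ** Y t - Y s ** (X t ** Y t)"
      by (simp add: mm.diff_left mm.diff_right matrix_mul_assoc)
    then show ?thesis using Y that t by simp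
  qed
  let ?F = "at t within S"
  have inS: "eventually (\<lambda>s. s \<in> S) ?F" by (simp add: eventually_at_filter)
  have lX: "(X \<longlongrightarrow> X t) ?F"
    using has_vector_derivative_continuous[OF X] by (simp add: continuous_within)
  then have X0: "((\<lambda>s. norm (X s - X t)) \<longlongrightarrow> 0) ?F" by (simp add: LIM_zero tendsto_norm_zero)
  then have "((\<lambda>s. norm (X s - X t) * norm (Y t)) \<longlongrightarrow> 0) ?F" by (rule tendsto_mult_left_zero)
  then have ev: "eventually (\<lambda>s. norm (X s - X t) * norm (Y t) < 1/2) ?F" by (rule order_tendstoD(2)) simp
  have "((\<lambda>s. Y s - Y t) \<longlongrightarrow> 0) ?F"
  proof (rule Lim_null_comparison)
    show "((\<lambda>s. 2 * norm (Y t) * norm (Y t) * norm (X s - X t)) \<longlongrightarrow> 0) ?F" by (rule tendsto_mult_right_zero[OF X0])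
    show "eventually (\<lambda>s. norm (Y s - Y t) \<le> 2 * norm (Y t) * norm (Y t) * norm (X s - X t)) ?F"
      using ev inS
    proof eventually_elim
      case (elim s)
      have le: "norm (Y s - Y t) \<le> norm (Y s) * (norm (X s - X t) * norm (Y t))"
      proof -
        have "norm (Y s ** (X s - X t) ** Y t) \<le> norm (Y s ** (X s - X t)) * norm (Y t)" by (rule norm_matrix_mult_le)
        also have "\<dots> \<le> (norm (Y s) * norm (X s - X t)) * norm (Y t)"
          by (intro mult_right_mono norm_matrix_mult_le) auto
        finally show ?thesis by (simp add: diff[OF elim(2)] mult.assoc)
      qed
      also have "\<dots> \<le> norm (Y s) * (1/2)" using elim by (intro mult_left_mono) auto
      finally have "norm (Y s) \<le> 2 * norm (Y t)"
        using norm_triangle_sub[of "Y s" "Y t"] by simp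
      then have "norm (Y s) * (norm (X s - X t) * norm (Y t)) \<le> (2 * norm (Y t)) * (norm (X s - X t) * norm (Y t))"
        by (intro mult_right_mono) auto
      with le show ?case by (simp add: mult_ac)
    qed
  qed
  then have lY: "(Y \<longlongrightarrow> Y t) ?F" by (rule LIM_zero_cancel)
  define q where "q s = (1 / norm (s - t)) *\<^sub>R (X s - (X t + (s - t) *\<^sub>R X'))" for s
  have q: "(q \<longlongrightarrow> 0) ?F"
    using X unfolding has_vector_derivative_def has_derivative_within q_def by auto
  have "((\<lambda>s. (1 / norm (s - t)) *\<^sub>R (Y s - (Y t + (s - t) *\<^sub>R - (Y t ** X' ** Y t)))) \<longlongrightarrow> 0) ?F"
  proof (rule Lim_null_comparison)
    have "((\<lambda>s. norm (Y s ** q s ** Y t) + norm ((Y t - Y s) ** X' ** Y t))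
        \<longlongrightarrow> norm (Y t ** 0 ** Y t) + norm ((Y t - Y t) ** X' ** Y t)) ?F"
      by (intro tendsto_add tendsto_norm mm.tendsto tendsto_diff tendsto_const lY q)
    then show "((\<lambda>s. norm (Y s ** q s ** Y t) + norm ((Y t - Y s) ** X' ** Y t)) \<longlongrightarrow> 0) ?F"
      by (simp add: mm.zero_left mm.zero_right)
    have ne: "eventually (\<lambda>s. s \<noteq> t) ?F" by (simp add: eventually_at_filter)
    show "eventually (\<lambda>s. norm ((1 / norm (s - t)) *\<^sub>R (Y s - (Y t + (s - t) *\<^sub>R - (Y t ** X' ** Y t))))
        \<le> norm (Y s ** q s ** Y t) + norm ((Y t - Y s) ** X' ** Y t)) ?F"
      using ne inS
    proof eventually_elim
      case (elim s)
      have "(1 / norm (s - t)) *\<^sub>R (Y s - (Y t + (s - t) *\<^sub>R - (Y t ** X' ** Y t)))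
          = (1 / norm (s - t)) *\<^sub>R ((Y s - Y t) + (s - t) *\<^sub>R (Y t ** X' ** Y t))"
        by (simp add: algebra_simps)
      also have "\<dots> = - (Y s ** q s ** Y t) + ((s - t) / norm (s - t)) *\<^sub>R ((Y t - Y s) ** X' ** Y t)"
        unfolding diff[OF elim(2)] q_def
        by (simp add: mm.diff_left mm.diff_right mm.add_left mm.add_right mm.scaleR_left mm.scaleR_right
            scaleR_diff_right scaleR_add_right)
      also have "norm \<dots> \<le> norm (Y s ** q s ** Y t) + norm (((s - t) / norm (s - t)) *\<^sub>R ((Y t - Y s) ** X' ** Y t))"
        using norm_triangle_ineq[of "- (Y s ** q s ** Y t)" "((s - t) / norm (s - t)) *\<^sub>R ((Y t - Y s) ** X' ** Y t)"]
        by (simp only: norm_minus_cancel)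
      also have "norm (((s - t) / norm (s - t)) *\<^sub>R ((Y t - Y s) ** X' ** Y t)) = norm ((Y t - Y s) ** X' ** Y t)"
        using elim(1) by simp
      finally show ?case .
    qed
  qed
  then have "(Y has_vector_derivative - (Y t ** X' ** Y t)) ?F"
    unfolding has_vector_derivative_def has_derivative_within
    by (rule conjI[OF bounded_linear_scaleR_left])
  then show ?thesis unfolding Y_def[abs_def] .
qed

definition err_coord :: "nat \<Rightarrow> real^'n::finite^'n \<Rightarrow> (nat \<Rightarrow> real^'n^'n) \<Rightarrow> nat \<Rightarrow> real^'n^'n" where
  "err_coord d E e k = (if k = d - 1 then E - mat 1 else - e (d - k))"

lemma sum_err_coord:
  assumes "d \<ge> 2" and f: "\<And>A. f (- A) = f A"
  shows "(\<Sum>k<d. f (err_coord d E e k)) = f (E - mat 1) + (\<Sum>i=2..d. f (e i) :: real)"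
proof -
  have "{..<d} = insert (d - 1) {..<d - 1}" using assms(1) by auto
  then have "(\<Sum>k<d. f (err_coord d E e k)) = f (E - mat 1) + (\<Sum>k<d - 1. f (err_coord d E e k))"
    by (simp add: err_coord_def)
  also have "(\<Sum>k<d - 1. f (err_coord d E e k)) = (\<Sum>k<d - 1. f (e (d - k)))"
    by (intro sum.cong) (auto simp: err_coord_def f)
  also have "\<dots> = (\<Sum>i=2..d. f (e i))"
    by (rule sum.reindex_bij_witness[of _ "\<lambda>i. d - i" "\<lambda>k. d - k"]) (use assms(1) in auto)
  finally show ?thesis .
qed

lemma opnorm_minus: "opnorm (- A) = opnorm A" for A :: "real^'n::finite^'n"
  using norm_minus_cancel[of "Sqmat A"] by (simp add: uminus_sqmat.abs_eq norm_sqmat.abs_eq)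

abbreviation observer_from where
  "observer_from G d a u X Xh0 xh0 Xh xh \<equiv>
    observer_solution G d a u X Xh xh \<and> Xh 0 = Xh0 \<and> (\<forall>i\<in>{2..d}. xh i 0 = xh0 i)"

context observer_error
begin

lemma equilibrium_distance_bounds:
  "equilibrium_distance d E e \<le> size_of (err_coord d E e)"
  "size_of (err_coord d E e) \<le> (real CARD('n))\<^sup>2 * equilibrium_distance d E e"
proof -
  have eq: "equilibrium_distance d E e = (\<Sum>k<d. opnorm (err_coord d E e k))"
    unfolding equilibrium_distance_def by (rule sum_err_coord[OF d, symmetric]) (rule opnorm_minus)
  show "equilibrium_distance d E e \<le> size_of (err_coord d E e)"
    unfolding eq by (intro sum_mono opnorm_le_norm)
  show "size_of (err_coord d E e) \<le> (real CARD('n))\<^sup>2 * equilibrium_distance d E e"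
    unfolding eq sum_distrib_left by (intro sum_mono norm_le_opnorm)
qed

text \<open>The derivative of \<open>X\<^sup>-\<^sup>1\<close> cancels the outer factors of the observer equation, and the input cancels in the last
  equation; only the errors remain.\<close>

lemma observer_solution_error:
  assumes sys: "system_solution G d u X x" and obs: "observer_solution G d a u X Xh xh" and t: "t \<ge> 0" and k: "k < d"
  defines "z \<equiv> \<lambda>k t. err_coord d (group_error (X t) (Xh t)) (\<lambda>i. x i t - xh i t) k"
  shows "(z k has_vector_derivative err_field d a (\<lambda>k. z k t) k) (at t within {0..})"
proof -
  define E where "E t = group_error (X t) (Xh t)" for t
  have z_top: "z (d - 1) t = E t - mat 1" for t by (simp add: z_def err_coord_def E_def)
  have z_low: "z k t = - (x (d - k) t - xh (d - k) t)" if "k < d - 1" for k t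
    using that by (simp add: z_def err_coord_def)
  define l where "l = principal_log (E t)"
  have El: "principal_log (mat 1 + z (d - 1) t) = l" unfolding z_top l_def by simp
  have lobs: "principal_log (matrix_inv (X t) ** Xh t) = l" by (simp add: l_def E_def group_error_def)
  note sysD = sys[unfolded system_solution_def, rule_format, OF t]
  note obsD = obs[unfolded observer_solution_def, rule_format, OF t, unfolded lobs]
  show ?thesis
  proof (cases "k = d - 1")
    case True
    have inv: "invertible (X s)" if "s \<in> {0..}" for s
      using sys that by (intro G_invertible) (auto simp: system_solution_def)
    have XY: "matrix_inv (X t) ** X t = mat 1" using invertible_inverse[OF inv[of t]] t by simp
    have dY: "((\<lambda>s. matrix_inv (X s)) has_vector_derivative - (matrix_inv (X t) ** (X t ** x 2 t) ** matrix_inv (X t))) (at t within {0..})"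
      using sysD t by (intro has_vector_derivative_matrix_inv inv) auto
    have dXh: "(Xh has_vector_derivative (X t ** xh 2 t ** matrix_inv (X t) ** Xh t - a (d - 1) *\<^sub>R (Xh t ** l))) (at t within {0..})"
      using obsD by blast
    have "(E has_vector_derivative matrix_inv (X t) ** (X t ** xh 2 t ** matrix_inv (X t) ** Xh t - a (d - 1) *\<^sub>R (Xh t ** l))
        + - (matrix_inv (X t) ** (X t ** x 2 t) ** matrix_inv (X t)) ** Xh t) (at t within {0..})"
      unfolding E_def[abs_def] group_error_def by (rule mm.has_vector_derivative[OF dY dXh])
    also have "matrix_inv (X t) ** (X t ** xh 2 t ** matrix_inv (X t) ** Xh t - a (d - 1) *\<^sub>R (Xh t ** l))
        + - (matrix_inv (X t) ** (X t ** x 2 t) ** matrix_inv (X t)) ** Xh t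
        = (xh 2 t - x 2 t) ** E t - a (d - 1) *\<^sub>R (E t ** l)"
      by (simp add: mm.diff_right mm.diff_left mm.scaleR_right mm.minus_left matrix_mul_assoc XY E_def group_error_def)
    also have "\<dots> = err_field d a (\<lambda>k. z k t) (d - 1)"
    proof -
      have "z (d - 2) t = xh 2 t - x 2 t" using z_low[of "d - 2" t] d by simp
      then show ?thesis unfolding err_field_top[OF d] El unfolding z_top by simp
    qed
    finally have "((\<lambda>t. E t - mat 1) has_vector_derivative err_field d a (\<lambda>k. z k t) (d - 1) - 0) (at t within {0..})"
      by (intro has_vector_derivative_diff has_vector_derivative_const)
    moreover have "z (d - 1) = (\<lambda>t. E t - mat 1)" by (rule ext) (rule z_top)
    ultimately show ?thesis unfolding True by (simp only: diff_0_right)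
  next
    case False
    then have k1: "k < d - 1" using k by simp
    have zk: "z k = (\<lambda>t. xh (d - k) t - x (d - k) t)" using z_low[OF k1] by auto
    show ?thesis
    proof (cases "k = 0")
      case True
      have "(z k has_vector_derivative (u t - a 0 *\<^sub>R l) - u t) (at t within {0..})"
        unfolding zk using sysD obsD True by (intro has_vector_derivative_diff) auto
      then show ?thesis unfolding err_field_lower[OF k1] El using True by simp
    next
      case False
      then have i: "d - k \<in> {2..<d}" "d - (d - k) = k" "d - (k - 1) = d - k + 1" "k - 1 < d - 1" using k1 by auto
      have "(xh (d - k) has_vector_derivative (xh (d - k + 1) t - a k *\<^sub>R l)) (at t within {0..})"
        using obsD i(1,2) by metis
      moreover have "(x (d - k) has_vector_derivative x (d - k + 1) t) (at t within {0..})"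
        using sysD i(1) by blast
      ultimately have "(z k has_vector_derivative (xh (d - k + 1) t - a k *\<^sub>R l) - x (d - k + 1) t) (at t within {0..})"
        unfolding zk by (rule has_vector_derivative_diff)
      moreover have "z (k - 1) t = xh (d - k + 1) t - x (d - k + 1) t" using z_low[OF i(4), of t] unfolding i(3) by simp
      then have "(xh (d - k + 1) t - a k *\<^sub>R l) - x (d - k + 1) t = z (k - 1) t - a k *\<^sub>R l" by simp
      ultimately show ?thesis unfolding err_field_lower[OF k1] El using False by (simp only: if_False)
    qed
  qed
qed

lemma observer_of_error:
  assumes sys: "system_solution G d u X x"
    and der: "\<And>t k. t \<ge> 0 \<Longrightarrow> k < d \<Longrightarrow>
      (z k has_vector_derivative err_field d a (\<lambda>k. z k t) k) (at t within {0..})"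
    and small: "\<And>t. t \<ge> 0 \<Longrightarrow> size_of (\<lambda>k. z k t) < rho"
    and inG: "\<And>t. t \<ge> 0 \<Longrightarrow> mat 1 + z (d - 1) t \<in> G"
    and ing: "\<And>t k. t \<ge> 0 \<Longrightarrow> k < d - 1 \<Longrightarrow> z k t \<in> lie_algebra G"
  shows "observer_solution G d a u X (\<lambda>t. X t ** (mat 1 + z (d - 1) t)) (\<lambda>i t. x i t + z (d - i) t)"
  unfolding observer_solution_def
proof (intro allI impI)
  fix t :: real assume t: "t \<ge> 0"
  define E where "E t = mat 1 + z (d - 1) t" for t
  define l where "l = principal_log (E t)"
  note sysD = sys[unfolded system_solution_def, rule_format, OF t]
  have XG: "X t \<in> G" using sysD by blast
  have XY: "matrix_inv (X t) ** X t = mat 1" using invertible_inverse[OF G_invertible[OF XG]] by simp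
  have XE: "matrix_inv (X t) ** (X t ** E t) = E t" by (simp add: matrix_mul_assoc XY)
  have EG: "E t \<in> G" using inG[OF t] by (simp only: E_def)
  have sub: "x i t + z (d - i) t \<in> lie_algebra G" if "i \<in> {2..d}" for i
    using sysD ing[OF t, of "d - i"] that by (intro subspace_add[OF subspace_lie_algebra]) auto
  have dom: "E t \<in> log_domain"
  proof (rule log_domain)
    have "norm (z (d - 1) t) < rho" using norm_le_size[of "d - 1" "\<lambda>k. z k t"] small[OF t] d by simp
    then show "norm (E t - mat 1) < rho" by (simp add: E_def)
  qed
  have dE: "(E has_vector_derivative z (d - 2) t ** E t - a (d - 1) *\<^sub>R (E t ** l)) (at t within {0..})"
  proof -
    have "(E has_vector_derivative 0 + err_field d a (\<lambda>k. z k t) (d - 1)) (at t within {0..})"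
      unfolding E_def[abs_def] using t d by (intro has_vector_derivative_add has_vector_derivative_const der) auto
    then show ?thesis unfolding err_field_top[OF d] by (simp add: E_def l_def)
  qed
  have "((\<lambda>t. X t ** E t) has_vector_derivative X t ** (z (d - 2) t ** E t - a (d - 1) *\<^sub>R (E t ** l)) + (X t ** x 2 t) ** E t) (at t within {0..})"
    using sysD by (intro mm.has_vector_derivative dE) auto
  moreover have "X t ** (z (d - 2) t ** E t - a (d - 1) *\<^sub>R (E t ** l)) + (X t ** x 2 t) ** E t
      = X t ** (x 2 t + z (d - 2) t) ** matrix_inv (X t) ** (X t ** E t) - a (d - 1) *\<^sub>R (X t ** E t ** l)"
  proof -
    have "X t ** (x 2 t + z (d - 2) t) ** matrix_inv (X t) ** (X t ** E t) = X t ** (x 2 t + z (d - 2) t) ** E t"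
      by (simp add: matrix_mul_assoc[symmetric] XE)
    then show ?thesis
      by (simp add: mm.diff_right mm.add_left mm.add_right mm.scaleR_right matrix_mul_assoc)
  qed
  ultimately have dXh: "((\<lambda>t. X t ** E t) has_vector_derivative
      X t ** (x 2 t + z (d - 2) t) ** matrix_inv (X t) ** (X t ** E t) - a (d - 1) *\<^sub>R (X t ** E t ** l)) (at t within {0..})" by simp
  have dxi: "((\<lambda>t. x i t + z (d - i) t) has_vector_derivative x (i + 1) t + z (d - (i + 1)) t - a (d - i) *\<^sub>R l) (at t within {0..})"
    if i: "i \<in> {2..<d}" for i
  proof -
    have k: "d - i < d - 1" "d - i \<noteq> 0" "d - i < d" "d - i - 1 = d - (i + 1)" using i by auto
    have "((\<lambda>t. x i t + z (d - i) t) has_vector_derivative x (i + 1) t + err_field d a (\<lambda>k. z k t) (d - i)) (at t within {0..})"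
      using sysD i t k by (intro has_vector_derivative_add der) auto
    then show ?thesis unfolding err_field_lower[OF k(1)] using k by (simp add: E_def l_def algebra_simps)
  qed
  have dxd: "((\<lambda>t. x d t + z (d - d) t) has_vector_derivative u t - a 0 *\<^sub>R l) (at t within {0..})"
  proof -
    have k: "d - d < d - 1" using d by simp
    have "((\<lambda>t. x d t + z (d - d) t) has_vector_derivative u t + err_field d a (\<lambda>k. z k t) (d - d)) (at t within {0..})"
      using sysD t d by (intro has_vector_derivative_add der) auto
    then show ?thesis unfolding err_field_lower[OF k] by (simp add: E_def l_def)
  qed
  show "X t ** (mat 1 + z (d - 1) t) \<in> G \<and> (\<forall>i\<in>{2..d}. x i t + z (d - i) t \<in> lie_algebra G) \<and>
    matrix_inv (X t) ** (X t ** (mat 1 + z (d - 1) t)) \<in> log_domain \<and>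
    ((\<lambda>t. X t ** (mat 1 + z (d - 1) t)) has_vector_derivative
      (X t ** (x 2 t + z (d - 2) t) ** matrix_inv (X t) ** (X t ** (mat 1 + z (d - 1) t))
        - a (d - 1) *\<^sub>R (X t ** (mat 1 + z (d - 1) t) ** principal_log (matrix_inv (X t) ** (X t ** (mat 1 + z (d - 1) t))))))
      (at t within {0..}) \<and>
    (\<forall>i\<in>{2..<d}. ((\<lambda>t. x i t + z (d - i) t) has_vector_derivative
      (x (i + 1) t + z (d - (i + 1)) t - a (d - i) *\<^sub>R principal_log (matrix_inv (X t) ** (X t ** (mat 1 + z (d - 1) t)))))
      (at t within {0..})) \<and>
    ((\<lambda>t. x d t + z (d - d) t) has_vector_derivative
      (u t - a 0 *\<^sub>R principal_log (matrix_inv (X t) ** (X t ** (mat 1 + z (d - 1) t))))) (at t within {0..})"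
    unfolding E_def[symmetric] XE l_def[symmetric]
    by (intro conjI ballI G_mult XG EG sub dom dXh dxi dxd)
qed

text \<open>The constants come from the error system, so they serve all inputs and all observed trajectories at once.\<close>

lemma observer_stability:
  "\<exists>\<delta>>0. \<exists>M>0. \<exists>\<kappa>>0. \<forall>u X x Xh0 xh0.
    system_solution G d u X x \<and> Xh0 \<in> G \<and> (\<forall>i\<in>{2..d}. xh0 i \<in> lie_algebra G) \<and>
    equilibrium_distance d (group_error (X 0) Xh0) (\<lambda>i. x i 0 - xh0 i) < \<delta> \<longrightarrow>
    (\<exists>Xh xh. observer_from G d a u X Xh0 xh0 Xh xh) \<and>
    (\<forall>Xh xh. observer_from G d a u X Xh0 xh0 Xh xh \<longrightarrow>
      (\<forall>t\<ge>0. equilibrium_distance d (group_error (X t) (Xh t)) (\<lambda>i. x i t - xh i t)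
        \<le> M * exp (- \<kappa> * t) * equilibrium_distance d (group_error (X 0) Xh0) (\<lambda>i. x i 0 - xh0 i)))"
proof -
  define N where "N = (real CARD('n))\<^sup>2"
  have N: "N > 0" by (simp add: N_def)
  obtain \<delta>0 where \<delta>0: "\<delta>0 > 0" "\<And>X. X \<in> G \<Longrightarrow> norm (X - mat 1) < \<delta>0 \<Longrightarrow> principal_log X \<in> lie_algebra G"
    using log_in_lie_algebra by blast
  \<comment> \<open>invariance uses states up to \<open>3 r\<close>, where the field is Lipschitz and logarithms lie in the Lie algebra\<close>
  define r where "r = min (rho / 6) (\<delta>0 / 4)"
  have r: "0 < r" "6 * r \<le> rho" "3 * r < \<delta>0" "r \<le> rho / 2" using rho \<delta>0(1) by (auto simp: r_def)
  show ?thesis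
  proof (rule error_dynamics[OF r(1,4)])
    fix \<delta> M \<kappa> :: real
    assume pos: "\<delta> > 0" "M > 0" "\<kappa> > 0"
      and decay: "\<And>z t. (\<And>t k. t \<ge> 0 \<Longrightarrow> k < d \<Longrightarrow>
        (z k has_vector_derivative err_field d a (\<lambda>k. z k t) k) (at t within {0..})) \<Longrightarrow>
      size_of (\<lambda>k. z k 0) < \<delta> \<Longrightarrow> t \<ge> 0 \<Longrightarrow>
      size_of (\<lambda>k. z k t) \<le> M * exp (- \<kappa> * t) * size_of (\<lambda>k. z k 0)"
      and ex: "\<And>z0. size_of z0 < \<delta> \<Longrightarrow> \<exists>z. (\<forall>k<d. z k 0 = z0 k) \<and> (\<forall>t\<ge>0. size_of (\<lambda>k. z k t) < r) \<and>
      (\<forall>t\<ge>0. \<forall>k<d. (z k has_vector_derivative err_field d a (\<lambda>k. z k t) k) (at t within {0..}))"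
    have posN: "\<delta> / N > 0" "N * M > 0" using pos N by auto
    have main: "(\<exists>Xh xh. observer_from G d a u X Xh0 xh0 Xh xh) \<and>
      (\<forall>Xh xh. observer_from G d a u X Xh0 xh0 Xh xh \<longrightarrow>
      (\<forall>t\<ge>0. equilibrium_distance d (group_error (X t) (Xh t)) (\<lambda>i. x i t - xh i t)
        \<le> N * M * exp (- \<kappa> * t) * equilibrium_distance d (group_error (X 0) Xh0) (\<lambda>i. x i 0 - xh0 i)))"
      if sys: "system_solution G d u X x" and Xh0: "Xh0 \<in> G" and xh0: "\<forall>i\<in>{2..d}. xh0 i \<in> lie_algebra G"
        and init: "equilibrium_distance d (group_error (X 0) Xh0) (\<lambda>i. x i 0 - xh0 i) < \<delta> / N" for u X x Xh0 xh0
    proof (intro conjI allI impI)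
      define z0 where "z0 = err_coord d (group_error (X 0) Xh0) (\<lambda>i. x i 0 - xh0 i)"
      define q where "q = equilibrium_distance d (group_error (X 0) Xh0) (\<lambda>i. x i 0 - xh0 i)"
      have zq: "size_of z0 \<le> N * q"
        unfolding z0_def q_def N_def by (rule equilibrium_distance_bounds(2))
      also have "N * q < \<delta>" using init N by (simp add: q_def[symmetric] field_simps)
      finally have z0: "size_of z0 < \<delta>" .
      have X0: "X 0 \<in> G" and x0: "\<And>i. i \<in> {2..d} \<Longrightarrow> x i 0 \<in> lie_algebra G"
        using sys by (auto simp: system_solution_def)
      obtain z where z: "\<And>k. k < d \<Longrightarrow> z k 0 = z0 k" "\<And>t. t \<ge> 0 \<Longrightarrow> size_of (\<lambda>k. z k t) < r"
        "\<And>t k. t \<ge> 0 \<Longrightarrow> k < d \<Longrightarrow> (z k has_vector_derivative err_field d a (\<lambda>k. z k t) k) (at t within {0..})"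
        using ex[OF z0] by blast
      have ztop: "z (d - 1) 0 = group_error (X 0) Xh0 - mat 1" using z(1)[of "d - 1"] d by (simp add: z0_def err_coord_def)
      have zlow: "z k 0 = - (x (d - k) 0 - xh0 (d - k))" if "k < d - 1" for k
        using z(1)[of k] that by (simp add: z0_def err_coord_def)
      have inv: "mat 1 + z (d - 1) t \<in> G \<and> (\<forall>k<d-1. z k t \<in> lie_algebra G)" if "t \<ge> 0" for t
      proof (rule invariance[OF \<delta>0(2) r(1-3) z(3,2) _ _ that])
        show "mat 1 + z (d - 1) 0 \<in> G" unfolding ztop using X0 Xh0 by (simp add: group_error_def G_mult G_inv)
        fix k assume k: "k < d - 1"
        then have "d - k \<in> {2..d}" by auto
        then have "- (x (d - k) 0 - xh0 (d - k)) \<in> lie_algebra G"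
          using x0 xh0 by (intro subspace_neg[OF subspace_lie_algebra] subspace_diff[OF subspace_lie_algebra]) auto
        then show "z k 0 \<in> lie_algebra G" using zlow[OF k] by simp
      qed
      show "\<exists>Xh xh. observer_from G d a u X Xh0 xh0 Xh xh"
      proof (intro exI conjI ballI)
        show "observer_solution G d a u X (\<lambda>t. X t ** (mat 1 + z (d - 1) t)) (\<lambda>i t. x i t + z (d - i) t)"
        proof (rule observer_of_error[OF sys z(3)])
          show "size_of (\<lambda>k. z k t) < rho" if "t \<ge> 0" for t using z(2)[OF that] r by simp
        qed (use inv in auto)
        show "X 0 ** (mat 1 + z (d - 1) 0) = Xh0"
          unfolding ztop using invertible_inverse[OF G_invertible[OF X0]] by (simp add: group_error_def matrix_mul_assoc)
        fix i assume "i \<in> {2..d}"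
        then have "d - i < d - 1" "d - (d - i) = i" using d by auto
        then show "x i 0 + z (d - i) 0 = xh0 i" using zlow[of "d - i"] by simp
      qed
      fix Xh xh t
      assume A: "observer_from G d a u X Xh0 xh0 Xh xh" and t: "(t::real) \<ge> 0"
      define y where "y = (\<lambda>k t. err_coord d (group_error (X t) (Xh t)) (\<lambda>i. x i t - xh i t) k)"
      have y0: "y k 0 = z0 k" if "k < d" for k
        using A that by (auto simp: y_def z0_def err_coord_def)
      then have sy: "size_of (\<lambda>k. y k 0) = size_of z0" by (intro sum.cong) auto
      have "size_of (\<lambda>k. y k t) \<le> M * exp (- \<kappa> * t) * size_of (\<lambda>k. y k 0)"
      proof (rule decay)
        show "(y k has_vector_derivative err_field d a (\<lambda>k. y k t) k) (at t within {0..})" if "t \<ge> 0" "k < d" for t k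
          unfolding y_def using A by (intro observer_solution_error[OF sys _ that]) simp
      qed (use sy z0 t in simp_all)
      also have "\<dots> \<le> M * exp (- \<kappa> * t) * (N * q)" unfolding sy using zq pos by (intro mult_left_mono) auto
      finally have "size_of (\<lambda>k. y k t) \<le> N * M * exp (- \<kappa> * t) * q" by (simp add: mult_ac)
      then show "equilibrium_distance d (group_error (X t) (Xh t)) (\<lambda>i. x i t - xh i t)
        \<le> N * M * exp (- \<kappa> * t) * equilibrium_distance d (group_error (X 0) Xh0) (\<lambda>i. x i 0 - xh0 i)"
        unfolding q_def y_def using equilibrium_distance_bounds(1) order_trans by fast
    qed
    show ?thesis
      by (rule exI[of _ "\<delta> / N"], rule conjI[OF posN(1)], rule exI[of _ "N * M"], rule conjI[OF posN(2)],
          rule exI[of _ \<kappa>], rule conjI[OF pos(3)], intro allI impI, elim conjE, rule main; assumption)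
  qed
qed

end

lemma opnorm_diff_commute: "opnorm (A - B) = opnorm (B - A)" for A B :: "real^'n::finite^'n"
  using opnorm_minus[of "A - B"] by simp

theorem mainTheorem3:
  fixes G :: "(real ^ 'n::finite ^ 'n) set"
    and d :: nat
    and a :: "nat \<Rightarrow> real"
    and u :: "real \<Rightarrow> real ^ 'n ^ 'n"
  assumes "linear_lie_group G"
    and "d \<ge> 2"
    and "\<forall>t. u t \<in> lie_algebra G"
    and "smooth_curve u"
    and "bounded (range u)"
    and "locally_lipschitz u"
    and "hurwitz (monic_poly d a)"
  shows "exponentially_stabilizes G d a u (opball (mat 1) 1 \<times> UNIV) \<and>
    ((\<forall>X x. system_solution G d u X x \<longrightarrow> bounded (X ` {0..})) \<longrightarrow>
     (\<forall>X x. system_solution G d u X x \<longrightarrow>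
       (\<exists>\<delta>>0. \<forall>Xh0 xh0.
          Xh0 \<in> G \<and> (\<forall>i\<in>{2..d}. xh0 i \<in> lie_algebra G) \<and>
          opnorm (Xh0 - X 0) < \<delta> \<and> (\<forall>i\<in>{2..d}. opnorm (xh0 i - x i 0) < \<delta>) \<longrightarrow>
          (\<exists>Xh xh. observer_solution G d a u X Xh xh \<and>
             Xh 0 = Xh0 \<and> (\<forall>i\<in>{2..d}. xh i 0 = xh0 i)) \<and>
          (\<forall>Xh xh. observer_solution G d a u X Xh xh \<and>
             Xh 0 = Xh0 \<and> (\<forall>i\<in>{2..d}. xh i 0 = xh0 i) \<longrightarrow>
             exponentially_vanishes (\<lambda>t. opnorm (Xh t - X t)) \<and>
             (\<forall>i\<in>{2..d}. exponentially_vanishes (\<lambda>t. opnorm (xh i t - x i t)))))))"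
proof -
  obtain rho c where "exp_log_bounds TYPE('n) rho c" using exp_log_bounds_exist by blast
  then interpret exp_log_bounds rho c "TYPE('n)" .
  interpret observer_error rho c "TYPE('n)" G d a
    by unfold_locales (fact assms)+
  obtain \<delta> M \<kappa> where pos: "\<delta> > 0" "M > 0" "\<kappa> > 0"
    and S: "\<forall>u X x Xh0 xh0. system_solution G d u X x \<and> Xh0 \<in> G \<and> (\<forall>i\<in>{2..d}. xh0 i \<in> lie_algebra G) \<and>
      equilibrium_distance d (group_error (X 0) Xh0) (\<lambda>i. x i 0 - xh0 i) < \<delta> \<longrightarrow>
      (\<exists>Xh xh. observer_from G d a u X Xh0 xh0 Xh xh) \<and>
      (\<forall>Xh xh. observer_from G d a u X Xh0 xh0 Xh xh \<longrightarrow>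
        (\<forall>t\<ge>0. equilibrium_distance d (group_error (X t) (Xh t)) (\<lambda>i. x i t - xh i t)
          \<le> M * exp (- \<kappa> * t) * equilibrium_distance d (group_error (X 0) Xh0) (\<lambda>i. x i 0 - xh0 i)))"
    using observer_stability by (elim exE conjE) (rule that)
  note stab = S[THEN spec, THEN spec, THEN spec, THEN spec, THEN spec, THEN mp]
  show ?thesis
  proof (intro conjI allI impI)
    show "exponentially_stabilizes G d a u (opball (mat 1) 1 \<times> UNIV)"
      unfolding exponentially_stabilizes_def
      by (rule exI[of _ \<delta>], rule conjI[OF pos(1)], rule exI[of _ M], rule conjI[OF pos(2)],
          rule exI[of _ \<kappa>], rule conjI[OF pos(3)], intro allI impI, rule stab) blast
  next
    fix X x
    assume bdd: "\<forall>X x. system_solution G d u X x \<longrightarrow> bounded (X ` {0..})" and sys: "system_solution G d u X x"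
    have XG: "X t \<in> G" if "t \<ge> 0" for t using sys that by (simp add: system_solution_def)
    obtain \<beta> where \<beta>: "\<beta> > 0" "\<And>t. t \<ge> 0 \<Longrightarrow> norm (X t) \<le> \<beta>"
      using bdd sys unfolding bounded_pos by (metis atLeast_iff imageI)
    \<comment> \<open>bounds the initial equilibrium distance in terms of the initial estimation errors\<close>
    define b where "b = opnorm (matrix_inv (X 0)) + real d + 1"
    have b: "b > 0" using opnorm_nonneg[of "matrix_inv (X 0)"] by (simp add: b_def)
    have "\<delta> / b > 0" using pos b by simp
    moreover have "(\<exists>Xh xh. observer_from G d a u X Xh0 xh0 Xh xh) \<and>
          (\<forall>Xh xh. observer_from G d a u X Xh0 xh0 Xh xh \<longrightarrow>
             exponentially_vanishes (\<lambda>t. opnorm (Xh t - X t)) \<and>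
             (\<forall>i\<in>{2..d}. exponentially_vanishes (\<lambda>t. opnorm (xh i t - x i t))))"
      if "Xh0 \<in> G \<and> (\<forall>i\<in>{2..d}. xh0 i \<in> lie_algebra G) \<and>
          opnorm (Xh0 - X 0) < \<delta> / b \<and> (\<forall>i\<in>{2..d}. opnorm (xh0 i - x i 0) < \<delta> / b)" for Xh0 xh0
    proof -
      define q where "q = equilibrium_distance d (group_error (X 0) Xh0) (\<lambda>i. x i 0 - xh0 i)"
      have q0: "q \<ge> 0" unfolding q_def equilibrium_distance_def by (intro add_nonneg_nonneg sum_nonneg opnorm_nonneg)
      have "group_error (X 0) Xh0 - mat 1 = matrix_inv (X 0) ** (Xh0 - X 0)"
        using invertible_inverse[OF G_invertible[OF XG[of 0]]] by (simp add: group_error_def mm.diff_right)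
      then have "opnorm (group_error (X 0) Xh0 - mat 1) \<le> opnorm (matrix_inv (X 0)) * opnorm (Xh0 - X 0)"
        by (simp add: opnorm_mult_le)
      also have "\<dots> \<le> opnorm (matrix_inv (X 0)) * (\<delta> / b)" using that by (intro mult_left_mono opnorm_nonneg) auto
      finally have 1: "opnorm (group_error (X 0) Xh0 - mat 1) \<le> opnorm (matrix_inv (X 0)) * (\<delta> / b)" .
      have "(\<Sum>i=2..d. opnorm (x i 0 - xh0 i)) \<le> (\<Sum>i=2..d. \<delta> / b)"
        using that by (intro sum_mono) (auto simp: opnorm_diff_commute[of "x _ 0"] less_imp_le)
      also have "\<dots> \<le> real d * (\<delta> / b)" using pos b by (simp add: divide_right_mono mult_right_mono)
      finally have "q \<le> opnorm (matrix_inv (X 0)) * (\<delta> / b) + real d * (\<delta> / b)"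
        unfolding q_def equilibrium_distance_def using 1 by (intro add_mono)
      also have "\<dots> < b * (\<delta> / b)" using \<open>\<delta> / b > 0\<close> by (simp only: b_def distrib_right)
      also have "\<dots> = \<delta>" using b by simp
      finally have small: "q < \<delta>" .
      note S = stab[of u X x Xh0 xh0, folded q_def]
      have ex: "\<exists>Xh xh. observer_from G d a u X Xh0 xh0 Xh xh"
        using S sys that small by blast
      have "exponentially_vanishes (\<lambda>t. opnorm (Xh t - X t)) \<and>
             (\<forall>i\<in>{2..d}. exponentially_vanishes (\<lambda>t. opnorm (xh i t - x i t)))"
        if obs: "observer_from G d a u X Xh0 xh0 Xh xh" for Xh xh
      proof -
        define D where "D t = equilibrium_distance d (group_error (X t) (Xh t)) (\<lambda>i. x i t - xh i t)" for t
        have D: "D t \<le> M * exp (- \<kappa> * t) * q" if "t \<ge> 0" for t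
          unfolding D_def using S sys \<open>Xh0 \<in> G \<and> _\<close> small obs that by blast
        have part: "opnorm (group_error (X t) (Xh t) - mat 1) \<le> D t" for t
          unfolding D_def equilibrium_distance_def by (simp add: sum_nonneg opnorm_nonneg)
        have "opnorm (xh i t - x i t) \<le> D t" if "i \<in> {2..d}" for i t
        proof -
          have "opnorm (x i t - xh i t) \<le> (\<Sum>i=2..d. opnorm (x i t - xh i t))"
            using that by (intro member_le_sum[of i "{2..d}" "\<lambda>i. opnorm (x i t - xh i t)"] opnorm_nonneg) auto
          then show ?thesis
            unfolding D_def equilibrium_distance_def
            using opnorm_nonneg[of "group_error (X t) (Xh t) - mat 1"] opnorm_diff_commute[of "xh i t" "x i t"] by linarith
        qed
        note part_i = this
        have van: "exponentially_vanishes f" if "\<And>t. t \<ge> 0 \<Longrightarrow> \<bar>f t\<bar> \<le> K * D t" "K \<ge> 0" for f K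
        proof -
          have pos': "0 < K * M * q + 1" using that(2) pos q0 by (intro add_nonneg_pos mult_nonneg_nonneg) auto
          have "\<bar>f t\<bar> \<le> (K * M * q + 1) * exp (- \<kappa> * t)" if t: "t \<ge> 0" for t
          proof -
            have "\<bar>f t\<bar> \<le> K * (M * exp (- \<kappa> * t) * q)"
              using \<open>\<And>t. t \<ge> 0 \<Longrightarrow> \<bar>f t\<bar> \<le> K * D t\<close>[OF t] mult_left_mono[OF D[OF t] \<open>K \<ge> 0\<close>] by linarith
            also have "\<dots> \<le> (K * M * q + 1) * exp (- \<kappa> * t)" by (simp add: algebra_simps)
            finally show ?thesis .
          qed
          then show ?thesis unfolding exponentially_vanishes_def using pos' pos(3) by blast
        qed
        show ?thesis
        proof (intro conjI ballI)
          show "exponentially_vanishes (\<lambda>t. opnorm (Xh t - X t))"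
          proof (rule van[of _ \<beta>])
            fix t :: real assume t: "t \<ge> 0"
            have "Xh t - X t = X t ** (group_error (X t) (Xh t) - mat 1)"
              using invertible_inverse[OF G_invertible[OF XG[OF t]]]
              by (simp add: group_error_def mm.diff_right matrix_mul_assoc)
            then have "opnorm (Xh t - X t) \<le> opnorm (X t) * opnorm (group_error (X t) (Xh t) - mat 1)"
              by (simp add: opnorm_mult_le)
            also have "\<dots> \<le> \<beta> * D t"
              using \<beta> order_trans[OF opnorm_le_norm \<beta>(2)[OF t]] part[of t] by (intro mult_mono opnorm_nonneg) auto
            finally show "\<bar>opnorm (Xh t - X t)\<bar> \<le> \<beta> * D t" using opnorm_nonneg[of "Xh t - X t"] by simp
          qed (use \<beta> in simp)
          fix i assume "i \<in> {2..d}"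
          then show "exponentially_vanishes (\<lambda>t. opnorm (xh i t - x i t))"
            by (intro van[of _ 1]) (simp_all add: part_i opnorm_nonneg)
        qed
      qed
      with ex show ?thesis by blast
    qed
    ultimately show "\<exists>\<delta>>0. \<forall>Xh0 xh0. Xh0 \<in> G \<and> (\<forall>i\<in>{2..d}. xh0 i \<in> lie_algebra G) \<and>
          opnorm (Xh0 - X 0) < \<delta> \<and> (\<forall>i\<in>{2..d}. opnorm (xh0 i - x i 0) < \<delta>) \<longrightarrow>
          (\<exists>Xh xh. observer_from G d a u X Xh0 xh0 Xh xh) \<and>
          (\<forall>Xh xh. observer_from G d a u X Xh0 xh0 Xh xh \<longrightarrow>
             exponentially_vanishes (\<lambda>t. opnorm (Xh t - X t)) \<and>
             (\<forall>i\<in>{2..d}. exponentially_vanishes (\<lambda>t. opnorm (xh i t - x i t))))"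
      by blast
  qed
qed

end
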